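(* Let $\Lambda$ be a field (with involution) with $\mathrm{char}\,\Lambda\neq2$, or let $\Lambda=\mathbb Z/2\mathbb Z$, and set $Z=\widetilde K_1(\Lambda)$. Then all elements of $l_{2q+1}(\Lambda)$ are elementary.
   Context: $q\ge1$, $\epsilon=(-1)^q$, and $\Lambda$ has an involution $x\mapsto\bar x$. In general one fixes a subgroup $Z\subset\widetilde K_1(\Lambda)=\mathrm{coker}(K_1(\mathbb Z)\to K_1(\Lambda))$ and calls isomorphisms of based modules simple when their torsion lies in $Z$; the choice $Z=\widetilde K_1(\Lambda)$ means that all isomorphisms are simple and all choices of bases are equivalent, so bases may be ignored. For a finitely generated module (vector space) $M$ let $T_\epsilon$ act on $\mathrm{Hom}(M,M^* )$ by $(T_\epsilon\phi)(x)(y)=\epsilon\overline{\phi(y)(x)}$ and $Q_\epsilon(M)=\mathrm{coker}(1-T_\epsilon)$. An $\epsilon$-quadratic form is $(M,\psi)$ with $\psi\in Q_\epsilon(M)$, nonsingular if $\psi+\epsilon\psi^*\colon M\to M^*$ is an isomorphism; isometries are isomorphisms preserving $\psi$. $H_\epsilon(L)=(L\oplus L^*,\begin{pmatrix}0&1\\0&0\end{pmatrix})$. A Lagrangian of $(M,\psi)$ is a direct summand $L$ with $L=L^\perp$ with respect to $\psi+\epsilon\psi^*$ and $\psi|_L=0\in Q_\epsilon(L)$. A quasi-formation $(M,\psi;L,V)$ is a nonsingular form with a Lagrangian $L$ and a half-rank direct summand $V$. Isomorphisms are isometries carrying $L$ to $L'$ and $V$ to $V'$. Trivial formations are $(H_\epsilon(P);P,P^*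 )$; stable isomorphism is isomorphism after adding trivial formations. $l_{2q+1}(\Lambda)$ is the abelian monoid (direct sum) of stable isomorphism classes of quasi-formations modulo $(M,\psi;K,L)\oplus(M,\psi;L,V)\sim(M,\psi;K,V)$ for Lagrangians $K,L$. An element is elementary if it is represented by a boundary $\delta(K,\rho)=(H_\epsilon(K);K,\begin{pmatrix}1\\\rho\end{pmatrix}K)$, $\rho\in\mathrm{Hom}(K,K^* )$ arbitrary. *)

theory Defs
  imports
    Complex_Main
    "HOL-Algebra.Group"
    "HOL-Library.Function_Algebras"
    "HOL-Library.Product_Plus"
begin

section \<open>Finitely generated modules over a field with involution\<close>

text \<open>The ground field is a type \<open>'a\<close> of class \<^class>\<open>field\<close>; \<open>bar\<close> is its involution (possibly
  the identity).\<close>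

definition is_involution :: "('a::field \<Rightarrow> 'a) \<Rightarrow> bool" where
  "is_involution bar \<longleftrightarrow>
     (\<forall>x y. bar (x + y) = bar x + bar y) \<and> (\<forall>x y. bar (x * y) = bar y * bar x) \<and>
     bar 1 = 1 \<and> (\<forall>x. bar (bar x) = x)"

text \<open>A module is a subspace (the carrier) of some ambient vector space. Addition is that
  of the ambient type, the scalar multiplication is part of the data, so that a
  module and its dual can carry different ones.\<close>

record ('a, 'v) space = "'v partial_object" +
  smul :: "'a \<Rightarrow> 'v \<Rightarrow> 'v"

definition fg_space :: "('a::field, 'v::ab_group_add) space \<Rightarrow> bool" where
  "fg_space M \<longleftrightarrow> vector_space (smul M) \<and>
     (\<exists>B. finite B \<and> carrier M = module.span (smul M) B)"

text \<open>Maps are normalised to vanish outside the carrier of the source, so that equality of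
  homomorphisms is equality of functions.\<close>

definition lin_hom ::
  "('a::field, 'v::ab_group_add) space \<Rightarrow> ('a, 'w::ab_group_add) space \<Rightarrow> ('v \<Rightarrow> 'w) set" where
  "lin_hom M N = {f. f \<in> carrier M \<rightarrow> carrier N \<and>
     (\<forall>x\<in>carrier M. \<forall>y\<in>carrier M. f (x + y) = f x + f y) \<and>
     (\<forall>a. \<forall>x\<in>carrier M. f (smul M a x) = smul N a (f x)) \<and>
     (\<forall>x. x \<notin> carrier M \<longrightarrow> f x = 0)}"

definition lin_iso ::
  "('a::field, 'v::ab_group_add) space \<Rightarrow> ('a, 'w::ab_group_add) space \<Rightarrow> ('v \<Rightarrow> 'w) set" where
  "lin_iso M N = {f \<in> lin_hom M N. bij_betw f (carrier M) (carrier N)}"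

definition sum_space ::
  "('a::field, 'v::ab_group_add) space \<Rightarrow> ('a, 'w::ab_group_add) space \<Rightarrow> ('a, 'v \<times> 'w) space" where
  "sum_space M N = \<lparr>carrier = carrier M \<times> carrier N,
     smul = (\<lambda>a (x, y). (smul M a x, smul N a y))\<rparr>"

definition sub_space :: "('a::field, 'v::ab_group_add) space \<Rightarrow> 'v set \<Rightarrow> ('a, 'v) space" where
  "sub_space M L = M\<lparr>carrier := L\<rparr>"

definition direct_summand :: "('a::field, 'v::ab_group_add) space \<Rightarrow> 'v set \<Rightarrow> bool" where
  "direct_summand M L \<longleftrightarrow> module.subspace (smul M) L \<and>
     (\<exists>N. module.subspace (smul M) N \<and> L \<inter> N = {0} \<and>
          {x + y | x y. x \<in> L \<and> y \<in> N} = carrier M)"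

definition half_rank_summand :: "('a::field, 'v::ab_group_add) space \<Rightarrow> 'v set \<Rightarrow> bool" where
  "half_rank_summand M V \<longleftrightarrow> direct_summand M V \<and>
     2 * vector_space.dim (smul M) V = vector_space.dim (smul M) (carrier M)"

text \<open>The dual \<open>Hom(M, \<Lambda>)\<close>, a module via \<open>(a \<cdot> f)(x) = f(x) bar(a)\<close>.\<close>

definition dual :: "('a::field \<Rightarrow> 'a) \<Rightarrow> ('a, 'v::ab_group_add) space \<Rightarrow> ('a, 'v \<Rightarrow> 'a) space" where
  "dual bar M = \<lparr>carrier = lin_hom M \<lparr>carrier = UNIV, smul = (*)\<rparr>,
     smul = (\<lambda>a f x. f x * bar a)\<rparr>"


section \<open>Quadratic forms\<close>

abbreviation form_hom ::
  "('a::field \<Rightarrow> 'a) \<Rightarrow> ('a, 'v::ab_group_add) space \<Rightarrow> ('v \<Rightarrow> 'v \<Rightarrow> 'a) set" where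
  "form_hom bar M \<equiv> lin_hom M (dual bar M)"

definition form_T :: "('a::field \<Rightarrow> 'a) \<Rightarrow> 'a \<Rightarrow> ('v \<Rightarrow> 'v \<Rightarrow> 'a) \<Rightarrow> 'v \<Rightarrow> 'v \<Rightarrow> 'a" where
  "form_T bar e \<phi> = (\<lambda>x y. e * bar (\<phi> y x))"

definition quad_rel ::
  "('a::field \<Rightarrow> 'a) \<Rightarrow> 'a \<Rightarrow> ('a, 'v::ab_group_add) space \<Rightarrow> (('v \<Rightarrow> 'v \<Rightarrow> 'a) \<times> ('v \<Rightarrow> 'v \<Rightarrow> 'a)) set" where
  "quad_rel bar e M = {(\<phi>, \<phi>'). \<phi> \<in> form_hom bar M \<and> \<phi>' \<in> form_hom bar M \<and>
     (\<exists>\<chi>\<in>form_hom bar M. \<phi> - \<phi>' = \<chi> - form_T bar e \<chi>)}"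

text \<open>\<open>Q\<^sub>\<epsilon>(M)\<close>, the cokernel of \<open>1 - T\<^sub>\<epsilon>\<close>; its elements are cosets.\<close>

definition Q_group ::
  "('a::field \<Rightarrow> 'a) \<Rightarrow> 'a \<Rightarrow> ('a, 'v::ab_group_add) space \<Rightarrow> ('v \<Rightarrow> 'v \<Rightarrow> 'a) set set" where
  "Q_group bar e M = form_hom bar M // quad_rel bar e M"

definition Q_class ::
  "('a::field \<Rightarrow> 'a) \<Rightarrow> 'a \<Rightarrow> ('a, 'v::ab_group_add) space \<Rightarrow> ('v \<Rightarrow> 'v \<Rightarrow> 'a) \<Rightarrow> ('v \<Rightarrow> 'v \<Rightarrow> 'a) set" where
  "Q_class bar e M \<phi> = quad_rel bar e M `` {\<phi>}"

text \<open>\<open>\<psi> + \<epsilon>\<psi>\<^sup>*\<close>: all representatives \<open>\<phi>\<close> of \<open>\<psi>\<close> give the same \<open>\<phi> + T\<^sub>\<epsilon>\<phi>\<close>.\<close>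

definition symmetrization ::
  "('a::field \<Rightarrow> 'a) \<Rightarrow> 'a \<Rightarrow> ('v \<Rightarrow> 'v \<Rightarrow> 'a) set \<Rightarrow> 'v \<Rightarrow> 'v \<Rightarrow> 'a" where
  "symmetrization bar e \<psi> = the_elem ((\<lambda>\<phi>. \<phi> + form_T bar e \<phi>) ` \<psi>)"

definition restrict_form ::
  "('a::field, 'v::ab_group_add) space \<Rightarrow> ('v \<Rightarrow> 'v \<Rightarrow> 'a) \<Rightarrow> 'v \<Rightarrow> 'v \<Rightarrow> 'a" where
  "restrict_form M \<phi> = (\<lambda>x y. if x \<in> carrier M \<and> y \<in> carrier M then \<phi> x y else 0)"

text \<open>Induced operations on cosets, as unions over representatives: pullback \<open>f\<^sup>*\<psi>\<close> along
  \<open>f : M \<rightarrow> N\<close>, and the orthogonal sum of two forms.\<close>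

definition Q_pullback ::
  "('a::field \<Rightarrow> 'a) \<Rightarrow> 'a \<Rightarrow> ('a, 'v::ab_group_add) space \<Rightarrow> ('v \<Rightarrow> 'w) \<Rightarrow>
   ('w \<Rightarrow> 'w \<Rightarrow> 'a) set \<Rightarrow> ('v \<Rightarrow> 'v \<Rightarrow> 'a) set" where
  "Q_pullback bar e M f \<psi> =
     (\<Union>\<phi>\<in>\<psi>. Q_class bar e M (restrict_form M (\<lambda>x y. \<phi> (f x) (f y))))"

definition Q_sum ::
  "('a::field \<Rightarrow> 'a) \<Rightarrow> 'a \<Rightarrow> ('a, 'v::ab_group_add) space \<Rightarrow> ('a, 'w::ab_group_add) space \<Rightarrow>
   ('v \<Rightarrow> 'v \<Rightarrow> 'a) set \<Rightarrow> ('w \<Rightarrow> 'w \<Rightarrow> 'a) set \<Rightarrow> ('v \<times> 'w \<Rightarrow> 'v \<times> 'w \<Rightarrow> 'a) set" where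
  "Q_sum bar e M N \<psi> \<psi>' = (\<Union>\<phi>\<in>\<psi>. \<Union>\<phi>'\<in>\<psi>'. Q_class bar e (sum_space M N)
     (restrict_form (sum_space M N) (\<lambda>(x, x') (y, y'). \<phi> x y + \<phi>' x' y')))"

definition nonsingular_form ::
  "('a::field \<Rightarrow> 'a) \<Rightarrow> 'a \<Rightarrow> ('a, 'v::ab_group_add) space \<Rightarrow> ('v \<Rightarrow> 'v \<Rightarrow> 'a) set \<Rightarrow> bool" where
  "nonsingular_form bar e M \<psi> \<longleftrightarrow>
     fg_space M \<and> \<psi> \<in> Q_group bar e M \<and> symmetrization bar e \<psi> \<in> lin_iso M (dual bar M)"

definition orthogonal_compl ::
  "('a::field \<Rightarrow> 'a) \<Rightarrow> 'a \<Rightarrow> ('a, 'v::ab_group_add) space \<Rightarrow> ('v \<Rightarrow> 'v \<Rightarrow> 'a) set \<Rightarrow> 'v set \<Rightarrow> 'v set" where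
  "orthogonal_compl bar e M \<psi> L = {x \<in> carrier M. \<forall>y\<in>L. symmetrization bar e \<psi> x y = 0}"

definition lagrangian ::
  "('a::field \<Rightarrow> 'a) \<Rightarrow> 'a \<Rightarrow> ('a, 'v::ab_group_add) space \<Rightarrow> ('v \<Rightarrow> 'v \<Rightarrow> 'a) set \<Rightarrow> 'v set \<Rightarrow> bool" where
  "lagrangian bar e M \<psi> L \<longleftrightarrow> direct_summand M L \<and> L = orthogonal_compl bar e M \<psi> L \<and>
     Q_pullback bar e (sub_space M L) (\<lambda>x. x) \<psi> = Q_class bar e (sub_space M L) 0"

text \<open>\<open>H\<^sub>\<epsilon>(L) = (L \<oplus> L\<^sup>*, \<psi>)\<close>: the matrix with upper right entry \<open>1\<close> and
  zeros elsewhere sends \<open>(x, f)\<close> to the functional \<open>(y, g) \<mapsto> f(y)\<close>.\<close>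

definition hyp_space ::
  "('a::field \<Rightarrow> 'a) \<Rightarrow> ('a, 'v::ab_group_add) space \<Rightarrow> ('a, 'v \<times> ('v \<Rightarrow> 'a)) space" where
  "hyp_space bar L = sum_space L (dual bar L)"

definition hyp_form ::
  "('a::field \<Rightarrow> 'a) \<Rightarrow> 'a \<Rightarrow> ('a, 'v::ab_group_add) space \<Rightarrow>
   ('v \<times> ('v \<Rightarrow> 'a) \<Rightarrow> 'v \<times> ('v \<Rightarrow> 'a) \<Rightarrow> 'a) set" where
  "hyp_form bar e L = Q_class bar e (hyp_space bar L)
     (restrict_form (hyp_space bar L) (\<lambda>(x, f) (y, g). f y))"


section \<open>Quasi-formations\<close>

text \<open>All isomorphisms are regarded as simple (\<open>Z\<close> is the whole reduced \<open>K\<^sub>1\<close>), so no bases are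
  recorded.\<close>

record ('a, 'v) quasi_formation =
  qspace :: "('a, 'v) space"
  qform :: "('v \<Rightarrow> 'v \<Rightarrow> 'a) set"
  qlag :: "'v set"
  qhalf :: "'v set"

definition is_quasi_formation ::
  "('a::field \<Rightarrow> 'a) \<Rightarrow> 'a \<Rightarrow> ('a, 'v::ab_group_add) quasi_formation \<Rightarrow> bool" where
  "is_quasi_formation bar e F \<longleftrightarrow>
     nonsingular_form bar e (qspace F) (qform F) \<and>
     lagrangian bar e (qspace F) (qform F) (qlag F) \<and>
     half_rank_summand (qspace F) (qhalf F)"

definition qf_isomorphic ::
  "('a::field \<Rightarrow> 'a) \<Rightarrow> 'a \<Rightarrow> ('a, 'v::ab_group_add) quasi_formation \<Rightarrow>
   ('a, 'w::ab_group_add) quasi_formation \<Rightarrow> bool" where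
  "qf_isomorphic bar e F G \<longleftrightarrow> (\<exists>f\<in>lin_iso (qspace F) (qspace G).
     Q_pullback bar e (qspace F) f (qform G) = qform F \<and>
     f ` qlag F = qlag G \<and> f ` qhalf F = qhalf G)"

definition qf_sum ::
  "('a::field \<Rightarrow> 'a) \<Rightarrow> 'a \<Rightarrow> ('a, 'v::ab_group_add) quasi_formation \<Rightarrow>
   ('a, 'w::ab_group_add) quasi_formation \<Rightarrow> ('a, 'v \<times> 'w) quasi_formation" where
  "qf_sum bar e F G = \<lparr>qspace = sum_space (qspace F) (qspace G),
     qform = Q_sum bar e (qspace F) (qspace G) (qform F) (qform G),
     qlag = qlag F \<times> qlag G, qhalf = qhalf F \<times> qhalf G\<rparr>"

definition trivial_formation ::
  "('a::field \<Rightarrow> 'a) \<Rightarrow> 'a \<Rightarrow> ('a, 'v::ab_group_add) space \<Rightarrow>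
   ('a, 'v \<times> ('v \<Rightarrow> 'a)) quasi_formation" where
  "trivial_formation bar e P = \<lparr>qspace = hyp_space bar P, qform = hyp_form bar e P,
     qlag = carrier P \<times> {0}, qhalf = {0} \<times> carrier (dual bar P)\<rparr>"

definition boundary ::
  "('a::field \<Rightarrow> 'a) \<Rightarrow> 'a \<Rightarrow> ('a, 'v::ab_group_add) space \<Rightarrow> ('v \<Rightarrow> 'v \<Rightarrow> 'a) \<Rightarrow>
   ('a, 'v \<times> ('v \<Rightarrow> 'a)) quasi_formation" where
  "boundary bar e K \<rho> = \<lparr>qspace = hyp_space bar K, qform = hyp_form bar e K,
     qlag = carrier K \<times> {0}, qhalf = (\<lambda>x. (x, \<rho> x)) ` carrier K\<rparr>"


section \<open>The monoid \<open>l\<^bsub>2q+1\<^esub>\<close>\<close>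

text \<open>Isomorphism classes are formed inside the ambient type \<open>nat \<Rightarrow> 'a\<close>, which contains a copy
  of every finitely generated module over \<open>'a\<close>. Constructions such as direct sums or
  boundaries live on other types and are compared with it by the heterogeneous relation
  \<^const>\<open>qf_isomorphic\<close>.\<close>

type_synonym 'a univ = "nat \<Rightarrow> 'a"

definition stably_isomorphic ::
  "('a::field \<Rightarrow> 'a) \<Rightarrow> 'a \<Rightarrow> ('a, 'a univ) quasi_formation \<Rightarrow> ('a, 'a univ) quasi_formation \<Rightarrow> bool" where
  "stably_isomorphic bar e F G \<longleftrightarrow>
     (\<exists>(P :: ('a, 'a univ) space) (P' :: ('a, 'a univ) space). fg_space P \<and> fg_space P' \<and>
        qf_isomorphic bar e (qf_sum bar e F (trivial_formation bar e P))
                            (qf_sum bar e G (trivial_formation bar e P')))"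

text \<open>The congruence (with respect to direct sum) generated by stable isomorphism and
  \<open>(M,\<psi>;K,L) \<oplus> (M,\<psi>;L,V) \<sim> (M,\<psi>;K,V)\<close>.\<close>

inductive l_equiv ::
  "('a::field \<Rightarrow> 'a) \<Rightarrow> 'a \<Rightarrow> ('a, 'a univ) quasi_formation \<Rightarrow> ('a, 'a univ) quasi_formation \<Rightarrow> bool"
  for bar :: "'a::field \<Rightarrow> 'a" and e :: 'a
where
  stable: "\<lbrakk>is_quasi_formation bar e F; is_quasi_formation bar e G; stably_isomorphic bar e F G\<rbrakk>
    \<Longrightarrow> l_equiv bar e F G"
| compose: "\<lbrakk>nonsingular_form bar e M \<psi>; lagrangian bar e M \<psi> K; lagrangian bar e M \<psi> L;
     half_rank_summand M V; is_quasi_formation bar e F;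
     qf_isomorphic bar e F (qf_sum bar e \<lparr>qspace = M, qform = \<psi>, qlag = K, qhalf = L\<rparr>
                                         \<lparr>qspace = M, qform = \<psi>, qlag = L, qhalf = V\<rparr>)\<rbrakk>
    \<Longrightarrow> l_equiv bar e F \<lparr>qspace = M, qform = \<psi>, qlag = K, qhalf = V\<rparr>"
| add: "\<lbrakk>l_equiv bar e F G; is_quasi_formation bar e (E :: ('a, 'a univ) quasi_formation);
     is_quasi_formation bar e F'; qf_isomorphic bar e F' (qf_sum bar e F E);
     is_quasi_formation bar e G'; qf_isomorphic bar e G' (qf_sum bar e G E)\<rbrakk>
    \<Longrightarrow> l_equiv bar e F' G'"
| sym: "l_equiv bar e F G \<Longrightarrow> l_equiv bar e G F"
| trans: "l_equiv bar e F G \<Longrightarrow> l_equiv bar e G E \<Longrightarrow> l_equiv bar e F E"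

definition l_monoid ::
  "('a::field \<Rightarrow> 'a) \<Rightarrow> nat \<Rightarrow> ('a, 'a univ) quasi_formation set monoid" where
  "l_monoid bar q = (let e = (-1) ^ q in
     \<lparr>carrier = {F. is_quasi_formation bar e F} // {(F, G). l_equiv bar e F G},
      mult = (\<lambda>X Y. {G. \<exists>F\<in>X. \<exists>F'\<in>Y. \<exists>E. is_quasi_formation bar e E \<and>
        qf_isomorphic bar e E (qf_sum bar e F F') \<and> l_equiv bar e E G}),
      one = {G. \<exists>P :: ('a, 'a univ) space. \<exists>E. fg_space P \<and> is_quasi_formation bar e E \<and>
        qf_isomorphic bar e E (trivial_formation bar e P) \<and> l_equiv bar e E G}\<rparr>)"

definition elementary ::
  "('a::field \<Rightarrow> 'a) \<Rightarrow> nat \<Rightarrow> ('a, 'a univ) quasi_formation set \<Rightarrow> bool" where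
  "elementary bar q X \<longleftrightarrow> (\<exists>F\<in>X. \<exists>K :: ('a, 'a univ) space. \<exists>\<rho>\<in>form_hom bar K. fg_space K \<and>
     qf_isomorphic bar ((-1) ^ q) F (boundary bar ((-1) ^ q) K \<rho>))"

end

theory Submission
  imports Defs
begin

text \<open>A quasi-formation \<open>(M, \<psi>; L, V)\<close> is isomorphic to a boundary as soon as some Lagrangian \<open>K\<close> is a
complement of both \<open>L\<close> and \<open>V\<close>: then \<open>M = L \<oplus> K\<close>, the form identifies \<open>K\<close> with \<open>L\<^sup>*\<close>, so \<open>M\<close> becomes
\<open>H(L)\<close>, and \<open>V\<close>, being transverse to \<open>K\<close>, becomes the graph of a map \<open>L \<rightarrow> L\<^sup>*\<close> (\<open>boundary_splitting\<close>).
Such a \<open>K\<close> may fail to exist: the hyperbolic plane over a field with trivial involution and \<open>\<epsilon> = 1\<close> has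
only two Lagrangians, so none is a complement of both. But it exists after adding one
trivial formation, so every quasi-formation is stably isomorphic to a boundary.

To find it, choose a Lagrangian complement \<open>N\<close> of \<open>L\<close> (\<open>lagrangian_complement_exists\<close>). Let \<open>h\<close> be
the symmetrised form, \<open>p\<close> the projection of \<open>M\<close> onto \<open>L\<close> along \<open>N\<close>, and \<open>U = V \<inter> N\<close>, the obstruction
to taking \<open>K = N\<close>. Since \<open>V\<close> has half rank, the subspaces \<open>p V\<close> and \<open>U\<^sup>\<bottom> \<inter> L\<close> of \<open>L\<close> have the same
rank, and two subspaces of equal rank have a common complement \<open>Y\<close> in \<open>L\<close>
(\<open>common_complement_exists\<close>). That \<open>Y\<close> is a complement of \<open>U\<^sup>\<bottom> \<inter> L\<close> means that \<open>h\<close> pairs \<open>Y\<close> and \<open>U\<close>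
perfectly (\<open>dual_common_complement_exists\<close>); hence every \<open>z\<close> in \<open>N\<close> has a unique \<open>\<pi> z\<close> in \<open>U\<close> with
\<open>h y (\<pi> z) = h y z\<close> for all \<open>y\<close> in \<open>Y\<close>. In \<open>M \<oplus> H(U)\<close> take
\[ K = \{(y + z, \pi z, - h(y, \cdot)|_U) : y \in Y, z \in N\}. \]
The last coordinate is chosen so that the hyperbolic summand contributes \<open>- h y (\<pi> z') = - h y z'\<close>, which
cancels the pairing between \<open>Y\<close> and \<open>N\<close>; this is why \<open>K\<close> is isotropic (\<open>K_null\<close>). A point of \<open>K\<close> in
\<open>L \<oplus> U\<close> has \<open>h y = 0\<close> on \<open>U\<close>, so \<open>y = 0\<close>, and then \<open>z\<close> lies in \<open>L \<inter> N = 0\<close> (\<open>LT_K_complementary\<close>). For a point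
of \<open>K\<close> in \<open>V \<oplus> U\<^sup>*\<close>, \<open>y = p (y + z)\<close> lies in \<open>p V \<inter> Y = 0\<close>, so \<open>z\<close> lies in \<open>V \<inter> N = U\<close>, whence \<open>z = \<pi> z = 0\<close>
(\<open>VT_K_complementary\<close>).

The remaining work is translation. Quadratic forms are cosets modulo the forms \<open>\<chi> - T\<chi>\<close>; they are
handled through representatives, with the predicate \<open>null_on\<close> for being of that shape. The boundary
found above lives on a product type and is copied to the type of coordinate
vectors over which the monoid is formed (\<open>quasi_formation_univ_copy_exists\<close>).\<close>

section \<open>Subspaces of finite dimension\<close>

text \<open>Definitions made in \<^locale>\<open>vector_space\<close> itself are issued again for its global interpretation by
real vector spaces and would be read as notions about those; hence a locale of its own.\<close>

locale vspace = vector_space scale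
  for scale :: "'a::field \<Rightarrow> 'b::ab_group_add \<Rightarrow> 'b" (infixr "*s" 75)
begin

text \<open>The ambient type may be infinite-dimensional, so finite dimension is a property of a subset.\<close>

definition findim :: "'b set \<Rightarrow> bool" where
  "findim S \<longleftrightarrow> (\<exists>B. finite B \<and> S = span B)"

lemma findim_subspace: "findim S \<Longrightarrow> subspace S"
  by (auto simp: findim_def)

lemma findim_basis:
  assumes "findim S"
  obtains B where "finite B" "independent B" "span B = S" "card B = dim S"
proof -
  obtain C where C: "finite C" "S = span C"
    using assms findim_def by auto
  obtain B where B: "B \<subseteq> S" "independent B" "S \<subseteq> span B" "card B = dim S"
    using basis_exists .
  have "finite B" using independent_span_bound[OF C(1) B(2)] B(1) C(2) by auto
  moreover have "span B = S"
    using B(1,3) C(2) span_minimal[of B S] by auto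
  ultimately show ?thesis using B that by blast
qed

lemma findim_mono:
  assumes "findim S" "subspace A" "A \<subseteq> S"
  shows "findim A"
proof -
  obtain C where C: "finite C" "S = span C"
    using assms(1) findim_def by auto
  obtain B where B: "B \<subseteq> A" "independent B" "A \<subseteq> span B" "card B = dim A"
    using basis_exists .
  have "finite B" using independent_span_bound[OF C(1) B(2)] B(1) C(2) assms(3) by auto
  moreover have "span B = A"
    using B(1,3) assms(2) span_minimal[of B A] by auto
  ultimately show ?thesis unfolding findim_def by blast
qed

text \<open>Extend a basis of \<open>A\<close> to one of \<open>S\<close>; the new basis vectors span a complement.\<close>

lemma subspace_complement_exists:
  assumes "subspace A" "subspace S" "A \<subseteq> S"
  shows "\<exists>C. subspace C \<and> A \<inter> C = {0} \<and> {x + y | x y. x \<in> A \<and> y \<in> C} = S"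
proof -
  obtain B where B: "B \<subseteq> A" "independent B" "A \<subseteq> span B"
    using basis_exists by metis
  obtain B' where B': "B \<subseteq> B'" "B' \<subseteq> S" "independent B'" "S \<subseteq> span B'"
    using maximal_independent_subset_extend[of B S] B assms by blast
  have A: "A = span B" using B assms(1) span_minimal by blast
  have S: "S = span B'" using B' assms(2) span_minimal by blast
  have un: "B \<union> (B' - B) = B'" using B'(1) by auto
  have "x = 0" if x: "x \<in> span B" "x \<in> span (B' - B)" for x
  proof -
    have r1: "representation B' x = representation B x"
      using representation_extend[OF B'(3) x(1) B'(1)] .
    have r2: "representation B' x = representation (B' - B) x"
      using representation_extend[OF B'(3) x(2)] by auto
    have "representation B' x b = 0" for b
      using r1 r2 representation_ne_zero[of B x b] representation_ne_zero[of "B' - B" x b] by auto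
    moreover have "x \<in> span B'" using x(1) B'(1) span_mono by blast
    ultimately show ?thesis
      using sum_nonzero_representation_eq[OF B'(3), of x] by simp
  qed
  then have "A \<inter> span (B' - B) = {0}" by (auto simp: A span_zero)
  moreover have "{x + y | x y. x \<in> A \<and> y \<in> span (B' - B)} = S"
    unfolding A S using span_Un[of B "B' - B"] un by simp
  ultimately show ?thesis using subspace_span by blast
qed

lemma independent_Un_if_disjoint_spans:
  assumes "finite C" "independent B" "independent C" "span B \<inter> span C = {0}"
  shows "independent (B \<union> C)"
  using assms(1,3,4)
proof (induction C)
  case empty
  then show ?case using assms(2) by simp
next
  case (insert c C)
  have c: "c \<notin> span C" "independent C"
    using insert by (auto simp: independent_insert)
  have sub: "span C \<subseteq> span (insert c C)" by (rule span_mono) auto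
  then have "span B \<inter> span C = {0}" using insert.prems(2) span_zero by blast
  then have ind: "independent (B \<union> C)" using insert.IH c by simp
  have "c \<notin> span (B \<union> C)"
  proof
    assume "c \<in> span (B \<union> C)"
    then obtain x y where xy: "c = x + y" "x \<in> span B" "y \<in> span C"
      by (auto simp: span_Un)
    have "c - y \<in> span (insert c C)"
      using xy(3) sub by (intro span_diff) (auto intro: span_base)
    then have "x \<in> span (insert c C)" using xy(1) by simp
    then have "x = 0" using xy(2) insert.prems(2) by blast
    then show False using xy c by simp
  qed
  then show ?case using ind by (simp add: independent_insertI)
qed

lemma dim_direct_sum:
  assumes "findim A" "findim C" "A \<inter> C = {0}"
  shows "dim {x + y | x y. x \<in> A \<and> y \<in> C} = dim A + dim C"
proof -
  obtain B1 where B1: "finite B1" "independent B1" "span B1 = A" "card B1 = dim A"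
    using findim_basis assms(1) by blast
  obtain B2 where B2: "finite B2" "independent B2" "span B2 = C" "card B2 = dim C"
    using findim_basis assms(2) by blast
  have ind: "independent (B1 \<union> B2)"
    using independent_Un_if_disjoint_spans[OF B2(1) B1(2) B2(2)] assms(3) B1(3) B2(3) by simp
  have "B1 \<inter> B2 = {}"
  proof (rule ccontr)
    assume "B1 \<inter> B2 \<noteq> {}"
    then obtain b where "b \<in> B1" "b \<in> B2" by auto
    then have "b = 0" using assms(3) B1(3) B2(3) span_base by blast
    then show False using \<open>b \<in> B1\<close> B1(2) dependent_zero by blast
  qed
  then have "card (B1 \<union> B2) = dim A + dim C"
    using B1 B2 by (simp add: card_Un_disjoint)
  moreover have "{x + y | x y. x \<in> A \<and> y \<in> C} = span (B1 \<union> B2)"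
    unfolding span_Un B1(3) B2(3) ..
  ultimately show ?thesis using dim_span_eq_card_independent[OF ind] by simp
qed

lemma findim_dim_eq_imp_eq:
  assumes "findim S" "subspace A" "A \<subseteq> S" "dim A = dim S"
  shows "A = S"
proof (rule ccontr)
  assume "A \<noteq> S"
  then obtain v where v: "v \<in> S" "v \<notin> A" using assms(3) by blast
  obtain B where B: "finite B" "independent B" "span B = A" "card B = dim A"
    using findim_basis[OF findim_mono[OF assms(1-3)]] .
  obtain C where C: "finite C" "independent C" "span C = S" "card C = dim S"
    using findim_basis[OF assms(1)] .
  have vB: "v \<notin> span B" "v \<notin> B" using v B(3) span_base[of v B] by auto
  have "independent (insert v B)" using independent_insertI[OF vB(1) B(2)] .
  moreover have "insert v B \<subseteq> span C"
    using v(1) B(3) C(3) assms(3) span_superset[of B] by auto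
  ultimately have "card (insert v B) \<le> card C"
    using independent_span_bound[OF C(1)] by blast
  then show False using B(1,4) C(4) vB(2) assms(4) by simp
qed

lemma dim_subset_findim:
  assumes "findim S" "subspace A" "A \<subseteq> S"
  shows "dim A \<le> dim S"
proof -
  obtain B where B: "finite B" "independent B" "span B = A" "card B = dim A"
    using findim_basis[OF findim_mono[OF assms]] .
  obtain C where C: "finite C" "independent C" "span C = S" "card C = dim S"
    using findim_basis[OF assms(1)] .
  have "B \<subseteq> span C" using B(3) C(3) assms(3) span_superset by blast
  then show ?thesis using independent_span_bound[OF C(1) B(2)] B C by simp
qed

lemma dim_span_insert_notin:
  assumes "findim A" "v \<notin> A"
  shows "dim (span (insert v A)) = Suc (dim A)" "findim (span (insert v A))"
proof -
  obtain B where B: "finite B" "independent B" "span B = A" "card B = dim A"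
    using findim_basis[OF assms(1)] .
  have sA: "span A = A" using findim_subspace[OF assms(1)] by simp
  have eq: "span (insert v A) = span (insert v B)"
    unfolding span_insert B(3) sA ..
  then show "findim (span (insert v A))" using B(1) unfolding findim_def by blast
  have v: "v \<notin> span B" "v \<notin> B" using assms(2) B(3) span_base[of v B] by auto
  show "dim (span (insert v A)) = Suc (dim A)"
    unfolding eq dim_span_eq_card_independent[OF independent_insertI[OF v(1) B(2)]]
    using B(1,4) v(2) by simp
qed

lemma span_insert_subspace:
  assumes "subspace Y"
  shows "span (insert v Y) = {k *s v + y | k y. y \<in> Y}"
proof -
  have sp: "span Y = Y" using assms by simp
  have "x \<in> span (insert v Y) \<longleftrightarrow> x \<in> {k *s v + y | k y. y \<in> Y}" for x
  proof
    assume "x \<in> span (insert v Y)"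
    then obtain k where "x - k *s v \<in> Y" unfolding span_breakdown_eq sp by blast
    moreover have "x = k *s v + (x - k *s v)" by simp
    ultimately show "x \<in> {k *s v + y | k y. y \<in> Y}" by blast
  next
    assume "x \<in> {k *s v + y | k y. y \<in> Y}"
    then obtain k y where "x = k *s v + y" "y \<in> Y" by blast
    then have "x - k *s v \<in> Y" by simp
    then show "x \<in> span (insert v Y)" unfolding span_breakdown_eq sp by blast
  qed
  then show ?thesis by blast
qed

text \<open>Induction on the common codimension: a vector outside both subspaces exists because no vector
space is the union of two proper subspaces. Adjoining it to both lowers the codimension by one, and
it is returned to the complement obtained from the induction hypothesis.\<close>

lemma common_complement_exists:
  assumes "findim S" "subspace A" "A \<subseteq> S" "subspace B" "B \<subseteq> S" "dim A = dim B"
  shows "\<exists>Y. subspace Y \<and> A \<inter> Y = {0} \<and> {x + y | x y. x \<in> A \<and> y \<in> Y} = S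
     \<and> B \<inter> Y = {0} \<and> {x + y | x y. x \<in> B \<and> y \<in> Y} = S"
  using assms(2-6)
proof (induction "dim S - dim A" arbitrary: A B)
  case 0
  have "dim A = dim S" "dim B = dim S"
    using dim_subset_findim[OF assms(1) 0(2,3)] dim_subset_findim[OF assms(1) 0(4,5)] 0(1,6)
    by linarith+
  then have "A = S" "B = S"
    using findim_dim_eq_imp_eq[OF assms(1) 0(2,3)] findim_dim_eq_imp_eq[OF assms(1) 0(4,5)] by blast+
  moreover have "0 \<in> S" using subspace_0[OF findim_subspace[OF assms(1)]] .
  ultimately show ?case by (intro exI[of _ "{0}"]) simp
next
  case (Suc k)
  have "A \<noteq> S" "B \<noteq> S" using Suc.hyps(2) Suc.prems(5) by auto
  then obtain a b where ab: "a \<in> S" "a \<notin> A" "b \<in> S" "b \<notin> B"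
    using Suc.prems(2,4) by blast
  have S: "subspace S" using assms(1) findim_subspace by blast
  have "\<exists>v\<in>S. v \<notin> A \<and> v \<notin> B"
  proof (cases "a \<in> B \<and> b \<in> A")
    case True
    \<comment> \<open>Otherwise \<open>a\<close> or \<open>b\<close> itself avoids both subspaces.\<close>
    have "a + b \<notin> A" using True ab subspace_diff[OF Suc.prems(1), of "a + b" b] by auto
    moreover have "a + b \<notin> B" using True ab subspace_diff[OF Suc.prems(3), of "a + b" a] by auto
    ultimately show ?thesis using ab subspace_add[OF S] by blast
  qed (use ab in auto)
  then obtain v where v: "v \<in> S" "v \<notin> A" "v \<notin> B" by blast
  let ?A = "span (insert v A)" and ?B = "span (insert v B)"
  have fA: "findim A" and fB: "findim B" 
    using findim_mono[OF assms(1)] Suc.prems(1-4) by simp_all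
  have AS: "?A \<subseteq> S" "?B \<subseteq> S"
    using v(1) Suc.prems(2,4) S by (simp_all add: span_minimal)
  have dims: "dim ?A = Suc (dim A)" "dim ?B = Suc (dim B)"
    using dim_span_insert_notin[OF fA v(2)] dim_span_insert_notin[OF fB v(3)] by blast+
  have "k = dim S - dim ?A" "dim ?A = dim ?B"
    using Suc.hyps(2) dims Suc.prems(5) by linarith+
  then obtain Y where Y: "subspace Y" "?A \<inter> Y = {0}" "{x + y | x y. x \<in> ?A \<and> y \<in> Y} = S"
     "?B \<inter> Y = {0}" "{x + y | x y. x \<in> ?B \<and> y \<in> Y} = S"
    using Suc.hyps(1)[of ?A ?B] AS subspace_span by blast
  let ?Y = "{k *s v + y | k y. y \<in> Y}"
  have spY: "?Y = span (insert v Y)" using span_insert_subspace[OF Y(1)] by simp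
  have gen: "C \<inter> ?Y = {0} \<and> {x + y | x y. x \<in> C \<and> y \<in> ?Y} = S"
    if C: "subspace C" "v \<notin> C" "span (insert v C) \<inter> Y = {0}"
      "{x + y | x y. x \<in> span (insert v C) \<and> y \<in> Y} = S" for C
  proof
    note spC = span_insert_subspace[OF C(1), of v]
    have "x = 0" if x: "x \<in> C" "x \<in> ?Y" for x
    proof -
      obtain k y where ky: "x = k *s v + y" "y \<in> Y" using x(2) by auto
      have "y = (- k) *s v + x" using ky(1) by simp
      then have "y \<in> span (insert v C)" using x(1) spC by blast
      then have "y = 0" using ky(2) C(3) by blast
      then have "k *s v \<in> C" using ky x by simp
      then have "k = 0"
        using C(1,2) subspace_scale[OF C(1), of "k *s v" "inverse k"] by (cases "k = 0") auto
      then show ?thesis using ky(1) \<open>y = 0\<close> by simp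
    qed
    moreover have "0 \<in> C" "0 \<in> ?Y" using subspace_0[OF C(1)] spY span_zero by auto
    ultimately show "C \<inter> ?Y = {0}" by blast
    show "{x + y | x y. x \<in> C \<and> y \<in> ?Y} = S"
      unfolding C(4)[symmetric] spC
    proof safe
      fix x k y assume "x \<in> C" "y \<in> Y"
      then show "\<exists>x' y'. x + (k *s v + y) = x' + y' \<and> x' \<in> {k *s v + y |k y. y \<in> C} \<and> y' \<in> Y"
        by (intro exI[of _ "k *s v + x"] exI[of _ y]) (auto simp: algebra_simps)
    next
      fix y k x assume "y \<in> Y" "x \<in> C"
      then show "\<exists>x' y'. k *s v + x + y = x' + y' \<and> x' \<in> C \<and> y' \<in> ?Y"
        by (intro exI[of _ x] exI[of _ "k *s v + y"]) (auto simp: algebra_simps)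
    qed
  qed
  have "subspace ?Y" unfolding spY by simp
  then show ?case
    using gen[OF Suc.prems(1) v(2) Y(2,3)] gen[OF Suc.prems(3) v(3) Y(4,5)] by (intro exI[of _ ?Y]) (intro conjI; simp)
qed

end

section \<open>Linear maps between finitely generated spaces\<close>

text \<open>The closure conditions are spelled out, rather than taken from the module theory, so that they
apply without an interpretation for the scalar multiplication of \<open>M\<close>.\<close>

definition subspace_of :: "('a::field, 'v::ab_group_add) space \<Rightarrow> 'v set \<Rightarrow> bool" where
  "subspace_of M A \<longleftrightarrow> A \<subseteq> carrier M \<and> 0 \<in> A \<and> (\<forall>x\<in>A. \<forall>y\<in>A. x + y \<in> A) \<and>
     (\<forall>a. \<forall>x\<in>A. smul M a x \<in> A)"

definition complementary ::
  "('a::field, 'v::ab_group_add) space \<Rightarrow> 'v set \<Rightarrow> 'v set \<Rightarrow> bool" where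
  "complementary M A C \<longleftrightarrow> subspace_of M A \<and> subspace_of M C \<and> A \<inter> C = {0} \<and>
     (\<forall>x\<in>carrier M. \<exists>a\<in>A. \<exists>c\<in>C. x = a + c)"

abbreviation rank :: "('a::field, 'v::ab_group_add) space \<Rightarrow> nat" where
  "rank M \<equiv> vector_space.dim (smul M) (carrier M)"

lemma sub_space_simps [simp]: "carrier (sub_space M A) = A" "smul (sub_space M A) = smul M"
  by (simp_all add: sub_space_def)

lemma sum_space_simps [simp]:
  "carrier (sum_space M N) = carrier M \<times> carrier N"
  "smul (sum_space M N) a (x, y) = (smul M a x, smul N a y)"
  by (simp_all add: sum_space_def)

lemma subspace_ofD:
  assumes "subspace_of M A"
  shows "A \<subseteq> carrier M" "x \<in> A \<Longrightarrow> x \<in> carrier M" "0 \<in> A"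
    "x \<in> A \<Longrightarrow> y \<in> A \<Longrightarrow> x + y \<in> A" "x \<in> A \<Longrightarrow> smul M a x \<in> A"
  using assms unfolding subspace_of_def by auto

lemma subspace_of_iff:
  assumes "vector_space (smul M)"
  shows "subspace_of M A \<longleftrightarrow> module.subspace (smul M) A \<and> A \<subseteq> carrier M"
proof -
  interpret vector_space "smul M" by fact
  show ?thesis unfolding subspace_of_def subspace_def by auto
qed

lemma vector_space_minus:
  assumes "vector_space s"
  shows "- x = s (- 1) x"
proof -
  interpret vector_space s by fact
  show ?thesis by simp
qed

lemma subspace_of_minus:
  assumes "vector_space (smul M)" "subspace_of M A" "x \<in> A"
  shows "- x \<in> A"
  using subspace_ofD(5)[OF assms(2,3), of "- 1"] vector_space_minus[OF assms(1), of x] by simp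

lemma subspace_of_diff:
  assumes "vector_space (smul M)" "subspace_of M A" "x \<in> A" "y \<in> A"
  shows "x - y \<in> A"
  using subspace_ofD(4)[OF assms(2,3) subspace_of_minus[OF assms(1,2,4)]] by simp

lemma subspace_of_Int: "subspace_of M A \<Longrightarrow> subspace_of M C \<Longrightarrow> subspace_of M (A \<inter> C)"
  unfolding subspace_of_def by auto

lemma fg_space_vs: "fg_space M \<Longrightarrow> vector_space (smul M)"
  by (simp add: fg_space_def)

lemma fg_space_vspace: "fg_space M \<Longrightarrow> vspace (smul M)"
  by (simp add: fg_space_def vspace_def)

lemma fg_space_iff: "fg_space M \<longleftrightarrow> vector_space (smul M) \<and> vspace.findim (smul M) (carrier M)"
  unfolding fg_space_def using vspace.findim_def[of "smul M" "carrier M"] vspace_def by blast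

lemma fg_space_carrier: 
  assumes "fg_space M"
  shows "subspace_of M (carrier M)"
proof -
  interpret vspace "smul M" using fg_space_vspace[OF assms] .
  have "subspace (carrier M)" using findim_subspace assms fg_space_iff by blast
  then show ?thesis using subspace_of_iff[OF fg_space_vs[OF assms]] by blast
qed

lemma fg_sub_space:
  assumes "fg_space M" "subspace_of M A"
  shows "fg_space (sub_space M A)"
proof -
  interpret vspace "smul M" using fg_space_vspace[OF assms(1)] .
  have "findim A"
    using findim_mono[of "carrier M" A] assms fg_space_iff[of M]
      subspace_of_iff[OF fg_space_vs[OF assms(1)], of A] by blast
  then show ?thesis using fg_space_vs[OF assms(1)] by (simp add: fg_space_iff)
qed

lemma complementaryD:
  assumes "complementary M A C"
  shows "subspace_of M A" "subspace_of M C" "x \<in> A \<Longrightarrow> x \<in> C \<Longrightarrow> x = 0"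
    "x \<in> carrier M \<Longrightarrow> \<exists>a\<in>A. \<exists>c\<in>C. x = a + c"
  using assms unfolding complementary_def by auto

lemma complementaryI:
  assumes "subspace_of M A" "subspace_of M C" "\<And>x. x \<in> A \<Longrightarrow> x \<in> C \<Longrightarrow> x = 0"
    "\<And>x. x \<in> carrier M \<Longrightarrow> \<exists>a\<in>A. \<exists>c\<in>C. x = a + c"
  shows "complementary M A C"
  using assms unfolding complementary_def subspace_of_def by blast

lemma complementary_iff_sums:
  assumes "vector_space (smul M)" "subspace_of M (carrier M)" "A \<subseteq> carrier M" "C \<subseteq> carrier M"
  shows "complementary M A C \<longleftrightarrow> module.subspace (smul M) A \<and> module.subspace (smul M) C \<and>
     A \<inter> C = {0} \<and> {x + y | x y. x \<in> A \<and> y \<in> C} = carrier M"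
proof -
  have "{x + y | x y. x \<in> A \<and> y \<in> C} \<subseteq> carrier M"
    using assms(2-4) subspace_ofD(4) by blast
  then have "{x + y | x y. x \<in> A \<and> y \<in> C} = carrier M \<longleftrightarrow>
    (\<forall>x\<in>carrier M. \<exists>a\<in>A. \<exists>c\<in>C. x = a + c)" by blast
  then show ?thesis
    unfolding complementary_def subspace_of_iff[OF assms(1)] using assms(3,4) by blast
qed

lemma direct_summand_iff:
  assumes "fg_space M"
  shows "direct_summand M A \<longleftrightarrow> (\<exists>C. complementary M A C)"
proof
  note vs = fg_space_vs[OF assms]
  assume "direct_summand M A"
  then obtain C where C: "module.subspace (smul M) A" "module.subspace (smul M) C"
     "A \<inter> C = {0}" "{x + y | x y. x \<in> A \<and> y \<in> C} = carrier M"
    unfolding direct_summand_def by blast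
  have "0 \<in> A" "0 \<in> C" using C(3) by auto
  then have "x \<in> {x + y | x y. x \<in> A \<and> y \<in> C}" if "x \<in> A \<union> C" for x
    using that by (force intro: exI[of _ 0])
  then have "A \<subseteq> carrier M" "C \<subseteq> carrier M" using C(4) by auto
  then show "\<exists>C. complementary M A C"
    using complementary_iff_sums[OF vs fg_space_carrier[OF assms]] C by blast
next
  note vs = fg_space_vs[OF assms]
  assume "\<exists>C. complementary M A C"
  then obtain C where C: "complementary M A C" ..
  have "A \<subseteq> carrier M" "C \<subseteq> carrier M"
    using complementaryD(1,2)[OF C] by (simp_all add: subspace_ofD(1))
  then have "module.subspace (smul M) A \<and> module.subspace (smul M) C \<and>
     A \<inter> C = {0} \<and> {x + y | x y. x \<in> A \<and> y \<in> C} = carrier M"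
    using complementary_iff_sums[OF vs fg_space_carrier[OF assms]] C by simp
  then show "direct_summand M A"
    unfolding direct_summand_def by (intro conjI exI[of _ C]) simp_all
qed

lemma complement_exists:
  assumes "fg_space M" "subspace_of M A"
  shows "\<exists>C. complementary M A C"
proof -
  interpret vspace "smul M" using fg_space_vspace[OF assms(1)] .
  note iff = subspace_of_iff[OF fg_space_vs[OF assms(1)]]
  have A: "subspace A" "A \<subseteq> carrier M" using assms(2) iff by blast+
  have "subspace (carrier M)" using fg_space_carrier[OF assms(1)] iff by blast
  then have "direct_summand M A" 
    unfolding direct_summand_def using subspace_complement_exists[OF A(1) _ A(2)] A(1) by blast
  then show ?thesis using direct_summand_iff[OF assms(1)] by blast
qed

lemma lin_homD:
  assumes "f \<in> lin_hom M N"
  shows "x \<in> carrier M \<Longrightarrow> f x \<in> carrier N"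
    "x \<in> carrier M \<Longrightarrow> y \<in> carrier M \<Longrightarrow> f (x + y) = f x + f y"
    "x \<in> carrier M \<Longrightarrow> f (smul M a x) = smul N a (f x)"
    "x \<notin> carrier M \<Longrightarrow> f x = 0"
  using assms unfolding lin_hom_def by auto

lemma lin_homI:
  assumes "\<And>x. x \<in> carrier M \<Longrightarrow> f x \<in> carrier N"
    "\<And>x y. x \<in> carrier M \<Longrightarrow> y \<in> carrier M \<Longrightarrow> f (x + y) = f x + f y"
    "\<And>a x. x \<in> carrier M \<Longrightarrow> f (smul M a x) = smul N a (f x)"
    "\<And>x. x \<notin> carrier M \<Longrightarrow> f x = 0"
  shows "f \<in> lin_hom M N"
  using assms unfolding lin_hom_def by auto

lemma lin_hom_0: 
  assumes "f \<in> lin_hom M N"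
  shows "f 0 = 0"
proof (cases "0 \<in> carrier M")
  case True
  then show ?thesis using lin_homD(2)[OF assms True True] by simp
qed (use lin_homD(4)[OF assms] in simp)

lemma lin_hom_diff:
  assumes "f \<in> lin_hom M N" "x \<in> carrier M" "y \<in> carrier M" "x - y \<in> carrier M"
  shows "f (x - y) = f x - f y"
  using lin_homD(2)[OF assms(1,4,3)] by (simp add: algebra_simps)

lemma subspace_of_image:
  assumes "f \<in> lin_hom M N" "subspace_of M A"
  shows "subspace_of N (f ` A)"
  unfolding subspace_of_def
proof (intro conjI ballI allI)
  note [simp] = subspace_ofD(2)[OF assms(2)]
  show "f ` A \<subseteq> carrier N" using lin_homD(1)[OF assms(1)] by auto
  show "0 \<in> f ` A" using lin_hom_0[OF assms(1)] subspace_ofD(3)[OF assms(2)] by force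
  fix x assume "x \<in> f ` A"
  then obtain u where u: "u \<in> A" "x = f u" by blast
  show "smul N a x \<in> f ` A" for a
    using lin_homD(3)[OF assms(1), of u a] subspace_ofD(5)[OF assms(2), of u a] u by force
  fix y assume "y \<in> f ` A"
  then obtain v where v: "v \<in> A" "y = f v" by blast
  show "x + y \<in> f ` A"
    using lin_homD(2)[OF assms(1), of u v] subspace_ofD(4)[OF assms(2), of u v] u v by force
qed

lemma subspace_of_kernel:
  assumes "f \<in> lin_hom M N" "subspace_of M A" "vector_space (smul N)"
  shows "subspace_of M {x \<in> A. f x = 0}"
proof -
  interpret N: vector_space "smul N" by fact
  show ?thesis
    unfolding subspace_of_def
    using subspace_ofD[OF assms(2)] lin_homD(2,3)[OF assms(1)] lin_hom_0[OF assms(1)] by auto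
qed

lemma lin_isoI:
  assumes "f \<in> lin_hom M N" "fg_space M"
    "\<And>x. x \<in> carrier M \<Longrightarrow> f x = 0 \<Longrightarrow> x = 0"
    "\<And>y. y \<in> carrier N \<Longrightarrow> \<exists>x\<in>carrier M. f x = y"
  shows "f \<in> lin_iso M N"
proof -
  have "inj_on f (carrier M)"
  proof (rule inj_onI)
    fix x y assume xy: "x \<in> carrier M" "y \<in> carrier M" "f x = f y"
    have d: "x - y \<in> carrier M"
      using subspace_of_diff[OF fg_space_vs fg_space_carrier] assms(2) xy by blast
    have "f (x - y) = 0" using lin_hom_diff[OF assms(1) xy(1,2) d] xy(3) by simp
    then show "x = y" using assms(3)[OF d] by simp
  qed
  moreover have "f ` carrier M = carrier N" using lin_homD(1)[OF assms(1)] assms(4) by blast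
  ultimately show ?thesis unfolding lin_iso_def bij_betw_def using assms(1) by blast
qed

lemma lin_isoD:
  assumes "f \<in> lin_iso M N"
  shows "f \<in> lin_hom M N" "inj_on f (carrier M)" "f ` carrier M = carrier N"
    "\<And>y. y \<in> carrier N \<Longrightarrow> \<exists>x\<in>carrier M. f x = y"
proof -
  have *: "f \<in> lin_hom M N \<and> inj_on f (carrier M) \<and> f ` carrier M = carrier N"
    using assms unfolding lin_iso_def bij_betw_def by simp
  then show "f \<in> lin_hom M N" "inj_on f (carrier M)" "f ` carrier M = carrier N" by simp_all
  show "\<exists>x\<in>carrier M. f x = y" if "y \<in> carrier N" for y
  proof -
    have "y \<in> f ` carrier M" using * that by simp
    then show ?thesis by auto
  qed
qed

lemma lin_iso_eq_0:
  assumes "f \<in> lin_iso M N" "x \<in> carrier M" "f x = 0" "0 \<in> carrier M"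
  shows "x = 0"
  using lin_isoD(2)[OF assms(1)] assms lin_hom_0[OF lin_isoD(1)[OF assms(1)]]
  by (metis inj_onD)

text \<open>The inverse, normalised to vanish outside the carrier as \<^const>\<open>lin_hom\<close> demands.\<close>

definition inv_iso :: "('a::field, 'v::ab_group_add) space \<Rightarrow> ('a, 'w::ab_group_add) space \<Rightarrow> ('v \<Rightarrow> 'w) \<Rightarrow> 'w \<Rightarrow> 'v" where
  "inv_iso M N f y = (if y \<in> carrier N then inv_into (carrier M) f y else 0)"

lemma inv_iso:
  assumes "f \<in> lin_iso M N" "fg_space M"
  shows "inv_iso M N f \<in> lin_iso N M"
    "x \<in> carrier M \<Longrightarrow> inv_iso M N f (f x) = x"
    "y \<in> carrier N \<Longrightarrow> f (inv_iso M N f y) = y"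
proof -
  let ?g = "inv_iso M N f"
  note f = lin_isoD[OF assms(1)]
  show 1: "?g (f x) = x" if "x \<in> carrier M" for x
    using that f(2) lin_homD(1)[OF f(1)] by (simp add: inv_iso_def)
  show 2: "f (?g y) = y" if "y \<in> carrier N" for y
    using that f(3) by (simp add: inv_iso_def f_inv_into_f)
  have 3: "?g y \<in> carrier M" if "y \<in> carrier N" for y
    using that f(3) by (simp add: inv_iso_def inv_into_into)
  have "?g \<in> lin_hom N M"
  proof (rule lin_homI)
    fix x y assume xy: "x \<in> carrier N" "y \<in> carrier N"
    have "?g (f (?g x + ?g y)) = ?g x + ?g y"
      by (rule 1) (use xy 3 subspace_ofD(4)[OF fg_space_carrier[OF assms(2)]] in blast)
    then show "?g (x + y) = ?g x + ?g y" using lin_homD(2)[OF f(1) 3 3] 2 xy by simp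
  next
    fix a x assume x: "x \<in> carrier N"
    have "?g (f (smul M a (?g x))) = smul M a (?g x)"
      by (rule 1) (use x 3 subspace_ofD(5)[OF fg_space_carrier[OF assms(2)]] in blast)
    then show "?g (smul N a x) = smul M a (?g x)" using lin_homD(3)[OF f(1) 3] 2 x by simp
  qed (simp_all add: 3, simp add: inv_iso_def)
  moreover have "bij_betw ?g (carrier N) (carrier M)"
    using 1 2 3 lin_homD(1)[OF f(1)] by (intro bij_betw_byWitness[of _ f]) auto
  ultimately show "?g \<in> lin_iso N M" unfolding lin_iso_def by blast
qed

lemma lin_hom_comp:
  assumes "f \<in> lin_hom M N" "g \<in> lin_hom N P"
  shows "(\<lambda>x. g (f x)) \<in> lin_hom M P"
  by (rule lin_homI)
    (simp_all add: lin_homD[OF assms(1)] lin_homD[OF assms(2)] lin_hom_0[OF assms(2)])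

lemma lin_iso_comp:
  assumes "f \<in> lin_iso M N" "g \<in> lin_iso N P"
  shows "(\<lambda>x. g (f x)) \<in> lin_iso M P"
proof -
  have "bij_betw (g \<circ> f) (carrier M) (carrier P)"
    using assms unfolding lin_iso_def by (intro bij_betw_trans) auto
  then show ?thesis
    using lin_hom_comp[OF lin_isoD(1)[OF assms(1)] lin_isoD(1)[OF assms(2)]]
    unfolding lin_iso_def by (simp add: comp_def)
qed

text \<open>A map in \<^const>\<open>lin_hom\<close> is additive on the carrier only. Its values on a basis of the
carrier extend to a map that is linear on the whole type, to which the general theory applies.\<close>

lemma lin_hom_extends:
  assumes "vector_space (smul M)" "vector_space (smul N)" "subspace_of M (carrier M)" "f \<in> lin_hom M N"
  shows "\<exists>g. Vector_Spaces.linear (smul M) (smul N) g \<and> (\<forall>x\<in>carrier M. g x = f x)"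
proof -
  interpret p: vector_space_pair "smul M" "smul N" using assms(1,2) by (simp add: vector_space_pair_def)
  obtain B where B: "B \<subseteq> carrier M" "p.vs1.independent B" "carrier M \<subseteq> p.vs1.span B"
    using p.vs1.basis_exists by metis
  obtain g where g: "Vector_Spaces.linear (smul M) (smul N) g" "\<forall>x\<in>B. g x = f x"
    using p.linear_independent_extend[OF B(2)] by metis
  interpret g: Vector_Spaces.linear "smul M" "smul N" g by fact
  let ?E = "{x \<in> carrier M. g x = f x}"
  have "p.vs1.subspace ?E"
    using subspace_ofD[OF assms(3)] lin_homD[OF assms(4)] lin_hom_0[OF assms(4)]
    by (simp add: p.vs1.subspace_def g.add g.scale)
  then have "p.vs1.span B \<subseteq> ?E"
    using B(1) g(2) by (intro p.vs1.span_minimal) auto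
  then show ?thesis using g(1) B(3) by blast
qed

lemma lin_iso_rank:
  assumes "f \<in> lin_iso M N" "fg_space M" "vector_space (smul N)"
  shows "fg_space N" "rank N = rank M"
proof -
  interpret M: vspace "smul M" using fg_space_vspace[OF assms(2)] .
  interpret N: vspace "smul N" using assms(3) by (simp add: vspace_def)
  note f = lin_isoD[OF assms(1)]
  obtain g where g: "Vector_Spaces.linear (smul M) (smul N) g" "\<forall>x\<in>carrier M. g x = f x"
    using lin_hom_extends[OF M.vector_space_axioms assms(3) fg_space_carrier[OF assms(2)] f(1)] by blast
  interpret g: Vector_Spaces.linear "smul M" "smul N" g by fact
  have "M.findim (carrier M)" using assms(2) fg_space_iff by blast
  then obtain B where B: "finite B" "M.independent B" "M.span B = carrier M" "card B = rank M"
    using M.findim_basis by blast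
  have img: "g ` carrier M = f ` carrier M" using g(2) by (simp cong: image_cong)
  have inj: "inj_on g (M.span B)" unfolding B(3) using f(2) g(2) inj_on_cong[of "carrier M" g f] by blast
  have sp: "N.span (g ` B) = carrier N" using g.span_image[of B] B(3) img f(3) by simp
  have ind: "N.independent (g ` B)" using g.independent_injective_image[OF B(2) inj] .
  have "finite (g ` B)" using B(1) by simp
  then have "N.findim (carrier N)" unfolding N.findim_def using sp by metis
  then show "fg_space N" using fg_space_iff assms(3) by blast
  have "card (g ` B) = card B"
    using inj M.span_superset[of B] by (intro card_image) (rule inj_on_subset)
  then show "rank N = rank M"
    using N.dim_span_eq_card_independent[OF ind] sp B(4) by simp
qed

lemma rank_complementary:
  assumes "fg_space M" "complementary M A C"
  shows "rank M = rank (sub_space M A) + rank (sub_space M C)"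
proof -
  interpret vspace "smul M" using fg_space_vspace[OF assms(1)] .
  have A: "subspace_of M A" and C: "subspace_of M C" and AC: "A \<inter> C = {0}"
    using assms(2) unfolding complementary_def by blast+
  have "{x + y | x y. x \<in> A \<and> y \<in> C} = carrier M"
    using complementary_iff_sums[OF fg_space_vs fg_space_carrier subspace_ofD(1) subspace_ofD(1)]
      assms A C by blast
  moreover have "findim A" "findim C"
    using fg_sub_space[OF assms(1) A] fg_sub_space[OF assms(1) C] by (simp_all add: fg_space_iff)
  ultimately show ?thesis using dim_direct_sum[of A C] AC by simp
qed

text \<open>A complement of the kernel is mapped isomorphically onto the image.\<close>

lemma rank_kernel_image:
  assumes "fg_space M" "vector_space (smul N)" "f \<in> lin_hom M N"
  shows "rank M = rank (sub_space M {x \<in> carrier M. f x = 0}) + rank (sub_space N (f ` carrier M))"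
proof -
  let ?K = "{x \<in> carrier M. f x = 0}"
  have K: "subspace_of M ?K" using subspace_of_kernel[OF assms(3) fg_space_carrier[OF assms(1)] assms(2)] .
  obtain C where C: "complementary M ?K C" using complement_exists[OF assms(1) K] by blast
  note CC = complementaryD[OF C]
  have CM: "x \<in> C \<Longrightarrow> x \<in> carrier M" for x using subspace_ofD(2)[OF CC(2)] .
  let ?g = "\<lambda>x. if x \<in> C then f x else 0"
  have fg: "fg_space (sub_space M C)" using fg_sub_space[OF assms(1) CC(2)] .
  have "?g \<in> lin_iso (sub_space M C) (sub_space N (f ` carrier M))"
  proof (rule lin_isoI)
    show "?g \<in> lin_hom (sub_space M C) (sub_space N (f ` carrier M))"
      by (rule lin_homI)
        (use subspace_ofD(4,5)[OF CC(2)] CM lin_homD[OF assms(3)] in auto)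
  next
    fix x assume "x \<in> carrier (sub_space M C)" "?g x = 0"
    then show "x = 0" using CC(3)[of x] CM by simp
  next
    fix y assume "y \<in> carrier (sub_space N (f ` carrier M))"
    then obtain x where x: "x \<in> carrier M" "y = f x" by auto
    then obtain a c where ac: "a \<in> ?K" "c \<in> C" "x = a + c" using CC(4) by blast
    then have "f x = f c" using lin_homD(2)[OF assms(3), of a c] CM by simp
    then show "\<exists>x\<in>carrier (sub_space M C). ?g x = y" using ac(2) x(2) by auto
  qed (fact fg)
  from lin_iso_rank(2)[OF this fg] have "rank (sub_space N (f ` carrier M)) = rank (sub_space M C)"
    using assms(2) by simp
  then show ?thesis using rank_complementary[OF assms(1) C] by simp
qed

lemma lin_iso_if_injective_rank_eq:
  assumes "f \<in> lin_hom M N" "fg_space M" "fg_space N" "rank M = rank N"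
    "\<And>x. x \<in> carrier M \<Longrightarrow> f x = 0 \<Longrightarrow> x = 0"
  shows "f \<in> lin_iso M N"
proof -
  let ?I = "sub_space N (f ` carrier M)"
  interpret N: vspace "smul N" using fg_space_vspace[OF assms(3)] .
  have sub: "subspace_of N (f ` carrier M)"
    using subspace_of_image[OF assms(1) fg_space_carrier[OF assms(2)]] .
  have "f \<in> lin_hom M ?I" using lin_homD[OF assms(1)] by (intro lin_homI) auto
  then have iso: "f \<in> lin_iso M ?I" by (rule lin_isoI[OF _ assms(2,5)]) auto
  have "rank ?I = rank N"
    using lin_iso_rank(2)[OF iso assms(2)] fg_space_vs[OF assms(3)] assms(4) by simp
  then have "f ` carrier M = carrier N"
    using N.findim_dim_eq_imp_eq[of "carrier N" "f ` carrier M"] assms(3) sub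
      subspace_of_iff[OF fg_space_vs[OF assms(3)]] fg_space_iff[of N] by simp
  then have "y \<in> f ` carrier M" if "y \<in> carrier N" for y using that by simp
  then have "\<exists>x\<in>carrier M. f x = y" if "y \<in> carrier N" for y using that by force
  then show ?thesis by (intro lin_isoI[OF assms(1,2,5)])
qed

lemma fg_sum_space:
  fixes M :: "('a::field, 'v::ab_group_add) space" and N :: "('a, 'w::ab_group_add) space"
  assumes "fg_space M" "fg_space N"
  shows "fg_space (sum_space M N)" "rank (sum_space M N) = rank M + rank N"
proof -
  let ?S = "sum_space M N"
  interpret M: vspace "smul M" using fg_space_vspace[OF assms(1)] .
  interpret N: vspace "smul N" using fg_space_vspace[OF assms(2)] .
  have vs: "vector_space (smul ?S)"
    unfolding vector_space_def
    by (auto simp: M.scale_right_distrib M.scale_left_distrib N.scale_right_distrib N.scale_left_distrib)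
  interpret S: vspace "smul ?S" using vs by (simp add: vspace_def)
  have sS: "subspace_of ?S (carrier ?S)"
    using fg_space_carrier[OF assms(1)] fg_space_carrier[OF assms(2)]
    unfolding subspace_of_def by (auto simp: zero_prod_def)
  define i where "i x = (x, 0 :: 'w)" for x :: 'v
  define j where "j y = (0 :: 'v, y)" for y :: 'w
  let ?i = "\<lambda>x. if x \<in> carrier M then i x else 0"
  let ?j = "\<lambda>x. if x \<in> carrier N then j x else 0"
  note subM = subspace_ofD[OF fg_space_carrier[OF assms(1)]]
  note subN = subspace_ofD[OF fg_space_carrier[OF assms(2)]]
  let ?A = "carrier M \<times> {0 :: 'w}" and ?B = "{0 :: 'v} \<times> carrier N"
  have A: "subspace_of ?S ?A" using subM(3-5) subN(3) unfolding subspace_of_def by (auto simp: zero_prod_def)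
  have B: "subspace_of ?S ?B" using subN(3-5) subM(3) unfolding subspace_of_def by (auto simp: zero_prod_def)
  have "?i \<in> lin_hom M (sub_space ?S ?A)"
    by (rule lin_homI) (use subM(4,5) in \<open>auto simp: i_def zero_prod_def\<close>)
  then have iso1: "?i \<in> lin_iso M (sub_space ?S ?A)"
    by (rule lin_isoI[OF _ assms(1)]) (auto simp: i_def zero_prod_def)
  have "?j \<in> lin_hom N (sub_space ?S ?B)"
    by (rule lin_homI) (use subN(4,5) in \<open>auto simp: j_def zero_prod_def\<close>)
  then have iso2: "?j \<in> lin_iso N (sub_space ?S ?B)"
    by (rule lin_isoI[OF _ assms(2)]) (auto simp: j_def zero_prod_def)
  have r1: "fg_space (sub_space ?S ?A)" "rank (sub_space ?S ?A) = rank M"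
    using lin_iso_rank[OF iso1 assms(1)] vs by simp_all
  have r2: "fg_space (sub_space ?S ?B)" "rank (sub_space ?S ?B) = rank N"
    using lin_iso_rank[OF iso2 assms(2)] vs by simp_all
  have comp: "complementary ?S ?A ?B"
    by (rule complementaryI[OF A B]) (auto simp: zero_prod_def)
  have sums: "{x + y | x y. x \<in> ?A \<and> y \<in> ?B} = carrier ?S"
    using complementary_iff_sums[OF vs sS subspace_ofD(1)[OF A] subspace_ofD(1)[OF B]] comp by blast
  obtain P where P: "finite P" "S.span P = ?A" using r1(1) by (auto simp: fg_space_def)
  obtain Q where Q: "finite Q" "S.span Q = ?B" using r2(1) by (auto simp: fg_space_def)
  have "S.span (P \<union> Q) = carrier ?S" using S.span_Un[of P Q] P(2) Q(2) sums by simp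
  then show fg: "fg_space ?S" unfolding fg_space_def using vs P(1) Q(1) by (metis finite_UnI)
  show "rank ?S = rank M + rank N" using rank_complementary[OF fg comp] r1(2) r2(2) by simp
qed

definition proj_on :: "('a::field, 'v::ab_group_add) space \<Rightarrow> 'v set \<Rightarrow> 'v set \<Rightarrow> 'v \<Rightarrow> 'v" where
  "proj_on M A C x = (if x \<in> carrier M then THE a. a \<in> A \<and> x - a \<in> C else 0)"

lemma proj_on_eq:
  assumes "vector_space (smul M)" "complementary M A C" "subspace_of M (carrier M)" "a \<in> A" "c \<in> C"
  shows "proj_on M A C (a + c) = a"
proof -
  note D = complementaryD[OF assms(2)]
  have "a + c \<in> carrier M"
    using assms(4,5) D(1,2) subspace_ofD(2) subspace_ofD(4)[OF assms(3)] by blast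
  moreover have "(THE a'. a' \<in> A \<and> a + c - a' \<in> C) = a"
  proof (rule the_equality)
    show "a \<in> A \<and> a + c - a \<in> C" using assms(4,5) by simp
    fix a' assume a': "a' \<in> A \<and> a + c - a' \<in> C"
    have "a' - a \<in> A" using a' subspace_of_diff[OF assms(1) D(1)] assms(4) by blast
    moreover have "a' - a \<in> C"
      using subspace_of_diff[OF assms(1) D(2) assms(5), of "a + c - a'"] a' by simp
    ultimately show "a' = a" using D(3) by fastforce
  qed
  ultimately show ?thesis unfolding proj_on_def by simp
qed

lemma proj_on:
  assumes "fg_space M" "complementary M A C"
  shows "x \<in> carrier M \<Longrightarrow> proj_on M A C x \<in> A" "x \<in> carrier M \<Longrightarrow> x - proj_on M A C x \<in> C"
    "a \<in> A \<Longrightarrow> c \<in> C \<Longrightarrow> proj_on M A C (a + c) = a"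
    "proj_on M A C \<in> lin_hom M (sub_space M A)"
proof -
  note D = complementaryD[OF assms(2)]
  note eq = proj_on_eq[OF fg_space_vs[OF assms(1)] assms(2) fg_space_carrier[OF assms(1)]]
  show "a \<in> A \<Longrightarrow> c \<in> C \<Longrightarrow> proj_on M A C (a + c) = a" by (rule eq)
  show 1: "proj_on M A C x \<in> A" if "x \<in> carrier M" for x
    using D(4)[OF that] eq by auto
  show "x - proj_on M A C x \<in> C" if "x \<in> carrier M" for x
    using D(4)[OF that] eq by auto
  show "proj_on M A C \<in> lin_hom M (sub_space M A)"
  proof (rule lin_homI)
    fix x y assume xy: "x \<in> carrier M" "y \<in> carrier M"
    obtain a c where x: "a \<in> A" "c \<in> C" "x = a + c" using D(4)[OF xy(1)] by blast
    obtain a' c' where y: "a' \<in> A" "c' \<in> C" "y = a' + c'" using D(4)[OF xy(2)] by blast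
    have s: "x + y = (a + a') + (c + c')" using x(3) y(3) by (simp add: algebra_simps)
    have "proj_on M A C (x + y) = a + a'"
      unfolding s using x y subspace_ofD(4)[OF D(1)] subspace_ofD(4)[OF D(2)] by (intro eq) simp_all
    moreover have "proj_on M A C x = a" "proj_on M A C y = a'"
      using eq[OF x(1,2)] eq[OF y(1,2)] x(3) y(3) by simp_all
    ultimately show "proj_on M A C (x + y) = proj_on M A C x + proj_on M A C y" by simp
  next
    fix k x assume x: "x \<in> carrier M"
    obtain a c where x: "a \<in> A" "c \<in> C" "x = a + c" using D(4)[OF x] by blast
    have "smul M k x = smul M k a + smul M k c"
      using fg_space_vs[OF assms(1)] x(3) vector_space.vector_space_assms(1) by blast
    then show "proj_on M A C (smul M k x) = smul (sub_space M A) k (proj_on M A C x)"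
      using eq[of "smul M k a" "smul M k c"] eq[OF x(1,2)] x
        subspace_ofD(5)[OF D(1)] subspace_ofD(5)[OF D(2)] by simp
  qed (simp_all add: 1, simp add: proj_on_def)
qed

lemma lin_hom_sub_codomain: "f \<in> lin_hom M (sub_space N A) \<Longrightarrow> A \<subseteq> carrier N \<Longrightarrow> f \<in> lin_hom M N"
  unfolding lin_hom_def by auto

section \<open>Coordinates and duals\<close>

lemma (in vspace) representation_sum_basis:
  assumes "finite B" "independent B"
  shows "representation B (\<Sum>b\<in>B. u b *s b) b' = (if b' \<in> B then u b' else 0)"
proof -
  have "representation B (\<Sum>b\<in>B. u b *s b) b' = (\<Sum>b\<in>B. representation B (u b *s b) b')"
    by (subst representation_sum[OF assms(2)]) (auto intro: span_scale span_base)
  also have "\<dots> = (\<Sum>b\<in>B. u b * (if b = b' then 1 else 0))"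
    by (rule sum.cong) (simp_all add: representation_scale[OF assms(2)] span_base representation_basis[OF assms(2)])
  also have "\<dots> = (\<Sum>b\<in>B. if b = b' then u b else 0)" by (rule sum.cong) auto
  also have "\<dots> = (if b' \<in> B then u b' else 0)" using assms(1) by simp
  finally show ?thesis .
qed

lemma (in vspace) sum_representation:
  assumes "finite B" "independent B" "x \<in> span B"
  shows "(\<Sum>b\<in>B. representation B x b *s b) = x"
  using sum_representation_eq[OF assms(2,3,1)] by simp

lemma lin_hom_sum:
  assumes "f \<in> lin_hom M N" "fg_space M" "finite B" "B \<subseteq> carrier M"
  shows "f (\<Sum>b\<in>B. smul M (u b) b) = (\<Sum>b\<in>B. smul N (u b) (f b)) \<and> (\<Sum>b\<in>B. smul M (u b) b) \<in> carrier M"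
  using assms(3,4)
proof (induction B)
  case empty
  then show ?case using lin_hom_0[OF assms(1)] subspace_ofD(3)[OF fg_space_carrier[OF assms(2)]] by simp
next
  case (insert b B)
  have "smul M (u b) b \<in> carrier M"
    using insert.prems subspace_ofD(5)[OF fg_space_carrier[OF assms(2)]] by blast
  then show ?case
    using insert lin_homD(2,3)[OF assms(1)] subspace_ofD(4)[OF fg_space_carrier[OF assms(2)]] by simp
qed

lemma fg_space_basis:
  assumes "fg_space M"
  obtains B where "finite B" "\<not> module.dependent (smul M) B" "module.span (smul M) B = carrier M"
    "card B = rank M"
proof -
  interpret vspace "smul M" using fg_space_vspace[OF assms] .
  show ?thesis using findim_basis[of "carrier M"] assms that fg_space_iff by blast
qed

text \<open>Coordinates with respect to a basis, continued by zeros.\<close>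

lemma univ_copy_exists:
  assumes "fg_space (M :: ('a::field, 'v::ab_group_add) space)"
  shows "\<exists>(W :: ('a, 'a univ) space) f. fg_space W \<and> f \<in> lin_iso W M"
proof -
  interpret vspace "smul M" using fg_space_vspace[OF assms] .
  obtain B where B: "finite B" "independent B" "span B = carrier M" "card B = rank M"
    using fg_space_basis[OF assms] by blast
  obtain h where h: "bij_betw h {0..<card B} B" using ex_bij_betw_nat_finite[OF B(1)] by blast
  define W :: "('a, 'a univ) space" where
    "W = \<lparr>carrier = {v. \<forall>i\<ge>card B. v i = 0}, smul = (\<lambda>a v i. a * v i)\<rparr>"
  have W: "vector_space (smul W)"
    unfolding vector_space_def W_def by (auto simp: fun_eq_iff algebra_simps)
  define c where "c x = (\<lambda>i. if x \<in> carrier M \<and> i < card B then representation B x (h i) else 0)" for x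
  note sub = subspace_ofD[OF fg_space_carrier[OF assms]]
  have c: "c \<in> lin_hom M W"
  proof (rule lin_homI)
    fix x y assume "x \<in> carrier M" "y \<in> carrier M"
    then show "c (x + y) = c x + c y"
      using sub(4)[of x y] by (auto simp: c_def fun_eq_iff representation_add[OF B(2)] B(3))
  next
    fix a x assume "x \<in> carrier M"
    then show "c (smul M a x) = smul W a (c x)"
      using sub(5)[of x a] by (auto simp: c_def W_def fun_eq_iff representation_scale[OF B(2)] B(3))
  qed (auto simp: c_def W_def fun_eq_iff)
  have "c \<in> lin_iso M W"
  proof (rule lin_isoI[OF c assms])
    fix x assume x: "x \<in> carrier M" "c x = 0"
    have "representation B x b = 0" if "b \<in> B" for b
    proof -
      have "b \<in> h ` {0..<card B}" using that bij_betw_imp_surj_on[OF h] by simp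
      then obtain i where "i < card B" "b = h i" by auto
      then show ?thesis using fun_cong[OF x(2), of i] x(1) by (simp add: c_def)
    qed
    then show "x = 0" using sum_representation[OF B(1,2), of x] x(1) B(3) by simp
  next
    fix v assume v: "v \<in> carrier W"
    let ?u = "\<lambda>b. v (the_inv_into {0..<card B} h b)"
    let ?x = "\<Sum>b\<in>B. smul M (?u b) b"
    have "?x \<in> span B" by (intro span_sum span_scale span_base)
    then have x: "?x \<in> carrier M" using B(3) by simp
    have "c ?x i = v i" for i
    proof (cases "i < card B")
      case True
      then have "h i \<in> B" "the_inv_into {0..<card B} h (h i) = i"
        using h by (auto simp: bij_betw_def the_inv_into_f_f)
      then show ?thesis using True x representation_sum_basis[OF B(1,2), of ?u "h i"] by (simp add: c_def)
    next
      case False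
      then show ?thesis using v by (simp add: c_def W_def)
    qed
    then show "\<exists>x\<in>carrier M. c x = v" using x by blast
  qed
  then show ?thesis
    using lin_iso_rank(1)[OF _ assms W] inv_iso(1)[OF _ assms] by blast
qed

abbreviation scalars :: "('a::field, 'a) space" where
  "scalars \<equiv> \<lparr>carrier = UNIV, smul = (*)\<rparr>"

lemma dual_simps [simp]:
  "carrier (dual bar M) = lin_hom M scalars"
  "smul (dual bar M) a f = (\<lambda>x. f x * bar a)"
  by (simp_all add: dual_def)

lemma functionalD:
  assumes "f \<in> lin_hom M scalars"
  shows "x \<in> carrier M \<Longrightarrow> y \<in> carrier M \<Longrightarrow> f (x + y) = f x + f y"
    "x \<in> carrier M \<Longrightarrow> f (smul M a x) = a * f x"
    "x \<notin> carrier M \<Longrightarrow> f x = 0"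
  using lin_homD[OF assms] by auto

locale involution =
  fixes bar :: "'a::field \<Rightarrow> 'a"
  assumes involution: "is_involution bar"
begin

lemma bar_simps [simp]:
  "bar (x + y) = bar x + bar y" "bar (x * y) = bar x * bar y" "bar 1 = 1" "bar (bar x) = x"
  "bar 0 = 0" "bar (- x) = - bar x" "bar (x - y) = bar x - bar y"
proof -
  show add: "bar (x + y) = bar x + bar y" for x y
    using involution by (simp add: is_involution_def)
  show "bar (x * y) = bar x * bar y" "bar 1 = 1" "bar (bar x) = x"
    using involution by (simp_all add: is_involution_def mult.commute)
  have "bar 0 + 0 = bar 0 + bar 0" using add[of 0 0] by (simp only: add_0_right)
  then show zero: "bar 0 = 0" using add_left_imp_eq by metis
  show minus: "bar (- x) = - bar x" for x
    using add[of x "- x"] zero by (simp add: eq_neg_iff_add_eq_0 add.commute)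
  show "bar (x - y) = bar x - bar y" using add[of x "- y"] minus[of y] by simp
qed

lemma bar_eq_0_iff [simp]: "bar x = 0 \<longleftrightarrow> x = 0"
  using bar_simps(4)[of x] bar_simps(5) by metis

lemma bar_sum: "bar (\<Sum>i\<in>A. f i) = (\<Sum>i\<in>A. bar (f i))"
  by (induction A rule: infinite_finite_induct) simp_all

lemma vector_space_dual: "vector_space (smul (dual bar M))"
  unfolding vector_space_def by (auto simp: fun_eq_iff algebra_simps)

text \<open>The isomorphism is the standard Hermitian form of a basis. Its symmetry makes it usable in place of the
isomorphism with the double dual.\<close>

lemma dual_iso_exists:
  assumes "fg_space M"
  shows "\<exists>\<phi>. \<phi> \<in> lin_iso M (dual bar M) \<and> (\<forall>x y. \<phi> y x = bar (\<phi> x y))"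
proof -
  interpret vspace "smul M" using fg_space_vspace[OF assms] .
  obtain B where B: "finite B" "independent B" "span B = carrier M" "card B = rank M"
    using fg_space_basis[OF assms] by blast
  note BM = span_superset[of B, unfolded B(3)]
  note sub = subspace_ofD[OF fg_space_carrier[OF assms]]
  let ?r = "representation B"
  define \<phi> where "\<phi> x y = (if x \<in> carrier M \<and> y \<in> carrier M then \<Sum>b\<in>B. ?r y b * bar (?r x b) else 0)" for x y
  have hom: "\<phi> \<in> lin_hom M (dual bar M)"
  proof (rule lin_homI)
    fix x assume x: "x \<in> carrier M"
    show "\<phi> x \<in> carrier (dual bar M)"
      unfolding dual_simps
      by (rule lin_homI)
        (use x sub in \<open>simp_all add: \<phi>_def representation_add[OF B(2)] representation_scale[OF B(2)] B(3)
          sum.distrib sum_distrib_left algebra_simps\<close>)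
    show "\<phi> (x + y) = \<phi> x + \<phi> y" if "y \<in> carrier M" for y
      using x that sub(4)[of x y]
      by (auto simp add: fun_eq_iff \<phi>_def representation_add[OF B(2)] B(3) sum.distrib algebra_simps)
    show "\<phi> (smul M a x) = smul (dual bar M) a (\<phi> x)" for a
      using x sub(5)[of x a]
      by (auto simp add: fun_eq_iff \<phi>_def representation_scale[OF B(2)] B(3) sum_distrib_left mult_ac)
  qed (auto simp: \<phi>_def fun_eq_iff)
  have at: "\<phi> x b = bar (?r x b)" if "x \<in> carrier M" "b \<in> B" for x b
  proof -
    have "\<phi> x b = (\<Sum>b'\<in>B. if b' = b then bar (?r x b') else 0)"
      using that BM by (auto simp: \<phi>_def representation_basis[OF B(2)] intro!: sum.cong)
    then show ?thesis using B(1) that(2) by simp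
  qed
  have "\<phi> \<in> lin_iso M (dual bar M)"
  proof (rule lin_isoI[OF hom assms])
    fix x assume x: "x \<in> carrier M" "\<phi> x = 0"
    then have "?r x b = 0" if "b \<in> B" for b using at[OF x(1) that] by simp
    then show "x = 0" using sum_representation[OF B(1,2), of x] x(1) B(3) by simp
  next
    fix f assume "f \<in> carrier (dual bar M)"
    then have f: "f \<in> lin_hom M scalars" by simp
    let ?x = "\<Sum>b\<in>B. smul M (bar (f b)) b"
    have "?x \<in> span B" by (intro span_sum span_scale span_base)
    then have x: "?x \<in> carrier M" using B(3) by simp
    have "\<phi> ?x y = f y" for y
    proof (cases "y \<in> carrier M")
      case True
      have "f y = f (\<Sum>b\<in>B. smul M (?r y b) b)" using sum_representation[OF B(1,2), of y] True B(3) by simp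
      also have "\<dots> = (\<Sum>b\<in>B. ?r y b * f b)" using lin_hom_sum[OF f assms B(1) BM, of "?r y"] by simp
      also have "\<dots> = \<phi> ?x y"
        using True x representation_sum_basis[OF B(1,2), of "\<lambda>b. bar (f b)"] by (simp add: \<phi>_def)
      finally show ?thesis by simp
    next
      case False
      then show ?thesis using functionalD(3)[OF f] by (simp add: \<phi>_def)
    qed
    then show "\<exists>x\<in>carrier M. \<phi> x = f" using x by blast
  qed
  moreover have "\<phi> y x = bar (\<phi> x y)" for x y
    by (simp add: \<phi>_def bar_sum mult.commute)
  ultimately show ?thesis by blast
qed

lemma fg_space_dual:
  assumes "fg_space M"
  shows "fg_space (dual bar M)" "rank (dual bar M) = rank M"
  using dual_iso_exists[OF assms] lin_iso_rank[OF _ assms vector_space_dual] by blast+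

end

section \<open>Sesquilinear forms and their classes\<close>

text \<open>Unlike \<^const>\<open>lin_hom\<close>, this prescribes nothing outside the carrier, so that it covers
inclusions and the projections of a product.\<close>

definition linear_on ::
  "('a::field, 'v::ab_group_add) space \<Rightarrow> ('a, 'w::ab_group_add) space \<Rightarrow> ('v \<Rightarrow> 'w) \<Rightarrow> bool" where
  "linear_on M N f \<longleftrightarrow> (\<forall>x\<in>carrier M. f x \<in> carrier N) \<and>
     (\<forall>x\<in>carrier M. \<forall>y\<in>carrier M. f (x + y) = f x + f y) \<and>
     (\<forall>a. \<forall>x\<in>carrier M. f (smul M a x) = smul N a (f x))"

lemma lin_hom_linear_on: "f \<in> lin_hom M N \<Longrightarrow> linear_on M N f"
  unfolding lin_hom_def linear_on_def by auto

locale sign_involution = involution bar for bar :: "'a::field \<Rightarrow> 'a" +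
  fixes e :: 'a
  assumes e_square [simp]: "e * e = 1" and bar_e [simp]: "bar e = e"
begin

lemma e_nonzero [simp]: "e \<noteq> 0"
  using e_square by (metis mult_zero_left zero_neq_one)

text \<open>The values outside the carrier are left free, in contrast to \<^const>\<open>lin_hom\<close>; thus forms can be
pulled back and added by plain formulas, and are normalised only when their class is taken.\<close>

definition sesq :: "('a, 'v::ab_group_add) space \<Rightarrow> ('v \<Rightarrow> 'v \<Rightarrow> 'a) \<Rightarrow> bool" where
  "sesq M \<phi> \<longleftrightarrow> (\<forall>x\<in>carrier M. \<forall>y\<in>carrier M. \<forall>z\<in>carrier M.
       \<phi> (x + y) z = \<phi> x z + \<phi> y z \<and> \<phi> z (x + y) = \<phi> z x + \<phi> z y) \<and>
     (\<forall>a. \<forall>x\<in>carrier M. \<forall>y\<in>carrier M.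
       \<phi> (smul M a x) y = bar a * \<phi> x y \<and> \<phi> x (smul M a y) = a * \<phi> x y)"

definition symm :: "('v \<Rightarrow> 'v \<Rightarrow> 'a) \<Rightarrow> 'v \<Rightarrow> 'v \<Rightarrow> 'a" where
  "symm \<phi> x y = \<phi> x y + e * bar (\<phi> y x)"

text \<open>The forms \<open>\<chi> - T\<chi>\<close>, which represent zero in \<open>Q\<^sub>\<epsilon>(M)\<close>.\<close>

definition null_on :: "('a, 'v::ab_group_add) space \<Rightarrow> ('v \<Rightarrow> 'v \<Rightarrow> 'a) \<Rightarrow> bool" where
  "null_on M \<phi> \<longleftrightarrow> (\<exists>\<chi>. sesq M \<chi> \<and>
     (\<forall>x\<in>carrier M. \<forall>y\<in>carrier M. \<phi> x y = \<chi> x y - e * bar (\<chi> y x)))"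

abbreviation qc :: "('a, 'v::ab_group_add) space \<Rightarrow> ('v \<Rightarrow> 'v \<Rightarrow> 'a) \<Rightarrow> ('v \<Rightarrow> 'v \<Rightarrow> 'a) set" where
  "qc M \<phi> \<equiv> Q_class bar e M (restrict_form M \<phi>)"

lemma sesqD:
  assumes "sesq M \<phi>" "x \<in> carrier M" "y \<in> carrier M"
  shows "z \<in> carrier M \<Longrightarrow> \<phi> (x + y) z = \<phi> x z + \<phi> y z"
    "z \<in> carrier M \<Longrightarrow> \<phi> z (x + y) = \<phi> z x + \<phi> z y"
    "\<phi> (smul M a x) y = bar a * \<phi> x y" "\<phi> x (smul M a y) = a * \<phi> x y"
  using assms unfolding sesq_def by blast+

lemma sesq_0:
  assumes "sesq M \<phi>" "0 \<in> carrier M" "x \<in> carrier M"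
  shows "\<phi> 0 x = 0" "\<phi> x 0 = 0"
proof -
  have "a = 0" if "a = a + a" for a :: 'a using that by (metis add_cancel_right_right)
  then show "\<phi> 0 x = 0" "\<phi> x 0 = 0"
    using sesqD(1,2)[OF assms(1,2,2,3)] by (simp_all only: add_0_left)
qed

lemma sesq_minus:
  assumes "sesq M \<phi>" "x \<in> carrier M" "y \<in> carrier M" "z \<in> carrier M" "x - y \<in> carrier M"
  shows "\<phi> (x - y) z = \<phi> x z - \<phi> y z" "\<phi> z (x - y) = \<phi> z x - \<phi> z y"
  using sesqD(1,2)[OF assms(1,5,3,4)] by simp_all

lemma sesq_cong:
  assumes "sesq M \<phi>" "subspace_of M (carrier M)"
    "\<And>x y. x \<in> carrier M \<Longrightarrow> y \<in> carrier M \<Longrightarrow> \<phi>' x y = \<phi> x y"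
  shows "sesq M \<phi>'"
  using assms(1) unfolding sesq_def
  by (simp add: assms(3) subspace_ofD(4,5)[OF assms(2)])

lemma sesq_add: "sesq M \<phi> \<Longrightarrow> sesq M \<phi>' \<Longrightarrow> sesq M (\<lambda>x y. \<phi> x y + \<phi>' x y)"
  unfolding sesq_def by (simp add: algebra_simps)

lemma sesq_uminus: "sesq M \<phi> \<Longrightarrow> sesq M (\<lambda>x y. - \<phi> x y)"
  unfolding sesq_def by simp

lemma sesq_zero: "sesq M (\<lambda>x y. 0)"
  unfolding sesq_def by simp

lemma sesq_T: "sesq M \<phi> \<Longrightarrow> sesq M (\<lambda>x y. e * bar (\<phi> y x))"
  unfolding sesq_def by (simp add: algebra_simps)

lemma sesq_symm: "sesq M \<phi> \<Longrightarrow> sesq M (symm \<phi>)"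
  unfolding symm_def[abs_def] by (intro sesq_add sesq_T)

lemma symm_swap: "symm \<phi> y x = e * bar (symm \<phi> x y)"
  unfolding symm_def by (simp add: algebra_simps)

lemma sesq_comp:
  assumes "sesq N \<phi>" "linear_on M N f" "linear_on M N g"
  shows "sesq M (\<lambda>x y. \<phi> (f x) (g y))"
  using assms unfolding sesq_def linear_on_def by simp

lemma null_onI:
  assumes "sesq M \<chi>" "\<And>x y. x \<in> carrier M \<Longrightarrow> y \<in> carrier M \<Longrightarrow> \<phi> x y = \<chi> x y - e * bar (\<chi> y x)"
  shows "null_on M \<phi>"
  using assms unfolding null_on_def by blast

lemma null_on_cong:
  assumes "null_on M \<phi>" "\<And>x y. x \<in> carrier M \<Longrightarrow> y \<in> carrier M \<Longrightarrow> \<phi>' x y = \<phi> x y"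
  shows "null_on M \<phi>'"
  using assms unfolding null_on_def by auto

lemma null_on_add:
  assumes "null_on M \<phi>" "null_on M \<phi>'"
  shows "null_on M (\<lambda>x y. \<phi> x y + \<phi>' x y)"
proof -
  obtain \<chi> where c: "sesq M \<chi>"
    "\<forall>x\<in>carrier M. \<forall>y\<in>carrier M. \<phi> x y = \<chi> x y - e * bar (\<chi> y x)"
    using assms(1) unfolding null_on_def by blast
  obtain \<chi>' where c': "sesq M \<chi>'"
    "\<forall>x\<in>carrier M. \<forall>y\<in>carrier M. \<phi>' x y = \<chi>' x y - e * bar (\<chi>' y x)"
    using assms(2) unfolding null_on_def by blast
  show ?thesis
    by (rule null_onI[OF sesq_add[OF c(1) c'(1)]]) (simp add: c(2) c'(2) algebra_simps)
qed

lemma null_on_uminus: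
  assumes "null_on M \<phi>"
  shows "null_on M (\<lambda>x y. - \<phi> x y)"
proof -
  obtain \<chi> where c: "sesq M \<chi>"
    "\<forall>x\<in>carrier M. \<forall>y\<in>carrier M. \<phi> x y = \<chi> x y - e * bar (\<chi> y x)"
    using assms(1) unfolding null_on_def by blast
  show ?thesis
    by (rule null_onI[OF sesq_uminus[OF c(1)]]) (simp add: c(2) algebra_simps)
qed

lemma null_on_zero: "null_on M (\<lambda>x y. 0)"
  by (rule null_onI[OF sesq_zero]) simp

lemma null_on_comp:
  assumes "null_on N \<phi>" "linear_on M N f"
  shows "null_on M (\<lambda>x y. \<phi> (f x) (f y))"
proof -
  obtain \<chi> where c: "sesq N \<chi>"
    "\<forall>x\<in>carrier N. \<forall>y\<in>carrier N. \<phi> x y = \<chi> x y - e * bar (\<chi> y x)"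
    using assms(1) unfolding null_on_def by blast
  show ?thesis
    by (rule null_onI[OF sesq_comp[OF c(1) assms(2,2)]]) (use c(2) assms(2) linear_on_def in blast)
qed

text \<open>\<open>(1 + T)(1 - T) = 0\<close>, because \<open>T\<close> is an involution.\<close>

lemma symm_null_on:
  assumes "null_on M \<phi>" "x \<in> carrier M" "y \<in> carrier M"
  shows "symm \<phi> x y = 0"
proof -
  obtain \<chi> where "\<forall>x\<in>carrier M. \<forall>y\<in>carrier M. \<phi> x y = \<chi> x y - e * bar (\<chi> y x)"
    using assms(1) unfolding null_on_def by blast
  then have "\<phi> x y = \<chi> x y - e * bar (\<chi> y x)" "\<phi> y x = \<chi> y x - e * bar (\<chi> x y)"
    using assms(2,3) by blast+
  then show ?thesis unfolding symm_def by (simp only: bar_simps bar_e) (simp add: algebra_simps)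
qed

lemma form_hom_iff:
  assumes "subspace_of M (carrier M)"
  shows "\<phi> \<in> form_hom bar M \<longleftrightarrow> sesq M \<phi> \<and> (\<forall>x y. x \<notin> carrier M \<or> y \<notin> carrier M \<longrightarrow> \<phi> x y = 0)"
proof
  assume \<phi>: "\<phi> \<in> form_hom bar M"
  note a = lin_homD[OF \<phi>]
  have b: "\<phi> x \<in> lin_hom M scalars" if "x \<in> carrier M" for x using a(1)[OF that] by simp
  have "\<phi> x y = 0" if "x \<notin> carrier M \<or> y \<notin> carrier M" for x y
  proof (cases "x \<in> carrier M")
    case True
    then show ?thesis using functionalD(3)[OF b, of x y] that by blast
  qed (use a(4)[of x] in simp)
  moreover have "sesq M \<phi>"
    unfolding sesq_def
    by (intro conjI ballI allI)
      (use a(2,3) functionalD(1,2)[OF b] in \<open>simp_all add: mult.commute\<close>)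
  ultimately show "sesq M \<phi> \<and> (\<forall>x y. x \<notin> carrier M \<or> y \<notin> carrier M \<longrightarrow> \<phi> x y = 0)"
    by blast
next
  assume \<phi>: "sesq M \<phi> \<and> (\<forall>x y. x \<notin> carrier M \<or> y \<notin> carrier M \<longrightarrow> \<phi> x y = 0)"
  then have s: "sesq M \<phi>" and o1: "x \<notin> carrier M \<Longrightarrow> \<phi> x y = 0" and o2: "y \<notin> carrier M \<Longrightarrow> \<phi> x y = 0" for x y
    by blast+
  show "\<phi> \<in> form_hom bar M"
  proof (rule lin_homI)
    fix x assume x: "x \<in> carrier M"
    show "\<phi> x \<in> carrier (dual bar M)"
      unfolding dual_simps by (rule lin_homI) (use x sesqD[OF s] o2 in auto)
    show "\<phi> (x + y) = \<phi> x + \<phi> y" if y: "y \<in> carrier M" for y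
    proof
      fix z show "\<phi> (x + y) z = (\<phi> x + \<phi> y) z"
        using sesqD(1)[OF s x y, of z] o2[of z] by (cases "z \<in> carrier M") auto
    qed
    show "\<phi> (smul M a x) = smul (dual bar M) a (\<phi> x)" for a
    proof
      fix z show "\<phi> (smul M a x) z = smul (dual bar M) a (\<phi> x) z"
        using sesqD(3)[OF s x, of z a] o2[of z] by (cases "z \<in> carrier M") (auto simp: mult.commute)
    qed
  qed (use o1 in \<open>auto simp: fun_eq_iff\<close>)
qed

lemma restrict_form_mem:
  assumes "subspace_of M (carrier M)" "sesq M \<phi>"
  shows "restrict_form M \<phi> \<in> form_hom bar M"
  unfolding form_hom_iff[OF assms(1)]
  using sesq_cong[OF assms(2,1), of "restrict_form M \<phi>"] by (auto simp: restrict_form_def)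

lemma restrict_form_id:
  assumes "\<phi> \<in> form_hom bar M" "subspace_of M (carrier M)"
  shows "restrict_form M \<phi> = \<phi>"
  using assms(1) unfolding form_hom_iff[OF assms(2)] by (auto simp: restrict_form_def fun_eq_iff)

lemma quad_rel_iff:
  assumes "subspace_of M (carrier M)"
  shows "(\<phi>, \<phi>') \<in> quad_rel bar e M \<longleftrightarrow> \<phi> \<in> form_hom bar M \<and> \<phi>' \<in> form_hom bar M \<and>
    null_on M (\<lambda>x y. \<phi> x y - \<phi>' x y)"
proof -
  have "(\<exists>\<chi>\<in>form_hom bar M. \<phi> - \<phi>' = \<chi> - form_T bar e \<chi>) \<longleftrightarrow> null_on M (\<lambda>x y. \<phi> x y - \<phi>' x y)"
    if \<phi>: "\<phi> \<in> form_hom bar M" "\<phi>' \<in> form_hom bar M"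
  proof
    assume "\<exists>\<chi>\<in>form_hom bar M. \<phi> - \<phi>' = \<chi> - form_T bar e \<chi>"
    then obtain \<chi> where c: "\<chi> \<in> form_hom bar M" "\<phi> - \<phi>' = \<chi> - form_T bar e \<chi>" by blast
    have "\<phi> x y - \<phi>' x y = \<chi> x y - e * bar (\<chi> y x)" for x y
      using fun_cong[OF fun_cong[OF c(2), of x], of y] by (simp add: form_T_def)
    then show "null_on M (\<lambda>x y. \<phi> x y - \<phi>' x y)"
      using c(1) form_hom_iff[OF assms, of \<chi>] by (intro null_onI[of M \<chi>]) auto
  next
    assume "null_on M (\<lambda>x y. \<phi> x y - \<phi>' x y)"
    then obtain \<chi> where c: "sesq M \<chi>"
      "\<forall>x\<in>carrier M. \<forall>y\<in>carrier M. \<phi> x y - \<phi>' x y = \<chi> x y - e * bar (\<chi> y x)"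
      unfolding null_on_def by blast
    have "(\<phi> - \<phi>') x y = (restrict_form M \<chi> - form_T bar e (restrict_form M \<chi>)) x y" for x y
      using c(2) \<phi> unfolding form_hom_iff[OF assms]
      by (cases "x \<in> carrier M \<and> y \<in> carrier M") (auto simp: form_T_def restrict_form_def)
    then have "\<phi> - \<phi>' = restrict_form M \<chi> - form_T bar e (restrict_form M \<chi>)"
      by (intro ext)
    then show "\<exists>\<chi>\<in>form_hom bar M. \<phi> - \<phi>' = \<chi> - form_T bar e \<chi>"
      using restrict_form_mem[OF assms c(1)] by blast
  qed
  then show ?thesis unfolding quad_rel_def by blast
qed

lemma quad_rel_equiv:
  assumes "subspace_of M (carrier M)"
  shows "equiv (form_hom bar M) (quad_rel bar e M)"
proof (rule equivI)
  show "quad_rel bar e M \<subseteq> form_hom bar M \<times> form_hom bar M"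
    by (auto simp: quad_rel_def)
  show "refl_on (form_hom bar M) (quad_rel bar e M)"
    by (rule refl_onI) (simp add: quad_rel_iff[OF assms] null_on_zero)
  show "sym (quad_rel bar e M)"
  proof (rule symI)
    fix \<phi> \<phi>' assume a: "(\<phi>, \<phi>') \<in> quad_rel bar e M"
    have "null_on M (\<lambda>x y. - (\<phi> x y - \<phi>' x y))"
      using a quad_rel_iff[OF assms] by (intro null_on_uminus) blast
    then show "(\<phi>', \<phi>) \<in> quad_rel bar e M"
      using a quad_rel_iff[OF assms] null_on_cong by fastforce
  qed
  show "trans (quad_rel bar e M)"
  proof (rule transI)
    fix \<phi> \<phi>' \<phi>'' assume a: "(\<phi>, \<phi>') \<in> quad_rel bar e M" "(\<phi>', \<phi>'') \<in> quad_rel bar e M"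
    have "null_on M (\<lambda>x y. (\<phi> x y - \<phi>' x y) + (\<phi>' x y - \<phi>'' x y))"
      using a quad_rel_iff[OF assms] by (intro null_on_add) blast+
    then show "(\<phi>, \<phi>'') \<in> quad_rel bar e M"
      using a quad_rel_iff[OF assms] by simp
  qed
qed

lemma qc_eq_iff:
  assumes "subspace_of M (carrier M)" "sesq M \<phi>" "sesq M \<phi>'"
  shows "qc M \<phi> = qc M \<phi>' \<longleftrightarrow> null_on M (\<lambda>x y. \<phi> x y - \<phi>' x y)"
proof -
  note m = restrict_form_mem[OF assms(1,2)] restrict_form_mem[OF assms(1,3)]
  have "qc M \<phi> = qc M \<phi>' \<longleftrightarrow> (restrict_form M \<phi>, restrict_form M \<phi>') \<in> quad_rel bar e M"
    unfolding Q_class_def using eq_equiv_class_iff[OF quad_rel_equiv[OF assms(1)] m] by simp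
  also have "\<dots> \<longleftrightarrow> null_on M (\<lambda>x y. restrict_form M \<phi> x y - restrict_form M \<phi>' x y)"
    using quad_rel_iff[OF assms(1)] m by simp
  also have "\<dots> \<longleftrightarrow> null_on M (\<lambda>x y. \<phi> x y - \<phi>' x y)"
    unfolding null_on_def by (auto simp: restrict_form_def)
  finally show ?thesis .
qed

lemma mem_qc_iff:
  assumes "subspace_of M (carrier M)" "sesq M \<phi>"
  shows "\<theta> \<in> qc M \<phi> \<longleftrightarrow> \<theta> \<in> form_hom bar M \<and> null_on M (\<lambda>x y. \<phi> x y - \<theta> x y)"
proof -
  have "null_on M (\<lambda>x y. restrict_form M \<phi> x y - \<theta> x y) \<longleftrightarrow> null_on M (\<lambda>x y. \<phi> x y - \<theta> x y)"
    unfolding null_on_def by (auto simp: restrict_form_def)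
  then show ?thesis
    unfolding Q_class_def using quad_rel_iff[OF assms(1), of "restrict_form M \<phi>" \<theta>]
      restrict_form_mem[OF assms] by simp
qed

lemma qc_self:
  assumes "subspace_of M (carrier M)" "sesq M \<phi>"
  shows "restrict_form M \<phi> \<in> qc M \<phi>"
  unfolding mem_qc_iff[OF assms]
  using restrict_form_mem[OF assms] null_on_cong[OF null_on_zero, of M "\<lambda>x y. \<phi> x y - restrict_form M \<phi> x y"]
  by (simp add: restrict_form_def)

lemma Q_group_mem:
  assumes "subspace_of M (carrier M)"
  shows "\<psi> \<in> Q_group bar e M \<longleftrightarrow> (\<exists>\<phi>. sesq M \<phi> \<and> \<psi> = qc M \<phi>)"
proof
  assume "\<psi> \<in> Q_group bar e M"
  then obtain \<phi> where \<phi>: "\<phi> \<in> form_hom bar M" "\<psi> = Q_class bar e M \<phi>"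
    unfolding Q_group_def Q_class_def by (auto elim: quotientE)
  then show "\<exists>\<phi>. sesq M \<phi> \<and> \<psi> = qc M \<phi>"
    using restrict_form_id[OF \<phi>(1) assms] form_hom_iff[OF assms] by metis
next
  assume "\<exists>\<phi>. sesq M \<phi> \<and> \<psi> = qc M \<phi>"
  then show "\<psi> \<in> Q_group bar e M"
    unfolding Q_group_def Q_class_def using restrict_form_mem[OF assms] by (auto intro: quotientI)
qed

text \<open>By \<open>symm_null_on\<close> the symmetrisation is the same for all representatives, so the image whose
element is taken is a singleton.\<close>

lemma symmetrization_qc:
  assumes "subspace_of M (carrier M)" "sesq M \<phi>"
  shows "symmetrization bar e (qc M \<phi>) = symm (restrict_form M \<phi>)"
proof -
  have "\<theta> + form_T bar e \<theta> = symm (restrict_form M \<phi>)" if "\<theta> \<in> qc M \<phi>" for \<theta>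
  proof (intro ext)
    fix x y
    have t: "\<theta> \<in> form_hom bar M" "null_on M (\<lambda>x y. \<phi> x y - \<theta> x y)"
      using that mem_qc_iff[OF assms] by blast+
    show "(\<theta> + form_T bar e \<theta>) x y = symm (restrict_form M \<phi>) x y"
    proof (cases "x \<in> carrier M \<and> y \<in> carrier M")
      case True
      then have "symm (\<lambda>x y. \<phi> x y - \<theta> x y) x y = 0" using symm_null_on[OF t(2)] by blast
      then show ?thesis using True by (simp add: symm_def form_T_def restrict_form_def algebra_simps)
    next
      case False
      then show ?thesis using t(1) form_hom_iff[OF assms(1)]
        by (auto simp: symm_def form_T_def restrict_form_def)
    qed
  qed
  then have "(\<lambda>\<theta>. \<theta> + form_T bar e \<theta>) ` qc M \<phi> = {symm (restrict_form M \<phi>)}"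
    using qc_self[OF assms] by (auto simp: image_iff)
  then show ?thesis unfolding symmetrization_def by simp
qed

text \<open>Null forms pull back to null forms; so the union over all representatives is a single coset.\<close>

lemma Q_pullback_qc:
  assumes "subspace_of M (carrier M)" "subspace_of N (carrier N)" "sesq N \<phi>" "linear_on M N f"
  shows "Q_pullback bar e M f (qc N \<phi>) = qc M (\<lambda>x y. \<phi> (f x) (f y))"
proof -
  have "qc M (\<lambda>x y. \<theta> (f x) (f y)) = qc M (\<lambda>x y. \<phi> (f x) (f y))" if "\<theta> \<in> qc N \<phi>" for \<theta>
  proof -
    have t: "\<theta> \<in> form_hom bar N" "null_on N (\<lambda>x y. \<phi> x y - \<theta> x y)"
      using that mem_qc_iff[OF assms(2,3)] by blast+
    have s: "sesq N \<theta>" using t(1) form_hom_iff[OF assms(2)] by blast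
    have "null_on M (\<lambda>x y. \<phi> (f x) (f y) - \<theta> (f x) (f y))"
      using null_on_comp[OF t(2) assms(4)] .
    then show ?thesis
      using qc_eq_iff[OF assms(1) sesq_comp[OF assms(3,4,4)] sesq_comp[OF s assms(4,4)]] by simp
  qed
  then show ?thesis unfolding Q_pullback_def using qc_self[OF assms(2,3)] by blast
qed

lemma linear_on_fst: "linear_on (sum_space M N) M fst"
  and linear_on_snd: "linear_on (sum_space M N) N snd"
  unfolding linear_on_def by auto

lemma sum_space_carrier:
  assumes "subspace_of M (carrier M)" "subspace_of N (carrier N)"
  shows "subspace_of (sum_space M N) (carrier (sum_space M N))"
  using assms unfolding subspace_of_def by (auto simp: zero_prod_def)

lemma sesq_sum:
  assumes "sesq M \<phi>" "sesq N \<phi>'"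
  shows "sesq (sum_space M N) (\<lambda>x y. \<phi> (fst x) (fst y) + \<phi>' (snd x) (snd y))"
  by (intro sesq_add sesq_comp[OF assms(1)] sesq_comp[OF assms(2)] linear_on_fst linear_on_snd)

lemma Q_sum_qc:
  assumes "subspace_of M (carrier M)" "subspace_of N (carrier N)" "sesq M \<phi>" "sesq N \<phi>'"
  shows "Q_sum bar e M N (qc M \<phi>) (qc N \<phi>') =
    qc (sum_space M N) (\<lambda>x y. \<phi> (fst x) (fst y) + \<phi>' (snd x) (snd y))"
proof -
  have "qc (sum_space M N) (\<lambda>(x, x') (y, y'). \<theta> x y + \<theta>' x' y') =
    qc (sum_space M N) (\<lambda>x y. \<phi> (fst x) (fst y) + \<phi>' (snd x) (snd y))"
    if "\<theta> \<in> qc M \<phi>" "\<theta>' \<in> qc N \<phi>'" for \<theta> \<theta>'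
  proof -
    have t: "\<theta> \<in> form_hom bar M" "null_on M (\<lambda>x y. \<phi> x y - \<theta> x y)"
      using that(1) mem_qc_iff[OF assms(1,3)] by blast+
    have t': "\<theta>' \<in> form_hom bar N" "null_on N (\<lambda>x y. \<phi>' x y - \<theta>' x y)"
      using that(2) mem_qc_iff[OF assms(2,4)] by blast+
    have s: "sesq M \<theta>" "sesq N \<theta>'" using t(1) t'(1) form_hom_iff assms(1,2) by blast+
    have eq: "(\<lambda>(x, x') (y, y'). \<theta> x y + \<theta>' x' y') = (\<lambda>x y. \<theta> (fst x) (fst y) + \<theta>' (snd x) (snd y))"
      by (simp add: fun_eq_iff)
    have "null_on (sum_space M N) (\<lambda>x y. (\<phi> (fst x) (fst y) - \<theta> (fst x) (fst y)) +
        (\<phi>' (snd x) (snd y) - \<theta>' (snd x) (snd y)))"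
      by (intro null_on_add null_on_comp[OF t(2) linear_on_fst] null_on_comp[OF t'(2) linear_on_snd])
    then have "null_on (sum_space M N) (\<lambda>x y. (\<phi> (fst x) (fst y) + \<phi>' (snd x) (snd y)) -
        (\<theta> (fst x) (fst y) + \<theta>' (snd x) (snd y)))"
      by (rule null_on_cong) simp
    then show ?thesis
      unfolding eq using qc_eq_iff[OF sum_space_carrier[OF assms(1,2)] sesq_sum[OF assms(3,4)] sesq_sum[OF s]]
      by simp
  qed
  then show ?thesis unfolding Q_sum_def
    using qc_self[OF assms(1,3)] qc_self[OF assms(2,4)] by blast
qed

section \<open>Quasi-formations in terms of representatives\<close>

text \<open>Bijectivity of the adjoint map \<open>M \<rightarrow> M\<^sup>*\<close> in terms of elements.\<close>

definition nondegenerate :: "('a, 'v::ab_group_add) space \<Rightarrow> ('v \<Rightarrow> 'v \<Rightarrow> 'a) \<Rightarrow> bool" where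
  "nondegenerate M h \<longleftrightarrow> (\<forall>x\<in>carrier M. (\<forall>y\<in>carrier M. h x y = 0) \<longrightarrow> x = 0) \<and>
     (\<forall>f\<in>lin_hom M scalars. \<exists>x\<in>carrier M. \<forall>y\<in>carrier M. h x y = f y)"

lemma nondegenerateD:
  assumes "nondegenerate M h"
  shows "x \<in> carrier M \<Longrightarrow> (\<And>y. y \<in> carrier M \<Longrightarrow> h x y = 0) \<Longrightarrow> x = 0"
    "f \<in> lin_hom M scalars \<Longrightarrow> \<exists>x\<in>carrier M. \<forall>y\<in>carrier M. h x y = f y"
  using assms unfolding nondegenerate_def by blast+

lemma nonsingular_form_iff:
  assumes "fg_space M" "sesq M \<phi>"
  shows "nonsingular_form bar e M (qc M \<phi>) \<longleftrightarrow> nondegenerate M (symm \<phi>)"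
proof -
  note sub = fg_space_carrier[OF assms(1)]
  let ?h = "restrict_form M (symm \<phi>)"
  have eq: "symm (restrict_form M \<phi>) = ?h"
    by (auto simp: symm_def restrict_form_def fun_eq_iff)
  have hom: "?h \<in> lin_hom M (dual bar M)"
    using restrict_form_mem[OF sub sesq_symm[OF assms(2)]] .
  have out: "f y = 0" if "f \<in> lin_hom M scalars" "y \<notin> carrier M" for f y
    using functionalD(3)[OF that] .
  have val: "?h x y = symm \<phi> x y" if "x \<in> carrier M" "y \<in> carrier M" for x y
    using that by (simp add: restrict_form_def)
  have "?h \<in> lin_iso M (dual bar M) \<longleftrightarrow> nondegenerate M (symm \<phi>)"
  proof
    assume iso: "?h \<in> lin_iso M (dual bar M)"
    show "nondegenerate M (symm \<phi>)"
      unfolding nondegenerate_def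
    proof (intro conjI ballI impI)
      fix x assume x: "x \<in> carrier M" "\<forall>y\<in>carrier M. symm \<phi> x y = 0"
      have "?h x = 0" using x by (auto simp: fun_eq_iff restrict_form_def)
      then show "x = 0" using lin_iso_eq_0[OF iso x(1)] subspace_ofD(3)[OF sub] by blast
    next
      fix f assume "f \<in> lin_hom M scalars"
      then obtain x where "x \<in> carrier M" "?h x = f" using lin_isoD(4)[OF iso, of f] by auto
      then show "\<exists>x\<in>carrier M. \<forall>y\<in>carrier M. symm \<phi> x y = f y" using val by (intro bexI[of _ x]) auto
    qed
  next
    assume nd: "nondegenerate M (symm \<phi>)"
    show "?h \<in> lin_iso M (dual bar M)"
    proof (rule lin_isoI[OF hom assms(1)])
      fix x assume x: "x \<in> carrier M" "?h x = 0"
      then have "\<forall>y\<in>carrier M. symm \<phi> x y = 0" using val[OF x(1)] by simp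
      then show "x = 0" using nd x(1) unfolding nondegenerate_def by blast
    next
      fix f assume "f \<in> carrier (dual bar M)"
      then have f: "f \<in> lin_hom M scalars" by simp
      then obtain x where x: "x \<in> carrier M" "\<forall>y\<in>carrier M. symm \<phi> x y = f y"
        using nd unfolding nondegenerate_def by blast
      have "?h x y = f y" for y
        using x out[OF f, of y] by (cases "y \<in> carrier M") (auto simp: restrict_form_def)
      then show "\<exists>x\<in>carrier M. ?h x = f" using x(1) by blast
    qed
  qed
  then show ?thesis
    unfolding nonsingular_form_def symmetrization_qc[OF sub assms(2)] eq
    using assms Q_group_mem[OF sub] by blast
qed

lemma lagrangian_iff:
  assumes "fg_space M" "sesq M \<phi>"
  shows "lagrangian bar e M (qc M \<phi>) L \<longleftrightarrow> subspace_of M L \<and>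
    (\<forall>x\<in>carrier M. x \<in> L \<longleftrightarrow> (\<forall>y\<in>L. symm \<phi> x y = 0)) \<and> null_on (sub_space M L) \<phi>"
proof -
  note sub = fg_space_carrier[OF assms(1)]
  have ds: "direct_summand M L \<longleftrightarrow> subspace_of M L"
    unfolding direct_summand_iff[OF assms(1)]
    using complement_exists[OF assms(1)] complementaryD(1) by blast
  have "L = orthogonal_compl bar e M (qc M \<phi>) L \<longleftrightarrow>
      (\<forall>x\<in>carrier M. x \<in> L \<longleftrightarrow> (\<forall>y\<in>L. symm \<phi> x y = 0))"
    "Q_pullback bar e (sub_space M L) (\<lambda>x. x) (qc M \<phi>) = Q_class bar e (sub_space M L) 0 \<longleftrightarrow>
      null_on (sub_space M L) \<phi>"
    if L: "subspace_of M L"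
  proof -
    note LM = subspace_ofD(1)[OF L]
    have v: "symm (restrict_form M \<phi>) x y = symm \<phi> x y" if "x \<in> carrier M" "y \<in> L" for x y
      using that LM by (auto simp: symm_def restrict_form_def)
    have "orthogonal_compl bar e M (qc M \<phi>) L = {x \<in> carrier M. \<forall>y\<in>L. symm \<phi> x y = 0}"
      unfolding orthogonal_compl_def symmetrization_qc[OF sub assms(2)] using v by auto
    then show "L = orthogonal_compl bar e M (qc M \<phi>) L \<longleftrightarrow>
      (\<forall>x\<in>carrier M. x \<in> L \<longleftrightarrow> (\<forall>y\<in>L. symm \<phi> x y = 0))" using LM by auto
    have l: "linear_on (sub_space M L) M (\<lambda>x. x)" using LM unfolding linear_on_def by auto
    have s: "subspace_of (sub_space M L) (carrier (sub_space M L))"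
      using L unfolding subspace_of_def by simp
    have z: "Q_class bar e (sub_space M L) 0 = qc (sub_space M L) (\<lambda>x y. 0)"
    proof -
      have "restrict_form (sub_space M L) (\<lambda>x y. 0) = (0 :: 'b \<Rightarrow> 'b \<Rightarrow> 'a)"
        by (simp add: restrict_form_def fun_eq_iff)
      then show ?thesis by simp
    qed
    show "Q_pullback bar e (sub_space M L) (\<lambda>x. x) (qc M \<phi>) = Q_class bar e (sub_space M L) 0 \<longleftrightarrow>
      null_on (sub_space M L) \<phi>"
      unfolding z Q_pullback_qc[OF s sub assms(2) l]
        qc_eq_iff[OF s sesq_comp[OF assms(2) l l] sesq_zero] by simp
  qed
  then show ?thesis unfolding lagrangian_def ds by blast
qed

lemma half_rank_summand_iff:
  assumes "fg_space M"
  shows "half_rank_summand M V \<longleftrightarrow> subspace_of M V \<and> 2 * rank (sub_space M V) = rank M"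
  unfolding half_rank_summand_def direct_summand_iff[OF assms]
  using complement_exists[OF assms] complementaryD(1) by fastforce

text \<open>A quasi-formation whose quadratic form is given by a representative.\<close>

definition qf :: "('a, 'v::ab_group_add) space \<Rightarrow> ('v \<Rightarrow> 'v \<Rightarrow> 'a) \<Rightarrow> 'v set \<Rightarrow> 'v set \<Rightarrow>
    ('a, 'v) quasi_formation" where
  "qf M \<phi> L V = \<lparr>qspace = M, qform = qc M \<phi>, qlag = L, qhalf = V\<rparr>"

lemma is_quasi_formation_qf_iff:
  assumes "fg_space M" "sesq M \<phi>"
  shows "is_quasi_formation bar e (qf M \<phi> L V) \<longleftrightarrow> nondegenerate M (symm \<phi>) \<and>
    (subspace_of M L \<and> (\<forall>x\<in>carrier M. x \<in> L \<longleftrightarrow> (\<forall>y\<in>L. symm \<phi> x y = 0)) \<and>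
      null_on (sub_space M L) \<phi>) \<and>
    subspace_of M V \<and> 2 * rank (sub_space M V) = rank M"
  unfolding is_quasi_formation_def qf_def
  by (simp add: nonsingular_form_iff[OF assms] lagrangian_iff[OF assms] half_rank_summand_iff[OF assms(1)])

lemma is_quasi_formation_qfE:
  assumes "is_quasi_formation bar e F"
  obtains M \<phi> L V where "F = qf M \<phi> L V" "fg_space M" "sesq M \<phi>"
proof -
  have "nonsingular_form bar e (qspace F) (qform F)"
    using assms unfolding is_quasi_formation_def by blast
  then have fg: "fg_space (qspace F)" and "qform F \<in> Q_group bar e (qspace F)"
    unfolding nonsingular_form_def by blast+
  then obtain \<phi> where "sesq (qspace F) \<phi>" "qform F = qc (qspace F) \<phi>"
    using Q_group_mem[OF fg_space_carrier[OF fg]] by blast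
  then show ?thesis using that[of "qspace F" \<phi> "qlag F" "qhalf F"] fg by (simp add: qf_def)
qed

lemma qf_isomorphic_iff:
  assumes "subspace_of M (carrier M)" "sesq M \<phi>" "subspace_of N (carrier N)" "sesq N \<theta>"
  shows "qf_isomorphic bar e (qf M \<phi> L V) (qf N \<theta> L' V') \<longleftrightarrow>
    (\<exists>f\<in>lin_iso M N. null_on M (\<lambda>x y. \<theta> (f x) (f y) - \<phi> x y) \<and> f ` L = L' \<and> f ` V = V')"
proof -
  have "Q_pullback bar e M f (qc N \<theta>) = qc M \<phi> \<longleftrightarrow> null_on M (\<lambda>x y. \<theta> (f x) (f y) - \<phi> x y)"
    if f: "f \<in> lin_iso M N" for f
  proof -
    have l: "linear_on M N f" using lin_isoD(1)[OF f] lin_hom_linear_on by blast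
    show ?thesis
      unfolding Q_pullback_qc[OF assms(1,3,4) l] qc_eq_iff[OF assms(1) sesq_comp[OF assms(4) l l] assms(2)] ..
  qed
  then show ?thesis unfolding qf_isomorphic_def qf_def by auto
qed

lemma qf_sum_qf:
  assumes "subspace_of M (carrier M)" "subspace_of N (carrier N)" "sesq M \<phi>" "sesq N \<phi>'"
  shows "qf_sum bar e (qf M \<phi> L V) (qf N \<phi>' L' V') =
    qf (sum_space M N) (\<lambda>x y. \<phi> (fst x) (fst y) + \<phi>' (snd x) (snd y)) (L \<times> L') (V \<times> V')"
  unfolding qf_sum_def qf_def using Q_sum_qc[OF assms] by simp

definition hyp :: "'v \<times> ('v \<Rightarrow> 'a) \<Rightarrow> 'v \<times> ('v \<Rightarrow> 'a) \<Rightarrow> 'a" where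
  "hyp x y = snd x (fst y)"

lemma hyp_form_qc: "hyp_form bar e K = qc (hyp_space bar K) hyp"
proof -
  have "restrict_form (hyp_space bar K) (\<lambda>(x, f) (y, g). f y) = restrict_form (hyp_space bar K) hyp"
    by (auto simp: restrict_form_def hyp_def fun_eq_iff)
  then show ?thesis unfolding hyp_form_def by simp
qed

lemma boundary_qf:
  "boundary bar e K \<rho> = qf (hyp_space bar K) hyp (carrier K \<times> {0}) ((\<lambda>x. (x, \<rho> x)) ` carrier K)"
  unfolding boundary_def hyp_form_qc qf_def ..

lemma trivial_formation_qf:
  "trivial_formation bar e P = qf (hyp_space bar P) hyp (carrier P \<times> {0}) ({0} \<times> carrier (dual bar P))"
  unfolding trivial_formation_def hyp_form_qc qf_def ..

lemma hyp_space_simps [simp]: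
  "carrier (hyp_space bar K) = carrier K \<times> lin_hom K scalars"
  "smul (hyp_space bar K) a (x, f) = (smul K a x, (\<lambda>y. f y * bar a))"
  by (simp_all add: hyp_space_def)

lemma sesq_hyp: "sesq (hyp_space bar K) hyp"
  unfolding sesq_def hyp_def using functionalD by (auto simp: mult.commute)

section \<open>Transport along isomorphisms\<close>

lemma null_on_symm_eq:
  assumes "null_on M (\<lambda>x y. \<theta> (f x) (f y) - \<phi> x y)" "x \<in> carrier M" "y \<in> carrier M"
  shows "symm \<theta> (f x) (f y) = symm \<phi> x y"
  using symm_null_on[OF assms] by (simp add: symm_def algebra_simps)

lemma lin_iso_restrict:
  assumes "f \<in> lin_iso M N" "subspace_of M A" 
  shows "(\<lambda>x. if x \<in> A then f x else 0) \<in> lin_iso (sub_space M A) (sub_space N (f ` A))"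
proof -
  note f = lin_isoD[OF assms(1)]
  have "(\<lambda>x. if x \<in> A then f x else 0) \<in> lin_hom (sub_space M A) (sub_space N (f ` A))"
    by (rule lin_homI) (use lin_homD[OF f(1)] subspace_ofD[OF assms(2)] in auto)
  moreover have "inj_on f A" using f(2) subspace_ofD(1)[OF assms(2)] inj_on_subset by blast
  then have "bij_betw (\<lambda>x. if x \<in> A then f x else 0) A (f ` A)"
    unfolding bij_betw_def by (auto simp: inj_on_def)
  ultimately show ?thesis unfolding lin_iso_def by simp
qed

lemma rank_image_iso:
  assumes "f \<in> lin_iso M N" "subspace_of M A" "fg_space M" "vector_space (smul N)"
  shows "rank (sub_space N (f ` A)) = rank (sub_space M A)"
  using lin_iso_rank(2)[OF lin_iso_restrict[OF assms(1,2)] fg_sub_space[OF assms(3,2)]] assms(4) by simp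

text \<open>Serves to see that the copy of a quasi-formation on another type is again one.\<close>

lemma is_quasi_formation_iso:
  assumes "fg_space M" "sesq M \<phi>" "fg_space N" "sesq N \<theta>" "f \<in> lin_iso M N"
    "null_on M (\<lambda>x y. \<theta> (f x) (f y) - \<phi> x y)" "is_quasi_formation bar e (qf M \<phi> L V)"
  shows "is_quasi_formation bar e (qf N \<theta> (f ` L) (f ` V))"
proof -
  note f = lin_isoD[OF assms(5)]
  note hom = lin_homD[OF f(1)]
  have q: "nondegenerate M (symm \<phi>)" "subspace_of M L"
    "\<And>x. x \<in> carrier M \<Longrightarrow> x \<in> L \<longleftrightarrow> (\<forall>y\<in>L. symm \<phi> x y = 0)" "null_on (sub_space M L) \<phi>"
    "subspace_of M V" "2 * rank (sub_space M V) = rank M"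
    using assms(7) unfolding is_quasi_formation_qf_iff[OF assms(1,2)] by blast+
  note LM = subspace_ofD(2)[OF q(2)]
  note eq = null_on_symm_eq[of M \<theta> f \<phi>, OF assms(6)]
  let ?g = "inv_iso M N f"
  note g = inv_iso[OF assms(5,1)]
  have nd: "nondegenerate N (symm \<theta>)"
    unfolding nondegenerate_def
  proof (intro conjI ballI impI)
    fix y assume y: "y \<in> carrier N" "\<forall>z\<in>carrier N. symm \<theta> y z = 0"
    obtain x where x: "x \<in> carrier M" "f x = y" using f(4)[OF y(1)] by blast
    have "symm \<phi> x z = 0" if "z \<in> carrier M" for z
      using eq[OF x(1) that] y(2) hom(1)[OF that] x(2) by simp
    then have "x = 0" using q(1) x(1) unfolding nondegenerate_def by blast
    then show "y = 0" using x(2) lin_hom_0[OF f(1)] by simp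
  next
    fix k assume "k \<in> lin_hom N scalars"
    then have "(\<lambda>x. k (f x)) \<in> lin_hom M scalars" using lin_hom_comp[OF f(1)] by blast
    from nondegenerateD(2)[OF q(1) this]
    obtain x where x: "x \<in> carrier M" "\<forall>y\<in>carrier M. symm \<phi> x y = k (f y)" by blast
    have "symm \<theta> (f x) z = k z" if z: "z \<in> carrier N" for z
    proof -
      obtain y where y: "y \<in> carrier M" "f y = z" using f(4)[OF z] by blast
      then show ?thesis using eq[OF x(1) y(1)] x(2) by simp
    qed
    then show "\<exists>x\<in>carrier N. \<forall>y\<in>carrier N. symm \<theta> x y = k y" using hom(1)[OF x(1)] by blast
  qed
  have lag: "\<forall>y\<in>carrier N. y \<in> f ` L \<longleftrightarrow> (\<forall>z\<in>f ` L. symm \<theta> y z = 0)"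
  proof
    fix y assume "y \<in> carrier N"
    then obtain x where x: "x \<in> carrier M" "f x = y" using f(4) by blast
    have "y \<in> f ` L \<longleftrightarrow> x \<in> L"
      using x f(2) LM by (metis (no_types, lifting) image_iff inj_onD)
    also have "\<dots> \<longleftrightarrow> (\<forall>z\<in>f ` L. symm \<theta> y z = 0)"
      unfolding q(3)[OF x(1)] using eq[OF x(1)] LM x(2) by auto
    finally show "y \<in> f ` L \<longleftrightarrow> (\<forall>z\<in>f ` L. symm \<theta> y z = 0)" .
  qed
  have subL: "subspace_of N (f ` L)" and subV: "subspace_of N (f ` V)"
    using subspace_of_image[OF f(1)] q(2,5) by blast+
  have lg: "linear_on N M ?g" using lin_isoD(1)[OF g(1)] lin_hom_linear_on by blast
  have lgL: "linear_on (sub_space N (f ` L)) (sub_space M L) ?g"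
    using lg LM hom(1) g(2) unfolding linear_on_def by auto
  have null1: "null_on (sub_space N (f ` L)) (\<lambda>x y. \<phi> (?g x) (?g y))"
    using null_on_comp[OF q(4) lgL] .
  have lgN: "linear_on (sub_space N (f ` L)) M ?g"
    using lgL LM unfolding linear_on_def by auto
  have null2: "null_on (sub_space N (f ` L)) (\<lambda>x y. \<theta> (f (?g x)) (f (?g y)) - \<phi> (?g x) (?g y))"
    using null_on_comp[OF assms(6) lgN] .
  have "null_on (sub_space N (f ` L)) \<theta>"
    using null_on_add[OF null1 null2] g(3) subspace_ofD(2)[OF subL] by (auto elim!: null_on_cong)
  moreover have "2 * rank (sub_space N (f ` V)) = rank N"
    using rank_image_iso[OF assms(5) q(5) assms(1)] lin_iso_rank(2)[OF assms(5,1)] fg_space_vs[OF assms(3)] q(6)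
    by simp
  ultimately show ?thesis
    unfolding is_quasi_formation_qf_iff[OF assms(3,4)] using nd lag subL subV by blast
qed

lemma qf_isomorphic_trans:
  assumes "fg_space M" "sesq M \<phi>" "fg_space N" "sesq N \<theta>" "fg_space P" "sesq P \<chi>"
    "qf_isomorphic bar e (qf M \<phi> L V) (qf N \<theta> L' V')"
    "qf_isomorphic bar e (qf N \<theta> L' V') (qf P \<chi> L'' V'')"
  shows "qf_isomorphic bar e (qf M \<phi> L V) (qf P \<chi> L'' V'')"
proof -
  note c = fg_space_carrier[OF assms(1)] fg_space_carrier[OF assms(3)] fg_space_carrier[OF assms(5)]
  obtain f where f: "f \<in> lin_iso M N" "null_on M (\<lambda>x y. \<theta> (f x) (f y) - \<phi> x y)" "f ` L = L'" "f ` V = V'"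
    using assms(7) unfolding qf_isomorphic_iff[OF c(1) assms(2) c(2) assms(4)] by blast
  obtain g where g: "g \<in> lin_iso N P" "null_on N (\<lambda>x y. \<chi> (g x) (g y) - \<theta> x y)" "g ` L' = L''" "g ` V' = V''"
    using assms(8) unfolding qf_isomorphic_iff[OF c(2) assms(4) c(3) assms(6)] by blast
  have "null_on M (\<lambda>x y. (\<chi> (g (f x)) (g (f y)) - \<theta> (f x) (f y)) + (\<theta> (f x) (f y) - \<phi> x y))"
    by (rule null_on_add[OF null_on_comp[OF g(2)] f(2)])
      (use lin_isoD(1)[OF f(1)] lin_hom_linear_on in blast)
  then have "null_on M (\<lambda>x y. \<chi> (g (f x)) (g (f y)) - \<phi> x y)" by simp
  moreover have "(\<lambda>x. g (f x)) ` L = L''" "(\<lambda>x. g (f x)) ` V = V''"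
    unfolding f(3)[symmetric] f(4)[symmetric] g(3)[symmetric] g(4)[symmetric] by auto
  ultimately show ?thesis
    unfolding qf_isomorphic_iff[OF c(1) assms(2) c(3) assms(6)]
    using lin_iso_comp[OF f(1) g(1)] by (intro bexI[of _ "\<lambda>x. g (f x)"] conjI)
qed

lemma quasi_formation_univ_copy_exists:
  fixes N :: "('a, 'v::ab_group_add) space"
  assumes "fg_space N" "sesq N \<theta>" "is_quasi_formation bar e (qf N \<theta> L V)"
  shows "\<exists>(W :: ('a, 'a univ) space) \<phi> L' V'. fg_space W \<and> sesq W \<phi> \<and>
     is_quasi_formation bar e (qf W \<phi> L' V') \<and>
     qf_isomorphic bar e (qf W \<phi> L' V') (qf N \<theta> L V) \<and>
     qf_isomorphic bar e (qf N \<theta> L V) (qf W \<phi> L' V')"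
proof -
  obtain W :: "('a, 'a univ) space" and w where W: "fg_space W" "w \<in> lin_iso W N"
    using univ_copy_exists[OF assms(1)] by blast
  let ?c = "inv_iso W N w"
  note c = inv_iso[OF W(2,1)]
  note w = lin_isoD[OF W(2)]
  have lw: "linear_on W N w" using lin_hom_linear_on[OF w(1)] .
  define \<phi> where "\<phi> x y = \<theta> (w x) (w y)" for x y
  have s: "sesq W \<phi>" unfolding \<phi>_def[abs_def] by (rule sesq_comp[OF assms(2) lw lw])
  have LV: "x \<in> carrier N" if "x \<in> L \<union> V" for x
    using assms(3) that subspace_ofD(2) unfolding is_quasi_formation_qf_iff[OF assms(1,2)] by blast
  have n: "null_on N (\<lambda>x y. \<phi> (?c x) (?c y) - \<theta> x y)"
    by (rule null_on_cong[OF null_on_zero]) (simp add: \<phi>_def c(3))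
  have 1: "is_quasi_formation bar e (qf W \<phi> (?c ` L) (?c ` V))"
    using is_quasi_formation_iso[of N \<theta> W \<phi> ?c L V, OF assms(1,2) W(1) s c(1) n assms(3)] .
  have "(\<lambda>x. w (?c x)) ` A = A" if "A \<subseteq> L \<union> V" for A
    using that LV c(3) by (force simp: image_iff)
  then have im: "w ` ?c ` L = L" "w ` ?c ` V = V" unfolding image_image by blast+
  have n': "null_on W (\<lambda>x y. \<theta> (w x) (w y) - \<phi> x y)"
    by (rule null_on_cong[OF null_on_zero]) (simp add: \<phi>_def)
  note cW = fg_space_carrier[OF W(1)] and cN = fg_space_carrier[OF assms(1)]
  have 2: "qf_isomorphic bar e (qf W \<phi> (?c ` L) (?c ` V)) (qf N \<theta> L V)"
    unfolding qf_isomorphic_iff[OF cW s cN assms(2)] using W(2) n' im by blast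
  have 3: "qf_isomorphic bar e (qf N \<theta> L V) (qf W \<phi> (?c ` L) (?c ` V))"
    unfolding qf_isomorphic_iff[OF cN assms(2) cW s] using c(1) n by blast
  show ?thesis using W(1) s 1 2 3 by blast
qed

lemma fg_hyp_space:
  assumes "fg_space K"
  shows "fg_space (hyp_space bar K)" "rank (hyp_space bar K) = 2 * rank K"
  unfolding hyp_space_def using fg_sum_space[OF assms fg_space_dual(1)[OF assms]] fg_space_dual(2)[OF assms]
  by simp_all

lemma zero_functional: "(0 :: 'v::ab_group_add \<Rightarrow> 'a) \<in> lin_hom M scalars"
  by (rule lin_homI) auto

text \<open>The point is that every functional \<open>k\<close> on \<open>K\<^sup>*\<close> is an evaluation. With a Hermitian isomorphism
\<open>\<phi> : K \<rightarrow> K\<^sup>*\<close>, the composite \<open>k \<circ> \<phi>\<close> is a functional on \<open>K\<close>, hence equal to some \<open>\<phi> x\<^sub>0\<close>, and the symmetry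
of \<open>\<phi>\<close> turns \<open>k (\<phi> x) = \<phi> x\<^sub>0 x\<close> into the conjugate of \<open>\<phi> x\<close> at \<open>x\<^sub>0\<close>.\<close>

lemma nondegenerate_hyp:
  fixes K :: "('a, 'v::ab_group_add) space"
  assumes "fg_space K"
  shows "nondegenerate (hyp_space bar K) (symm hyp)"
proof -
  obtain \<phi> where \<phi>: "\<phi> \<in> lin_iso K (dual bar K)" "\<And>x y. \<phi> y x = bar (\<phi> x y)"
    using dual_iso_exists[OF assms] by blast
  note hom = lin_homD[OF lin_isoD(1)[OF \<phi>(1)]]
  note sub = subspace_ofD[OF fg_space_carrier[OF assms]]
  have func: "\<phi> x \<in> lin_hom K scalars" if "x \<in> carrier K" for x using hom(1)[OF that] by simp
  have val: "symm hyp (x, f) (y, g) = f y + e * bar (g x)" for x :: 'v and f y g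
    by (simp add: symm_def hyp_def)
  show ?thesis
    unfolding nondegenerate_def
  proof (intro conjI ballI impI)
    fix t assume t: "t \<in> carrier (hyp_space bar K)" "\<forall>s\<in>carrier (hyp_space bar K). symm hyp t s = 0"
    obtain x f where tx: "t = (x, f)" by (cases t)
    then have x: "x \<in> carrier K" and f: "f \<in> lin_hom K scalars" using t(1) by simp_all
    have z: "f y + e * bar (g x) = 0" if "y \<in> carrier K" "g \<in> lin_hom K scalars" for y g
      using t(2) that unfolding tx val[symmetric] by simp
    have fy: "f y = 0" if "y \<in> carrier K" for y using z[OF that zero_functional] by simp
    then have "f = 0" using functionalD(3)[OF f] by (auto simp: fun_eq_iff)
    moreover have "\<phi> x y = 0" for y
    proof (cases "y \<in> carrier K")
      case True
      have "e * bar (\<phi> y x) = 0" using z[OF x func[OF True]] fy[OF x] by simp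
      then have "e * (e * bar (\<phi> y x)) = 0" by simp
      then show ?thesis using \<phi>(2)[of x y] by simp
    next
      case False
      then show ?thesis using functionalD(3)[OF func[OF x]] by simp
    qed
    then have "\<phi> x = 0" by (simp add: fun_eq_iff)
    then have "x = 0" using lin_iso_eq_0[OF \<phi>(1) x] sub(3) by blast
    ultimately show "t = 0" using tx by (simp add: zero_prod_def)
  next
    fix k assume k: "k \<in> lin_hom (hyp_space bar K) scalars"
    note kD = functionalD[OF k]
    have "(\<lambda>x. k (x, 0)) \<in> lin_hom K scalars"
    proof (rule lin_homI)
      fix x y assume "x \<in> carrier K" "y \<in> carrier K"
      then show "k (x + y, 0) = k (x, 0) + k (y, 0)" using kD(1)[of "(x, 0)" "(y, 0)"] by (simp add: zero_functional)
    next
      fix a x assume "x \<in> carrier K"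
      then show "k (smul K a x, 0) = smul scalars a (k (x, 0))"
        using kD(2)[of "(x, 0)" a] zero_functional[of K] by (simp add: zero_fun_def)
    qed (use kD(3) in auto)
    note f = this
    let ?k = "\<lambda>x. if x \<in> carrier K then k (0, \<phi> x) else 0"
    have fk: "?k \<in> lin_hom K scalars"
    proof (rule lin_homI)
      fix x y assume xy: "x \<in> carrier K" "y \<in> carrier K"
      have "k (0, \<phi> (x + y)) = k (0, \<phi> x) + k (0, \<phi> y)"
        using kD(1)[of "(0, \<phi> x)" "(0, \<phi> y)"] func xy sub(3) hom(2)[OF xy] by simp
      then show "(if x + y \<in> carrier K then k (0, \<phi> (x + y)) else 0) =
         (if x \<in> carrier K then k (0, \<phi> x) else 0) + (if y \<in> carrier K then k (0, \<phi> y) else 0)"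
        using xy sub(4) by simp
    next
      fix a x assume x: "x \<in> carrier K"
      have "smul K a 0 = 0" using vector_space_minus[OF fg_space_vs[OF assms]] module.scale_zero_right
          fg_space_vs[OF assms] module_iff_vector_space by metis
      then have "k (0, \<phi> (smul K a x)) = a * k (0, \<phi> x)"
        using kD(2)[of "(0, \<phi> x)" a] func[OF x] sub(3) hom(3)[OF x, of a] by simp
      then show "(if smul K a x \<in> carrier K then k (0, \<phi> (smul K a x)) else 0) =
         smul scalars a (if x \<in> carrier K then k (0, \<phi> x) else 0)"
        using x sub(5) by simp
    qed auto
    have "\<exists>x\<in>carrier K. \<phi> x = ?k" by (rule lin_isoD(4)[OF \<phi>(1)]) (simp only: dual_simps fk)
    then obtain x0 where x0: "x0 \<in> carrier K" "\<phi> x0 = ?k" by blast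
    have x0': "k (0, g) = bar (g x0)" if g: "g \<in> lin_hom K scalars" for g
    proof -
      obtain x where x: "x \<in> carrier K" "\<phi> x = g" using lin_isoD(4)[OF \<phi>(1), of g] g by auto
      show ?thesis using fun_cong[OF x0(2), of x] x \<phi>(2)[of x0 x] by simp
    qed
    \<comment> \<open>The factor \<open>e\<close> undoes the one in the symmetrised hyperbolic form.\<close>
    let ?t = "(smul K e x0, \<lambda>x. k (x, 0))"
    have "symm hyp ?t s = k s" if s: "s \<in> carrier (hyp_space bar K)" for s
    proof -
      obtain y g where yg: "s = (y, g)" "y \<in> carrier K" "g \<in> lin_hom K scalars" using s by (cases s) auto
      have "k (y, g) = k (y, 0) + k (0, g)"
        using kD(1)[of "(y, 0)" "(0, g)"] yg sub(3) by (simp add: zero_functional)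
      then show ?thesis
        unfolding yg(1) val using x0'[OF yg(3)] functionalD(2)[OF yg(3) x0(1), of e] by simp
    qed
    moreover have "?t \<in> carrier (hyp_space bar K)" using f x0(1) sub(5) by simp
    ultimately show "\<exists>x\<in>carrier (hyp_space bar K). \<forall>y\<in>carrier (hyp_space bar K). symm hyp x y = k y" by blast
  qed
qed

lemma is_quasi_formation_boundary:
  fixes K :: "('a, 'v::ab_group_add) space"
  assumes "fg_space K" "\<rho> \<in> form_hom bar K"
  shows "is_quasi_formation bar e (boundary bar e K \<rho>)"
proof -
  let ?H = "hyp_space bar K"
  note fgH = fg_hyp_space[OF assms(1)]
  note sub = subspace_ofD[OF fg_space_carrier[OF assms(1)]]
  note \<rho> = lin_homD[OF assms(2), unfolded dual_simps]
  have val: "symm hyp (x, f) (y, g) = f y + e * bar (g x)" for x :: 'v and f y g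
    by (simp add: symm_def hyp_def)
  let ?L = "carrier K \<times> {0 :: 'v \<Rightarrow> 'a}" and ?V = "(\<lambda>x. (x, \<rho> x)) ` carrier K"
  have L: "subspace_of ?H ?L"
    using sub zero_functional[of K] unfolding subspace_of_def by (auto simp: zero_prod_def zero_fun_def)
  have iso: "(\<lambda>x. (x, \<rho> x)) ` carrier K = (\<lambda>x. if x \<in> carrier K then (x, \<rho> x) else 0) ` carrier K"
    by auto
  have homV: "(\<lambda>x. if x \<in> carrier K then (x, \<rho> x) else 0) \<in> lin_hom K ?H"
    by (rule lin_homI) (use \<rho> sub in auto)
  have V: "subspace_of ?H ?V"
    unfolding iso using subspace_of_image[OF homV fg_space_carrier[OF assms(1)]] .
  have "(\<lambda>x. if x \<in> carrier K then (x, \<rho> x) else 0) \<in> lin_iso K (sub_space ?H ?V)"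
  proof (rule lin_isoI[OF _ assms(1)])
    show "(\<lambda>x. if x \<in> carrier K then (x, \<rho> x) else 0) \<in> lin_hom K (sub_space ?H ?V)"
      by (rule lin_homI) (use lin_homD[OF homV] in auto)
  qed (auto simp: zero_prod_def)
  from lin_iso_rank(2)[OF this assms(1)] have rV: "rank (sub_space ?H ?V) = rank K"
    using fg_space_vs[OF fgH(1)] by simp
  have lag: "t \<in> ?L \<longleftrightarrow> (\<forall>s\<in>?L. symm hyp t s = 0)" if t: "t \<in> carrier ?H" for t
  proof -
    obtain x f where xf: "t = (x, f)" "x \<in> carrier K" "f \<in> lin_hom K scalars" using t by (cases t) auto
    have "(\<forall>s\<in>?L. symm hyp t s = 0) \<longleftrightarrow> (\<forall>y\<in>carrier K. f y = 0)"
      unfolding xf(1) by (auto simp: val)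
    also have "\<dots> \<longleftrightarrow> f = 0" using functionalD(3)[OF xf(3)] by (auto simp: fun_eq_iff)
    finally show ?thesis using xf by simp
  qed
  have "null_on (sub_space ?H ?L) hyp"
    by (rule null_on_cong[OF null_on_zero]) (auto simp: hyp_def)
  then show ?thesis
    unfolding boundary_qf is_quasi_formation_qf_iff[OF fgH(1) sesq_hyp]
    using nondegenerate_hyp[OF assms(1)] L V lag rV fgH(2) by simp
qed

text \<open>On the side of the target it suffices to add the trivial formation of the zero space.\<close>

lemma stably_isomorphicI:
  fixes F :: "('a, 'a univ) quasi_formation" and P :: "('a, 'a univ) space"
  assumes "fg_space P" "fg_space T" "sesq T \<phi>" "fg_space W" "sesq W \<theta>"
    "qf_sum bar e F (trivial_formation bar e P) = qf T \<phi> L V"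
    "qf_isomorphic bar e (qf T \<phi> L V) (qf W \<theta> L' V')"
  shows "stably_isomorphic bar e F (qf W \<theta> L' V')"
proof -
  define Z :: "('a, 'a univ) space" where "Z = \<lparr>carrier = {0}, smul = (\<lambda>a v i. a * v i)\<rparr>"
  have vZ: "vector_space (smul Z)"
    unfolding vector_space_def Z_def by (auto simp: fun_eq_iff algebra_simps)
  have cZ: "carrier Z = {0}" by (simp add: Z_def)
  have sZ: "smul Z a (\<lambda>x. 0) = (\<lambda>x. 0)" for a by (simp add: Z_def)
  interpret vector_space "smul Z" by (fact vZ)
  have Z: "fg_space Z" unfolding fg_space_def using vZ cZ by (intro conjI exI[of _ "{}"]) simp_all
  have dZ: "lin_hom Z scalars = {0}"
  proof -
    have "f = 0" if f: "f \<in> lin_hom Z scalars" for f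
    proof
      fix x show "f x = 0 x"
        using lin_hom_0[OF f] functionalD(3)[OF f, of x] cZ by (cases "x = 0") simp_all
    qed
    then show ?thesis using zero_functional[of Z] by blast
  qed
  let ?H = "hyp_space bar Z"
  note fgH = fg_hyp_space(1)[OF Z]
  note c = fg_space_carrier[OF assms(2)] fg_space_carrier[OF assms(4)] fg_space_carrier[OF fgH]
  obtain f where f: "f \<in> lin_iso T W" "null_on T (\<lambda>x y. \<theta> (f x) (f y) - \<phi> x y)" "f ` L = L'" "f ` V = V'"
    using assms(7) unfolding qf_isomorphic_iff[OF c(1) assms(3) c(2) assms(5)] by blast
  note hom = lin_homD[OF lin_isoD(1)[OF f(1)]]
  let ?S = "sum_space W ?H" and ?\<theta> = "\<lambda>x y. \<theta> (fst x) (fst y) + hyp (snd x) (snd y)"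
  let ?g = "\<lambda>t. (f t, (0, 0))"
  have "?g \<in> lin_hom T ?S"
    by (rule lin_homI) (use hom cZ sZ zero_functional[of Z] in \<open>auto simp: zero_prod_def zero_fun_def\<close>)
  then have iso: "?g \<in> lin_iso T ?S"
  proof (rule lin_isoI[OF _ assms(2)])
    fix x assume "x \<in> carrier T" "?g x = 0"
    then show "x = 0" using lin_iso_eq_0[OF f(1)] subspace_ofD(3)[OF c(1)] by (simp add: zero_prod_def)
  next
    fix y assume "y \<in> carrier ?S"
    then show "\<exists>x\<in>carrier T. ?g x = y" using lin_isoD(4)[OF f(1)] cZ dZ by (cases y) auto
  qed
  have "qf_isomorphic bar e (qf T \<phi> L V) (qf ?S ?\<theta> (L' \<times> (carrier Z \<times> {0})) (V' \<times> ({0} \<times> carrier (dual bar Z))))"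
    unfolding qf_isomorphic_iff[OF c(1) assms(3) sum_space_carrier[OF c(2,3)] sesq_sum[OF assms(5) sesq_hyp]]
  proof (intro bexI[OF _ iso] conjI)
    show "null_on T (\<lambda>x y. ?\<theta> (?g x) (?g y) - \<phi> x y)" using f(2) by (simp add: hyp_def)
  qed (use f(3,4) cZ dZ in auto)
  then show ?thesis
    unfolding stably_isomorphic_def
    by (intro exI[of _ P] exI[of _ Z] conjI assms(1) Z)
      (simp only: assms(6) trivial_formation_qf[of Z] qf_sum_qf[OF c(2,3) assms(5) sesq_hyp])
qed

section \<open>Complementary Lagrangians\<close>

text \<open>A Lagrangian is dual to every complement: extend a functional on \<open>L\<close> by zero and represent it by
some \<open>l + n\<close>; as \<open>l\<close> is orthogonal to \<open>L\<close>, the functional is represented by \<open>n\<close> alone.\<close>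

lemma lagrangian_pairing:
  assumes "fg_space M" "sesq M \<phi>" "nondegenerate M (symm \<phi>)" "complementary M L N"
    "\<forall>x\<in>carrier M. x \<in> L \<longleftrightarrow> (\<forall>y\<in>L. symm \<phi> x y = 0)"
  shows "\<And>x. x \<in> N \<Longrightarrow> (\<forall>y\<in>L. symm \<phi> x y = 0) \<Longrightarrow> x = 0"
    "\<And>f. f \<in> lin_hom (sub_space M L) scalars \<Longrightarrow> \<exists>x\<in>N. \<forall>y\<in>L. symm \<phi> x y = f y"
proof -
  note D = complementaryD[OF assms(4)]
  note s = sesq_symm[OF assms(2)]
  note LM = subspace_ofD(2)[OF D(1)] and NM = subspace_ofD(2)[OF D(2)]
  show "x = 0" if "x \<in> N" "\<forall>y\<in>L. symm \<phi> x y = 0" for x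
    using bspec[OF assms(5), OF NM[OF that(1)]] that D(3) by blast
  fix f assume f: "f \<in> lin_hom (sub_space M L) scalars"
  let ?p = "proj_on M L N"
  note p = proj_on[OF assms(1,4)]
  have "(\<lambda>x. f (?p x)) \<in> lin_hom M scalars" by (rule lin_hom_comp[OF p(4) f])
  from nondegenerateD(2)[OF assms(3) this]
  obtain x where x: "x \<in> carrier M" "\<forall>y\<in>carrier M. symm \<phi> x y = f (?p y)" by blast
  obtain l n where ln: "l \<in> L" "n \<in> N" "x = l + n" using D(4)[OF x(1)] by blast
  have "symm \<phi> n y = f y" if y: "y \<in> L" for y
  proof -
    have "symm \<phi> l y = 0" using bspec[OF assms(5), OF LM[OF ln(1)]] ln(1) y by blast
    then have "symm \<phi> x y = symm \<phi> n y"
      using sesqD(1)[OF s LM[OF ln(1)] NM[OF ln(2)] LM[OF y]] ln(3) by simp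
    moreover have "?p y = y" using p(3)[OF y subspace_ofD(3)[OF D(2)]] by simp
    ultimately show ?thesis using x(2) LM[OF y] by simp
  qed
  then show "\<exists>x\<in>N. \<forall>y\<in>L. symm \<phi> x y = f y" using ln(2) by blast
qed

text \<open>Let \<open>q\<close> be the projection to an arbitrary complement \<open>N\<^sub>0\<close> of \<open>L\<close>. For each \<open>x\<close> the functional
\<open>\<phi> (q x) (q \<cdot>)\<close> vanishes on \<open>L\<close>, so it is \<open>h (\<kappa> x)\<close> for some \<open>\<kappa> x\<close> in \<open>L\<^sup>\<bottom> = L\<close>. Shearing \<open>N\<^sub>0\<close> by \<open>- \<kappa>\<close>
yields the Lagrangian: modulo null forms, both cross terms of \<open>\<phi> (q x - \<kappa> x) (q y - \<kappa> y)\<close> add up to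
\<open>- h (\<kappa> x) (q y)\<close>, which cancels \<open>\<phi> (q x) (q y)\<close>.\<close>

lemma lagrangian_complement_exists:
  assumes "fg_space M" "sesq M \<phi>" "nondegenerate M (symm \<phi>)" "subspace_of M L"
    "\<forall>x\<in>carrier M. x \<in> L \<longleftrightarrow> (\<forall>y\<in>L. symm \<phi> x y = 0)" "null_on (sub_space M L) \<phi>"
  shows "\<exists>N. complementary M L N \<and> null_on (sub_space M N) \<phi>"
proof -
  obtain N0 where N0: "complementary M L N0" using complement_exists[OF assms(1,4)] by blast
  note D = complementaryD[OF N0]
  note LM = subspace_ofD(2)[OF D(1)] and NM = subspace_ofD(2)[OF D(2)]
  note sub = fg_space_carrier[OF assms(1)]
  note subM = subspace_ofD[OF sub]
  note vs = fg_space_vs[OF assms(1)]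
  note h = sesq_symm[OF assms(2)]
  define p where "p = proj_on M L N0"
  note p = proj_on[OF assms(1) N0, folded p_def]
  note phom = lin_homD[OF p(4), unfolded sub_space_simps]
  define q where "q x = (if x \<in> carrier M then x - p x else 0)" for x
  have qmem: "q x \<in> N0" if "x \<in> carrier M" for x using p(2)[OF that] that by (simp add: q_def)
  have qM: "q x \<in> carrier M" if "x \<in> carrier M" for x using NM qmem[OF that] by blast
  have q: "q \<in> lin_hom M (sub_space M N0)"
  proof (rule lin_homI)
    fix x y assume "x \<in> carrier M" "y \<in> carrier M"
    then show "q (x + y) = q x + q y" using subM(4) phom(2) by (simp add: q_def)
  next
    fix a x assume x: "x \<in> carrier M"
    interpret vector_space "smul M" by (fact vs)
    show "q (smul M a x) = smul (sub_space M N0) a (q x)"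
      using x subM(5) phom(3) by (simp add: q_def scale_right_diff_distrib)
  qed (use qmem in \<open>auto simp: q_def\<close>)
  note qhom = lin_homD[OF q, unfolded sub_space_simps]
  have qL: "q x = 0" if "x \<in> L" for x
    using p(3)[OF that subspace_ofD(3)[OF D(2)]] by (simp add: q_def)
  have decomp: "x = p x + q x" if "x \<in> carrier M" for x using that by (simp add: q_def)
  have ex: "\<exists>k. k \<in> carrier M \<and> (\<forall>y\<in>carrier M. symm \<phi> k y = \<phi> (q x) (q y))" if x: "x \<in> carrier M" for x
  proof -
    have "(\<lambda>y. if y \<in> carrier M then \<phi> (q x) (q y) else 0) \<in> lin_hom M scalars"
      by (rule lin_homI) (use subM sesqD[OF assms(2) _ qM[OF x]] sesqD(2,4)[OF assms(2)] qM x qhom in auto)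
    from nondegenerateD(2)[OF assms(3) this] show ?thesis by auto
  qed
  define k where "k x = (SOME k. k \<in> carrier M \<and> (\<forall>y\<in>carrier M. symm \<phi> k y = \<phi> (q x) (q y)))" for x
  have k: "k x \<in> carrier M" "\<And>y. y \<in> carrier M \<Longrightarrow> symm \<phi> (k x) y = \<phi> (q x) (q y)"
    if x: "x \<in> carrier M" for x
    using someI_ex[OF ex[OF x], folded k_def] by blast+
  have unique: "u = v" if "u \<in> carrier M" "v \<in> carrier M" "\<forall>y\<in>carrier M. symm \<phi> u y = symm \<phi> v y" for u v
  proof -
    have d: "u - v \<in> carrier M" using subspace_of_diff[OF vs sub that(1,2)] .
    have "\<forall>y\<in>carrier M. symm \<phi> (u - v) y = 0" using sesq_minus(1)[OF h that(1,2) _ d] that(3) by simp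
    then have "u - v = 0" using assms(3) d unfolding nondegenerate_def by blast
    then show ?thesis by simp
  qed
  have kL: "k x \<in> L" if x: "x \<in> carrier M" for x
  proof -
    have "symm \<phi> (k x) y = 0" if y: "y \<in> L" for y
      using k(2)[OF x LM[OF y]] qL[OF y] sesq_0(2)[OF assms(2) subM(3) qM[OF x]] by simp
    then show ?thesis using bspec[OF assms(5), OF k(1)[OF x]] by blast
  qed
  have k_add: "k (x + y) = k x + k y" if xy: "x \<in> carrier M" "y \<in> carrier M" for x y
  proof (rule unique)
    show "k (x + y) \<in> carrier M" "k x + k y \<in> carrier M" using k(1) subM(4) xy by blast+
    show "\<forall>z\<in>carrier M. symm \<phi> (k (x + y)) z = symm \<phi> (k x + k y) z"
      using k(2) sesqD(1)[OF h k(1)[OF xy(1)] k(1)[OF xy(2)]] qhom(2)[OF xy] subM(4)[OF xy] xy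
        sesqD(1)[OF assms(2) qM[OF xy(1)] qM[OF xy(2)]] qM by simp
  qed
  have k_scale: "k (smul M a x) = smul M a (k x)" if x: "x \<in> carrier M" for a x
  proof (rule unique)
    show "k (smul M a x) \<in> carrier M" "smul M a (k x) \<in> carrier M" using k(1) subM(5) x by blast+
    show "\<forall>z\<in>carrier M. symm \<phi> (k (smul M a x)) z = symm \<phi> (smul M a (k x)) z"
      using k(2) sesqD(3)[OF h k(1)[OF x]] qhom(3)[OF x] subM(5)[OF x] x
        sesqD(3)[OF assms(2) qM[OF x]] qM by simp
  qed
  have k_q: "k x = k y" if "x \<in> carrier M" "y \<in> carrier M" "q x = q y" for x y
    by (rule unique) (use k that in auto)
  let ?r = "\<lambda>x. if x \<in> carrier M then q x - k x else 0"
  have rM: "q x - k x \<in> carrier M" if "x \<in> carrier M" for x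
    using subspace_of_diff[OF vs sub qM[OF that] k(1)[OF that]] .
  have r: "?r \<in> lin_hom M M"
  proof (rule lin_homI)
    fix x y assume xy: "x \<in> carrier M" "y \<in> carrier M"
    then show "?r (x + y) = ?r x + ?r y" using k_add qhom(2) subM(4) by simp
  next
    fix a x assume x: "x \<in> carrier M"
    interpret vector_space "smul M" by (fact vs)
    show "?r (smul M a x) = smul M a (?r x)"
      using x k_scale qhom(3) subM(5) by (simp add: scale_right_diff_distrib)
  qed (use rM in auto)
  define N where "N = ?r ` carrier M"
  have N: "subspace_of M N" unfolding N_def by (rule subspace_of_image[OF r sub])
  \<comment> \<open>Elements of \<open>N\<close> are recovered from their own projection, so the null forms below are forms on \<open>N\<close>.\<close>
  have N_eq: "x = q x - k x" if x: "x \<in> N" for x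
  proof -
    obtain m where m: "m \<in> carrier M" "x = q m - k m" using x unfolding N_def by auto
    have qq: "q (q m) = q m"
      using p(3)[OF subspace_ofD(3)[OF D(1)] qmem[OF m(1)]] qM[OF m(1)] by (simp add: q_def)
    have xM: "x \<in> carrier M" using rM[OF m(1)] m(2) by simp
    have "q x = q (q m) - q (k m)"
      using lin_hom_diff[OF q qM[OF m(1)] k(1)[OF m(1)]] rM[OF m(1)] m(2) by simp
    then have "q x = q m" using qq qL[OF kL[OF m(1)]] by simp
    then show ?thesis using k_q[OF xM m(1)] m(2) by simp
  qed
  have comp: "complementary M L N"
  proof (rule complementaryI[OF assms(4) N])
    fix x assume x: "x \<in> L" "x \<in> N"
    have xM: "x \<in> carrier M" using LM x(1) .
    have q0: "q x = q 0" using qL[OF x(1)] qL[OF subspace_ofD(3)[OF D(1)]] by simp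
    have "k x = k 0" using k_q[OF xM subM(3) q0] .
    moreover have "k 0 = 0" using k_add[OF subM(3) subM(3)] by (metis add_cancel_right_right)
    ultimately show "x = 0" using N_eq[OF x(2)] qL[OF x(1)] by simp
  next
    fix x assume x: "x \<in> carrier M"
    have "x = (p x + k x) + ?r x" using decomp[OF x] x by simp
    moreover have "p x + k x \<in> L" using subspace_ofD(4)[OF D(1) p(1)[OF x] kL[OF x]] .
    ultimately show "\<exists>a\<in>L. \<exists>c\<in>N. x = a + c" unfolding N_def using x by blast
  qed
  note NM' = subspace_ofD(2)[OF N]
  have lk: "linear_on (sub_space M N) (sub_space M L) k"
    unfolding linear_on_def using NM' kL k_add k_scale by simp
  have lkM: "linear_on (sub_space M N) M k" and lqM: "linear_on (sub_space M N) M q"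
    unfolding linear_on_def using NM' k(1) k_add k_scale qM qhom by simp_all
  have n1: "null_on (sub_space M N) (\<lambda>x y. \<phi> (k x) (k y))"
    by (rule null_on_comp[OF assms(6) lk])
  have n2: "null_on (sub_space M N) (\<lambda>x y. e * bar (\<phi> (q y) (k x)) - \<phi> (q x) (k y))"
    by (rule null_onI[OF sesq_uminus[OF sesq_comp[OF assms(2) lqM lkM]]]) (simp add: algebra_simps)
  have "null_on (sub_space M N) \<phi>"
  proof (rule null_on_cong[OF null_on_add[OF n2 n1]])
    fix x y assume "x \<in> carrier (sub_space M N)" "y \<in> carrier (sub_space M N)"
    then have xy: "x \<in> N" "y \<in> N" by simp_all
    note xyM = NM'[OF xy(1)] NM'[OF xy(2)]
    note mem = qM[OF xyM(1)] qM[OF xyM(2)] k(1)[OF xyM(1)] k(1)[OF xyM(2)]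
    have e1: "\<phi> (q x) (q y) = symm \<phi> (k x) (q y)"
    proof -
      have "q (q y) = q y"
        using p(3)[OF subspace_ofD(3)[OF D(1)] qmem[OF xyM(2)]] mem(2) by (simp add: q_def)
      then show ?thesis using k(2)[OF xyM(1) mem(2)] by simp
    qed
    have "\<phi> x y = \<phi> (q x - k x) (q y - k y)" using N_eq[OF xy(1)] N_eq[OF xy(2)] by simp
    also have "\<dots> = \<phi> (q x) (q y) - \<phi> (q x) (k y) - (\<phi> (k x) (q y) - \<phi> (k x) (k y))"
      using sesq_minus(1)[OF assms(2) mem(1,3) rM[OF xyM(2)] rM[OF xyM(1)]]
        sesq_minus(2)[OF assms(2) mem(2,4,1) rM[OF xyM(2)]]
        sesq_minus(2)[OF assms(2) mem(2,4,3) rM[OF xyM(2)]] by simp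
    finally show "\<phi> x y = e * bar (\<phi> (q y) (k x)) - \<phi> (q x) (k y) + \<phi> (k x) (k y)"
      unfolding e1 symm_def by simp
  qed
  then show ?thesis using comp by blast
qed

text \<open>The isometry to \<open>H(L')\<close> sends \<open>t = l + k\<close> with \<open>l\<close> in \<open>L\<close> and \<open>k\<close> in \<open>K\<close> to the pair of \<open>j\<^sup>-\<^sup>1 l\<close> and the
functional \<open>h k (j \<cdot>)\<close>. It preserves the form because \<open>\<phi>\<close> is null on \<open>L\<close> and on \<open>K\<close>, and because the two
cross terms, \<open>\<phi> (l, k')\<close> and \<open>\<phi> (k, l')\<close>, can be collected modulo null forms into the single term
\<open>h (k, l')\<close>. The projection along \<open>K\<close> restricts to a bijection from \<open>V\<close> to \<open>L\<close>, which makes \<open>V\<close> a graph.\<close>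

lemma boundary_splitting:
  fixes L' :: "('a, 'w::ab_group_add) space"
  assumes "fg_space T" "sesq T \<phi>" "complementary T L K" "complementary T V K"
    "null_on (sub_space T L) \<phi>" "null_on (sub_space T K) \<phi>"
    "\<And>x. x \<in> K \<Longrightarrow> (\<forall>y\<in>L. symm \<phi> x y = 0) \<Longrightarrow> x = 0"
    "\<And>f. f \<in> lin_hom (sub_space T L) scalars \<Longrightarrow> \<exists>x\<in>K. \<forall>y\<in>L. symm \<phi> x y = f y"
    "fg_space L'" "j \<in> lin_iso L' (sub_space T L)"
  shows "\<exists>\<rho>\<in>form_hom bar L'. qf_isomorphic bar e (qf T \<phi> L V) (boundary bar e L' \<rho>)"
proof -
  note D = complementaryD[OF assms(3)] and DV = complementaryD[OF assms(4)]
  note LT = subspace_ofD(2)[OF D(1)] and KT = subspace_ofD(2)[OF D(2)] and VT = subspace_ofD(2)[OF DV(1)]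
  note sub = fg_space_carrier[OF assms(1)] and sub' = fg_space_carrier[OF assms(9)]
  note subT = subspace_ofD[OF sub] and subL' = subspace_ofD[OF sub']
  note vs = fg_space_vs[OF assms(1)]
  interpret vector_space "smul T" by (fact vs)
  note h = sesq_symm[OF assms(2)]
  define p where "p = proj_on T L K"
  note p = proj_on[OF assms(1,3), folded p_def]
  note phom = lin_homD[OF p(4), unfolded sub_space_simps]
  note s = proj_on[OF assms(1,4)]
  let ?i = "inv_iso L' (sub_space T L) j"
  note i = inv_iso[OF assms(10,9), unfolded sub_space_simps]
  note j = lin_homD[OF lin_isoD(1)[OF assms(10)], unfolded sub_space_simps]
  note ihom = lin_homD[OF lin_isoD(1)[OF i(1)], unfolded sub_space_simps]
  have jT: "j x \<in> carrier T" if "x \<in> carrier L'" for x using LT j(1)[OF that] .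
  have qT: "t - p t \<in> carrier T" if "t \<in> carrier T" for t using KT p(2)[OF that] .
  have pT: "p t \<in> carrier T" if "t \<in> carrier T" for t using LT p(1)[OF that] .
  let ?g = "\<lambda>t x. if x \<in> carrier L' then symm \<phi> (t - p t) (j x) else 0"
  let ?f = "\<lambda>t. if t \<in> carrier T then (?i (p t), ?g t) else 0"
  let ?H = "hyp_space bar L'"
  have g: "?g t \<in> lin_hom L' scalars" if t: "t \<in> carrier T" for t
    by (rule lin_homI) (use sesqD(2,4)[OF h] qT[OF t] jT j(2,3) subL'(4,5) in auto)
  have f: "?f \<in> lin_hom T ?H"
  proof (rule lin_homI)
    fix t assume t: "t \<in> carrier T"
    show "?f t \<in> carrier ?H" using t ihom(1)[OF p(1)[OF t]] g[OF t] by simp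
    show "?f (t + u) = ?f t + ?f u" if u: "u \<in> carrier T" for u
    proof -
      have tu: "t + u - p (t + u) = (t - p t) + (u - p u)" using phom(2)[OF t u] by simp
      have "?g (t + u) = ?g t + ?g u"
        unfolding tu using sesqD(1)[OF h qT[OF t] qT[OF u]] jT by (auto simp: fun_eq_iff)
      then show ?thesis using t u subT(4)[OF t u] phom(2)[OF t u] ihom(2)[OF p(1)[OF t] p(1)[OF u]] by simp
    qed
    show "?f (smul T a t) = smul ?H a (?f t)" for a
    proof -
      have "smul T a t - p (smul T a t) = smul T a (t - p t)"
        using phom(3)[OF t] by (simp add: scale_right_diff_distrib)
      then have "?g (smul T a t) = (\<lambda>x. ?g t x * bar a)"
        using sesqD(3)[OF h qT[OF t]] jT by (auto simp: fun_eq_iff mult.commute)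
      then show ?thesis using t subT(5)[OF t, of a] phom(3)[OF t, of a] ihom(3)[OF p(1)[OF t], of a] by simp
    qed
  qed simp
  have j_surj: "\<exists>x\<in>carrier L'. j x = l" if "l \<in> L" for l
    using lin_isoD(4)[OF assms(10), of l] that by simp
  have iso: "?f \<in> lin_iso T ?H"
  proof (rule lin_isoI[OF f assms(1)])
    fix t assume t: "t \<in> carrier T" "?f t = 0"
    then have "?i (p t) = 0" and g0: "?g t = 0" by (auto simp: zero_prod_def)
    then have pt: "p t = 0"
      using lin_iso_eq_0[OF i(1), of "p t"] p(1)[OF t(1)] subspace_ofD(3)[OF D(1)] by simp
    then have tK: "t \<in> K" using p(2)[OF t(1)] by simp
    have "symm \<phi> t l = 0" if l: "l \<in> L" for l
    proof -
      obtain x where x: "x \<in> carrier L'" "j x = l" using j_surj[OF l] by blast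
      then show ?thesis using fun_cong[OF g0, of x] pt by simp
    qed
    then show "t = 0" using assms(7)[OF tK] by blast
  next
    fix y assume "y \<in> carrier ?H"
    then obtain x g where xg: "y = (x, g)" "x \<in> carrier L'" "g \<in> lin_hom L' scalars" by (cases y) auto
    have "(\<lambda>l. g (?i l)) \<in> lin_hom (sub_space T L) scalars"
      using lin_hom_comp[OF lin_isoD(1)[OF i(1)] xg(3)] .
    then obtain k where k: "k \<in> K" "\<forall>l\<in>L. symm \<phi> k l = g (?i l)" using assms(8) by blast
    let ?t = "j x + k"
    have t: "?t \<in> carrier T" using subT(4)[OF jT[OF xg(2)] KT[OF k(1)]] .
    have pt: "p ?t = j x" using p(3)[OF j(1)[OF xg(2)] k(1)] .
    have "?g ?t = g"
      using pt k(2) j(1) i(2) functionalD(3)[OF xg(3)] by (auto simp: fun_eq_iff)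
    then have "?f ?t = y" using t pt i(2)[OF xg(2)] xg(1) by simp
    then show "\<exists>t\<in>carrier T. ?f t = y" using t by blast
  qed
  have lp: "linear_on T (sub_space T L) p" using lin_hom_linear_on[OF p(4)] .
  have lpT: "linear_on T T p" using lp LT unfolding linear_on_def by auto
  have lq: "linear_on T (sub_space T K) (\<lambda>t. t - p t)"
    unfolding linear_on_def using p(2) phom(2,3) by (auto simp: scale_right_diff_distrib)
  have lqT: "linear_on T T (\<lambda>t. t - p t)" using lq KT unfolding linear_on_def by auto
  have n1: "null_on T (\<lambda>x y. - \<phi> (p x) (p y))" and n2: "null_on T (\<lambda>x y. - \<phi> (x - p x) (y - p y))"
    using null_on_uminus null_on_comp[OF assms(5) lp] null_on_comp[OF assms(6) lq] by blast+
  \<comment> \<open>The cross terms of \<open>\<phi>\<close> differ from the symmetrised term by a form \<open>\<chi> - T\<chi>\<close>.\<close>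
  have n3: "null_on T (\<lambda>x y. e * bar (\<phi> (p y) (x - p x)) - \<phi> (p x) (y - p y))"
    by (rule null_onI[OF sesq_uminus[OF sesq_comp[OF assms(2) lpT lqT]]]) simp
  have null: "null_on T (\<lambda>x y. hyp (?f x) (?f y) - \<phi> x y)"
  proof (rule null_on_cong[OF null_on_add[OF null_on_add[OF n1 n2] n3]])
    fix x y assume x: "x \<in> carrier T" and y: "y \<in> carrier T"
    have "hyp (?f x) (?f y) = symm \<phi> (x - p x) (p y)"
      using x y ihom(1)[OF p(1)[OF y]] i(3)[OF p(1)[OF y]] by (simp add: hyp_def)
    moreover have "\<phi> x y = \<phi> (p x) (p y) + \<phi> (p x) (y - p y) + (\<phi> (x - p x) (p y) + \<phi> (x - p x) (y - p y))"
    proof -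
      have "\<phi> x y = \<phi> (p x + (x - p x)) (p y + (y - p y))" by simp
      also have "\<dots> = \<phi> (p x) (p y + (y - p y)) + \<phi> (x - p x) (p y + (y - p y))"
        by (rule sesqD(1)[OF assms(2) pT[OF x] qT[OF x]]) (simp add: y)
      also have "\<dots> = \<phi> (p x) (p y) + \<phi> (p x) (y - p y) + (\<phi> (x - p x) (p y) + \<phi> (x - p x) (y - p y))"
        using sesqD(2)[OF assms(2) pT[OF y] qT[OF y] pT[OF x]]
          sesqD(2)[OF assms(2) pT[OF y] qT[OF y] qT[OF x]] by simp
      finally show ?thesis .
    qed
    ultimately show "hyp (?f x) (?f y) - \<phi> x y =
       - \<phi> (p x) (p y) + - \<phi> (x - p x) (y - p y) + (e * bar (\<phi> (p y) (x - p x)) - \<phi> (p x) (y - p y))"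
      by (simp add: symm_def)
  qed
  have fL: "?f l = (?i l, 0)" if l: "l \<in> L" for l
  proof -
    have "p l = l" using p(3)[OF l subspace_ofD(3)[OF D(2)]] by simp
    then show ?thesis using LT[OF l] sesq_0(1)[OF h subT(3)] jT by (auto simp: fun_eq_iff)
  qed
  have imL: "?f ` L = carrier L' \<times> {0}"
  proof (intro equalityI subsetI)
    fix y assume "y \<in> ?f ` L"
    then obtain l where "l \<in> L" "y = ?f l" by blast
    then show "y \<in> carrier L' \<times> {0}" using fL ihom(1) by simp
  next
    fix y assume "y \<in> carrier L' \<times> {0 :: 'w \<Rightarrow> 'a}"
    then obtain x where x: "x \<in> carrier L'" "y = (x, 0)" by auto
    then have "y = ?f (j x)" using fL[OF j(1)[OF x(1)]] i(2) by simp
    then show "y \<in> ?f ` L" using j(1)[OF x(1)] by blast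
  qed
  let ?s = "proj_on T V K"
  let ?\<rho> = "\<lambda>x. snd (?f (?s (j x)))"
  have sT: "?s (j x) \<in> carrier T" if "x \<in> carrier L'" for x using VT s(1)[OF jT[OF that]] .
  have "j \<in> lin_hom L' T"
    using lin_hom_sub_codomain[OF lin_isoD(1)[OF assms(10)] subspace_ofD(1)[OF D(1)]] .
  then have "(\<lambda>x. ?s (j x)) \<in> lin_hom L' T"
    using lin_hom_comp[OF _ lin_hom_sub_codomain[OF s(4) subspace_ofD(1)[OF DV(1)]]] by blast
  then have hom: "(\<lambda>x. ?f (?s (j x))) \<in> lin_hom L' ?H" using lin_hom_comp[OF _ f] by blast
  have \<rho>: "?\<rho> \<in> form_hom bar L'"
  proof (rule lin_homI)
    fix x assume x: "x \<in> carrier L'"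
    show "?\<rho> x \<in> carrier (dual bar L')"
      using lin_homD(1)[OF hom x] unfolding hyp_space_simps dual_simps mem_Times_iff by (rule conjunct2)
    show "?\<rho> (x + y) = ?\<rho> x + ?\<rho> y" if y: "y \<in> carrier L'" for y
      using lin_homD(2)[OF hom x y] by (simp only: snd_add)
    show "?\<rho> (smul L' a x) = smul (dual bar L') a (?\<rho> x)" for a
    proof -
      obtain u v where uv: "?f (?s (j x)) = (u, v)" by (cases "?f (?s (j x))")
      then show ?thesis using lin_homD(3)[OF hom x, of a] by (simp only: uv) simp
    qed
  next
    fix x assume x: "x \<notin> carrier L'"
    show "?\<rho> x = 0" using lin_homD(4)[OF hom x] by (simp only: snd_zero)
  qed
  have fs: "?f (?s (j x)) = (x, ?\<rho> x)" if x: "x \<in> carrier L'" for x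
  proof -
    have k: "?s (j x) - j x \<in> K"
      using subspace_of_minus[OF vs D(2) s(2)[OF jT[OF x]]] by simp
    have "p (?s (j x)) = j x" using p(3)[OF j(1)[OF x] k] by simp
    then have "fst (?f (?s (j x))) = x" using sT[OF x] i(2)[OF x] by simp
    then show ?thesis by (intro prod_eqI) (simp_all only: fst_conv snd_conv)
  qed
  have imV: "?f ` V = (\<lambda>x. (x, ?\<rho> x)) ` carrier L'"
  proof (intro equalityI subsetI)
    fix y assume "y \<in> ?f ` V"
    then obtain v where v: "v \<in> V" "y = ?f v" by blast
    have vT: "v \<in> carrier T" using VT v(1) .
    let ?x = "?i (p v)"
    have x: "?x \<in> carrier L'" using ihom(1)[OF p(1)[OF vT]] .
    have "- (v - p v) \<in> K" using subspace_of_minus[OF vs D(2) p(2)[OF vT]] .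
    then have "?s (v + - (v - p v)) = v" by (rule s(3)[OF v(1)])
    moreover have "v + - (v - p v) = j ?x" using i(3)[OF p(1)[OF vT]] by simp
    ultimately have "?s (j ?x) = v" by simp
    then have "y = (?x, ?\<rho> ?x)" unfolding v(2) using fs[OF x] by (simp only:)
    then show "y \<in> (\<lambda>x. (x, ?\<rho> x)) ` carrier L'" using x by blast
  next
    fix y assume "y \<in> (\<lambda>x. (x, ?\<rho> x)) ` carrier L'"
    then obtain x where x: "x \<in> carrier L'" "y = (x, ?\<rho> x)" by blast
    have "y = ?f (?s (j x))" unfolding x(2) by (rule fs[OF x(1), symmetric])
    then show "y \<in> ?f ` V" using s(1)[OF jT[OF x(1)]] by (rule image_eqI)
  qed
  have "qf_isomorphic bar e (qf T \<phi> L V) (boundary bar e L' ?\<rho>)"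
    unfolding boundary_qf qf_isomorphic_iff[OF sub assms(2) fg_space_carrier[OF fg_hyp_space(1)[OF assms(9)]] sesq_hyp]
    by (intro bexI[OF _ iso] conjI null imL imV)
  then show ?thesis using \<rho> by blast
qed

text \<open>\<open>h\<close> as a map from \<open>A\<close> to the dual of \<open>B\<close>.\<close>

definition pair :: "('v \<Rightarrow> 'v \<Rightarrow> 'a) \<Rightarrow> 'v set \<Rightarrow> 'v set \<Rightarrow> 'v \<Rightarrow> 'v \<Rightarrow> 'a" where
  "pair h A B x = (\<lambda>y. if x \<in> A \<and> y \<in> B then h x y else 0)"

lemma pair_hom:
  assumes "sesq M h" "subspace_of M A" "subspace_of M B"
  shows "pair h A B \<in> lin_hom (sub_space M A) (dual bar (sub_space M B))"
proof (rule lin_homI)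
  note AM = subspace_ofD(2)[OF assms(2)] and BM = subspace_ofD(2)[OF assms(3)]
  fix x assume "x \<in> carrier (sub_space M A)"
  then have x: "x \<in> A" by simp
  have "pair h A B x \<in> lin_hom (sub_space M B) scalars"
    by (rule lin_homI)
      (use x AM BM sesqD(2,4)[OF assms(1)] subspace_ofD(4,5)[OF assms(3)] in \<open>auto simp: pair_def\<close>)
  then show "pair h A B x \<in> carrier (dual bar (sub_space M B))" by simp
  show "pair h A B (x + y) = pair h A B x + pair h A B y" if "y \<in> carrier (sub_space M A)" for y
    using that x AM BM sesqD(1)[OF assms(1)] subspace_ofD(4)[OF assms(2)]
    by (auto simp: pair_def fun_eq_iff)
  show "pair h A B (smul (sub_space M A) a x) = smul (dual bar (sub_space M B)) a (pair h A B x)" for a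
    using x AM BM sesqD(3)[OF assms(1)] subspace_ofD(5)[OF assms(2)]
    by (auto simp: pair_def fun_eq_iff mult.commute)
qed (auto simp: pair_def fun_eq_iff)

lemma pair_eq_0_iff: "x \<in> A \<Longrightarrow> pair h A B x = 0 \<longleftrightarrow> (\<forall>y\<in>B. h x y = 0)"
  by (auto simp: pair_def fun_eq_iff)

lemma pair_eq_iff:
  assumes "f \<in> lin_hom (sub_space M B) scalars" "x \<in> A"
  shows "pair h A B x = f \<longleftrightarrow> (\<forall>y\<in>B. h x y = f y)"
  using assms(2) functionalD(3)[OF assms(1)] by (auto simp: pair_def fun_eq_iff)

end

section \<open>A subspace dual to the intersection of V with a Lagrangian complement\<close>

text \<open>A nonsingular form with two complementary Lagrangians.\<close>

locale split_lagrangian = sign_involution bar e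
  for bar :: "'a::field \<Rightarrow> 'a" and e :: 'a +
  fixes M :: "('a, 'v::ab_group_add) space" and \<phi> :: "'v \<Rightarrow> 'v \<Rightarrow> 'a" and L N :: "'v set"
  assumes fg: "fg_space M" and sesq: "sesq M \<phi>" and nondeg: "nondegenerate M (symm \<phi>)"
    and comp: "complementary M L N"
    and perp: "\<forall>x\<in>carrier M. x \<in> L \<longleftrightarrow> (\<forall>y\<in>L. symm \<phi> x y = 0)"
    and null_L: "null_on (sub_space M L) \<phi>" and null_N: "null_on (sub_space M N) \<phi>"
begin

definition h :: "'v \<Rightarrow> 'v \<Rightarrow> 'a" where "h = symm \<phi>"

definition p :: "'v \<Rightarrow> 'v" where "p = proj_on M L N"

lemmas subM = subspace_ofD[OF fg_space_carrier[OF fg]]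
lemmas vs = fg_space_vs[OF fg]
lemmas L_subspace = complementaryD(1)[OF comp] and N_subspace = complementaryD(2)[OF comp]
lemmas LM = subspace_ofD(2)[OF L_subspace] and NM = subspace_ofD(2)[OF N_subspace]
lemmas nondeg_h = nondeg[folded h_def] and perp_h = bspec[OF perp[folded h_def]]
lemmas fg_sub = fg_sub_space[OF fg]

sublocale vspace "smul M"
  using vs by (simp add: vspace_def)

lemmas p_proj = proj_on[OF fg comp, folded p_def]
lemmas p_hom = lin_homD[OF p_proj(4), unfolded sub_space_simps]

lemma p_lin_hom: "p \<in> lin_hom M M"
  using lin_hom_sub_codomain[OF p_proj(4) subspace_ofD(1)[OF L_subspace]] .

lemma p_L: "x \<in> L \<Longrightarrow> p x = x"
  using p_proj(3)[of x 0] subspace_ofD(3)[OF N_subspace] by simp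

lemma p_N: "x \<in> N \<Longrightarrow> p x = 0"
  using p_proj(3)[of 0 x] subspace_ofD(3)[OF L_subspace] by simp

lemma h_sesq: "sesq M h"
  unfolding h_def by (rule sesq_symm[OF sesq])

lemma h_swap: "h x y = e * bar (h y x)"
  unfolding h_def by (rule symm_swap)

lemma h_L: "x \<in> L \<Longrightarrow> y \<in> L \<Longrightarrow> h x y = 0"
  using perp_h[OF LM, of x] by blast

lemma h_N: "x \<in> N \<Longrightarrow> y \<in> N \<Longrightarrow> h x y = 0"
  unfolding h_def using symm_null_on[OF null_N] by simp

lemmas N_dual_L = lagrangian_pairing[OF fg sesq nondeg comp perp, folded h_def]

lemma h_eq_h_p:
  assumes m: "m \<in> carrier M" and u: "u \<in> N"
  shows "h m u = h (p m) u"
proof -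
  have "h (p m + (m - p m)) u = h (p m) u + h (m - p m) u"
    using sesqD(1)[OF h_sesq LM[OF p_proj(1)[OF m]] NM[OF p_proj(2)[OF m]] NM[OF u]] .
  then show ?thesis using h_N[OF p_proj(2)[OF m] u] by simp
qed

text \<open>Extend the functional by zero on \<open>L\<close> and on a complement of \<open>A\<close> in \<open>N\<close>. A vector that represents the
extension is orthogonal to \<open>L\<close>, so it lies in \<open>L\<close>.\<close>

lemma functional_represented_by_L:
  assumes A: "subspace_of M A" "A \<subseteq> N" and f: "f \<in> lin_hom (sub_space M A) scalars"
  shows "\<exists>x\<in>L. \<forall>u\<in>A. h x u = f u"
proof -
  obtain C where C: "complementary (sub_space M N) A C"
    using complement_exists[OF fg_sub[OF N_subspace], of A] A by (auto simp: subspace_of_def)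
  note r = proj_on[OF fg_sub[OF N_subspace] C]
  define r where "r = proj_on (sub_space M N) A C"
  note r = r[folded r_def]
  have "(\<lambda>x. if x \<in> carrier M then x - p x else 0) \<in> lin_hom M (sub_space M N)"
  proof (rule lin_homI)
    fix x y assume "x \<in> carrier M" "y \<in> carrier M"
    then show "(if x + y \<in> carrier M then x + y - p (x + y) else 0) =
      (if x \<in> carrier M then x - p x else 0) + (if y \<in> carrier M then y - p y else 0)"
      using subM(4) p_hom(2) by simp
  next
    fix a x assume "x \<in> carrier M"
    then show "(if smul M a x \<in> carrier M then smul M a x - p (smul M a x) else 0) =
      smul (sub_space M N) a (if x \<in> carrier M then x - p x else 0)"
      using subM(5) p_hom(3) by (simp add: scale_right_diff_distrib)
  qed (use p_proj(2) in auto)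
  from lin_hom_comp[OF lin_hom_comp[OF this r(4)], of f scalars]
  have "(\<lambda>x. f (r (if x \<in> carrier M then x - p x else 0))) \<in> lin_hom M scalars"
    using f by (simp add: sub_space_def)
  from nondegenerateD(2)[OF nondeg_h this] obtain x where x: "x \<in> carrier M"
    "\<forall>y\<in>carrier M. h x y = f (r (if y \<in> carrier M then y - p y else 0))" by blast
  have "r 0 = 0" using lin_hom_0[OF r(4)] .
  then have "h x y = 0" if "y \<in> L" for y
    using x(2) LM[OF that] p_L[OF that] lin_hom_0[OF f] by simp
  then have "x \<in> L" using perp_h[OF x(1)] by blast
  moreover have "h x u = f u" if u: "u \<in> A" for u
  proof -
    have "r u = u" using r(3)[OF u subspace_ofD(3)[OF complementaryD(2)[OF C]]] by simp
    then show ?thesis using x(2) subspace_ofD(2)[OF A(1) u] p_N[OF subsetD[OF A(2) u]] by simp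
  qed
  ultimately show ?thesis by blast
qed

lemma rank_N: "rank (sub_space M N) = rank (sub_space M L)"
proof -
  have "pair h N L \<in> lin_iso (sub_space M N) (dual bar (sub_space M L))"
  proof (rule lin_isoI[OF pair_hom[OF h_sesq N_subspace L_subspace] fg_sub[OF N_subspace]])
    fix x assume "x \<in> carrier (sub_space M N)" "pair h N L x = 0"
    then show "x = 0" using N_dual_L(1)[of x] pair_eq_0_iff[of x N h L] by simp
  next
    fix f assume "f \<in> carrier (dual bar (sub_space M L))"
    then have f: "f \<in> lin_hom (sub_space M L) scalars" by simp
    then show "\<exists>x\<in>carrier (sub_space M N). pair h N L x = f"
      using N_dual_L(2)[OF f] pair_eq_iff[OF f] by auto
  qed
  then show ?thesis
    using lin_iso_rank(2)[OF _ fg_sub[OF N_subspace] vector_space_dual] fg_space_dual(2)[OF fg_sub[OF L_subspace]] by metis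
qed

definition annihilator :: "'v set \<Rightarrow> 'v set" where
  "annihilator A = {x \<in> L. pair h L A x = 0}"

lemma annihilator_iff: "x \<in> annihilator A \<longleftrightarrow> x \<in> L \<and> (\<forall>u\<in>A. h x u = 0)"
  unfolding annihilator_def using pair_eq_0_iff[of x L h A] by auto

lemma annihilator_subspace_rank:
  assumes A: "subspace_of M A" "A \<subseteq> N"
  shows "subspace_of M (annihilator A)"
    "rank (sub_space M L) = rank (sub_space M (annihilator A)) + rank (sub_space M A)"
proof -
  have hom: "pair h L A \<in> lin_hom (sub_space M L) (dual bar (sub_space M A))"
    by (rule pair_hom[OF h_sesq L_subspace A(1)])
  have "subspace_of (sub_space M L) {x \<in> carrier (sub_space M L). pair h L A x = 0}"
    using subspace_of_kernel[OF hom fg_space_carrier[OF fg_sub[OF L_subspace]] vector_space_dual] .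
  then show "subspace_of M (annihilator A)"
    unfolding annihilator_def using L_subspace by (auto simp: subspace_of_def)
  have im: "pair h L A ` L = carrier (dual bar (sub_space M A))"
  proof (intro equalityI subsetI)
    fix f assume "f \<in> pair h L A ` L"
    then show "f \<in> carrier (dual bar (sub_space M A))" using lin_homD(1)[OF hom] by auto
  next
    fix f assume "f \<in> carrier (dual bar (sub_space M A))"
    then have f: "f \<in> lin_hom (sub_space M A) scalars" by simp
    then obtain x where x: "x \<in> L" "\<forall>u\<in>A. h x u = f u" using functional_represented_by_L[OF A f] by blast
    then have "pair h L A x = f" using pair_eq_iff[OF f x(1)] by blast
    then show "f \<in> pair h L A ` L" using x(1) by blast
  qed
  have "rank (sub_space M L) = rank (sub_space M (annihilator A)) +
      rank (sub_space (dual bar (sub_space M A)) (carrier (dual bar (sub_space M A))))"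
    using rank_kernel_image[OF fg_sub[OF L_subspace] vector_space_dual hom] im by (simp add: annihilator_def sub_space_def)
  then show "rank (sub_space M L) = rank (sub_space M (annihilator A)) + rank (sub_space M A)" using fg_space_dual(2)[OF fg_sub[OF A(1)]] by (simp add: sub_space_def)
qed

text \<open>Here the half rank of \<open>V\<close> enters. The projection \<open>p\<close> has kernel \<open>V \<inter> N\<close> on \<open>V\<close>, so \<open>p V\<close> has rank
\<open>rank L - rank (V \<inter> N)\<close>, which is also the rank of the annihilator of \<open>V \<inter> N\<close> in \<open>L\<close>. So the two have a common
complement \<open>Y\<close>, and \<open>Y\<close> is dual to \<open>V \<inter> N\<close> because it is a complement of the annihilator.\<close>

lemma dual_common_complement_exists:
  assumes V: "subspace_of M V" "2 * rank (sub_space M V) = rank M"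
  shows "\<exists>Y. subspace_of M Y \<and> Y \<subseteq> L \<and>
    (\<forall>v\<in>V. p v \<in> Y \<longrightarrow> p v = 0) \<and> (\<forall>l\<in>L. \<exists>v\<in>V. \<exists>y\<in>Y. l = p v + y) \<and>
    pair h Y (V \<inter> N) \<in> lin_iso (sub_space M Y) (dual bar (sub_space M (V \<inter> N))) \<and>
    pair h (V \<inter> N) Y \<in> lin_iso (sub_space M (V \<inter> N)) (dual bar (sub_space M Y))"
proof -
  note VM = subspace_ofD(2)[OF V(1)]
  define U where "U = V \<inter> N"
  have U: "subspace_of M U" unfolding U_def by (rule subspace_of_Int[OF V(1) N_subspace])
  have UN': "U \<subseteq> N" by (simp add: U_def)
  have UM: "x \<in> carrier M" and UN: "x \<in> N" if "x \<in> U" for x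
    using that NM by (auto simp: U_def)
  define W where "W = p ` V"
  have W: "subspace_of M W" "W \<subseteq> L"
    unfolding W_def using subspace_of_image[OF p_lin_hom V(1)] p_proj(1) VM by blast+
  let ?U0 = "annihilator U"
  have rankV: "rank (sub_space M V) = rank (sub_space M L)"
    using rank_complementary[OF fg comp] rank_N V(2) by linarith
  have "rank (sub_space M V) = rank (sub_space M U) + rank (sub_space M W)"
  proof -
    let ?p = "\<lambda>x. if x \<in> V then p x else 0"
    have "?p \<in> lin_hom (sub_space M V) M"
      by (rule lin_homI) (use p_hom VM LM subspace_ofD(4,5)[OF V(1)] in auto)
    from rank_kernel_image[OF fg_sub[OF V(1)] vs this]
    have "rank (sub_space M V) = rank (sub_space M {x \<in> V. ?p x = 0}) + rank (sub_space M (?p ` V))"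
      by simp
    moreover have "{x \<in> V. ?p x = 0} = U"
      using p_proj(2) VM p_N by (auto simp: U_def) (metis diff_zero)
    moreover have "?p ` V = W" unfolding W_def by auto
    ultimately show ?thesis by simp
  qed
  moreover note annihilator_subspace_rank(2)[OF U UN']
  ultimately have rank_eq: "rank (sub_space M W) = rank (sub_space M ?U0)" using rankV by linarith
  note U0 = annihilator_subspace_rank(1)[OF U UN']
  have sub_iff: "subspace_of M A \<longleftrightarrow> subspace A \<and> A \<subseteq> carrier M" for A
    by (rule subspace_of_iff[OF vs])
  have finL: "findim L" using fg_sub[OF L_subspace] fg_space_iff[of "sub_space M L"] by simp
  have "?U0 \<subseteq> L" using annihilator_iff by blast
  then obtain Y where Y: "subspace Y" "W \<inter> Y = {0}" "{x + y | x y. x \<in> W \<and> y \<in> Y} = L"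
     "?U0 \<inter> Y = {0}" "{x + y | x y. x \<in> ?U0 \<and> y \<in> Y} = L"
    using common_complement_exists[OF finL, of W ?U0] W U0 rank_eq sub_iff by auto
  have YL: "y \<in> L" if "y \<in> Y" for y
  proof -
    have "0 + y \<in> {x + y | x y. x \<in> W \<and> y \<in> Y}" using subspace_ofD(3)[OF W(1)] that by blast
    then show ?thesis using Y(3) by simp
  qed
  have YM: "y \<in> carrier M" if "y \<in> Y" for y using LM YL[OF that] by blast
  have subY: "subspace_of M Y" using sub_iff Y(1) YM by blast
  have YU_inj: "y = 0" if "y \<in> Y" "\<And>u. u \<in> U \<Longrightarrow> h y u = 0" for y
    using that Y(4) annihilator_iff[of y] YL by blast
  have YU_surj: "\<exists>y\<in>Y. \<forall>u\<in>U. h y u = f u" if f: "f \<in> lin_hom (sub_space M U) scalars" for f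
  proof -
    obtain l where l: "l \<in> L" "\<forall>u\<in>U. h l u = f u" using functional_represented_by_L[OF U UN' f] by blast
    then have "l \<in> {x + y | x y. x \<in> ?U0 \<and> y \<in> Y}" unfolding Y(5) by simp
    then obtain x y where xy: "x \<in> ?U0" "y \<in> Y" "l = x + y" by blast
    have "h y u = f u" if u: "u \<in> U" for u
      using sesqD(1)[OF h_sesq LM YM[OF xy(2)] UM[OF u], of x] xy(1,3) u l(2) annihilator_iff[of x] by simp
    then show ?thesis using xy(2) by blast
  qed
  have YU_iso: "pair h Y U \<in> lin_iso (sub_space M Y) (dual bar (sub_space M U))"
  proof (rule lin_isoI[OF pair_hom[OF h_sesq subY U] fg_sub[OF subY]])
    fix x assume "x \<in> carrier (sub_space M Y)" "pair h Y U x = 0"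
    then show "x = 0" using YU_inj[of x] pair_eq_0_iff[of x Y h U] by simp
  next
    fix f assume "f \<in> carrier (dual bar (sub_space M U))"
    then have f: "f \<in> lin_hom (sub_space M U) scalars" by simp
    then show "\<exists>x\<in>carrier (sub_space M Y). pair h Y U x = f"
      using YU_surj[OF f] pair_eq_iff[OF f] by auto
  qed
  have UY_iso: "pair h U Y \<in> lin_iso (sub_space M U) (dual bar (sub_space M Y))"
  proof (rule lin_iso_if_injective_rank_eq[OF pair_hom[OF h_sesq U subY] fg_sub[OF U] fg_space_dual(1)[OF fg_sub[OF subY]]])
    show "rank (sub_space M U) = rank (dual bar (sub_space M Y))"
      using lin_iso_rank(2)[OF YU_iso fg_sub[OF subY] vector_space_dual] fg_space_dual(2)[OF fg_sub[OF U]]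
        fg_space_dual(2)[OF fg_sub[OF subY]] by simp
  next
    fix u assume "u \<in> carrier (sub_space M U)" "pair h U Y u = 0"
    then have u: "u \<in> U" "\<forall>y\<in>Y. h u y = 0" using pair_eq_0_iff[of u U h Y] by simp_all
    show "u = 0"
    proof (rule N_dual_L(1)[OF UN[OF u(1)]], rule ballI)
      fix l assume "l \<in> L"
      then have "l \<in> {x + y | x y. x \<in> ?U0 \<and> y \<in> Y}" unfolding Y(5) by simp
      then obtain x y where xy: "x \<in> ?U0" "y \<in> Y" "l = x + y" by blast
      have "h u x = 0" using xy(1) annihilator_iff[of x] u(1) h_swap[of u x] by simp
      then show "h u l = 0"
        using sesqD(2)[OF h_sesq LM YM[OF xy(2)] UM[OF u(1)], of x] xy u(2) annihilator_iff[of x] by simp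
    qed
  qed
  have "p v = 0" if "v \<in> V" "p v \<in> Y" for v using that Y(2) unfolding W_def by blast
  moreover have "\<exists>v\<in>V. \<exists>y\<in>Y. l = p v + y" if l: "l \<in> L" for l
  proof -
    have "l \<in> {x + y | x y. x \<in> W \<and> y \<in> Y}" unfolding Y(3) by (rule l)
    then show ?thesis unfolding W_def by blast
  qed
  ultimately show ?thesis
    using subY YL YU_iso UY_iso unfolding U_def by (intro exI[of _ Y] conjI ballI impI subsetI) simp_all
qed

end

section \<open>A Lagrangian of the stabilised form\<close>

text \<open>\<open>V\<close> and \<open>Y\<close> as in \<open>dual_common_complement_exists\<close>; the Lagrangian \<open>K\<close> is constructed from these
properties.\<close>

locale dual_complement = split_lagrangian bar e M \<phi> L N
  for bar :: "'a::field \<Rightarrow> 'a" and e :: 'a and M :: "('a, 'v::ab_group_add) space"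
    and \<phi> :: "'v \<Rightarrow> 'v \<Rightarrow> 'a" and L N :: "'v set" +
  fixes V Y :: "'v set"
  assumes V_subspace: "subspace_of M V" and Y_subspace: "subspace_of M Y" and Y_subset_L: "Y \<subseteq> L"
    and pV_disjoint_Y: "\<And>v. v \<in> V \<Longrightarrow> p v \<in> Y \<Longrightarrow> p v = 0"
    and pV_Y_span_L: "\<And>l. l \<in> L \<Longrightarrow> \<exists>v\<in>V. \<exists>y\<in>Y. l = p v + y"
    and YU_iso: "pair h Y (V \<inter> N) \<in> lin_iso (sub_space M Y) (dual bar (sub_space M (V \<inter> N)))"
    and UY_iso: "pair h (V \<inter> N) Y \<in> lin_iso (sub_space M (V \<inter> N)) (dual bar (sub_space M Y))"
begin

abbreviation U :: "'v set" where "U \<equiv> V \<inter> N"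

lemma U_subspace: "subspace_of M U"
  by (rule subspace_of_Int[OF V_subspace N_subspace])

lemmas VM = subspace_ofD(2)[OF V_subspace] and YM = subspace_ofD(2)[OF Y_subspace]

lemma YL: "y \<in> Y \<Longrightarrow> y \<in> L"
  using Y_subset_L by blast

lemma UM: "x \<in> U \<Longrightarrow> x \<in> carrier M" and UN: "x \<in> U \<Longrightarrow> x \<in> N" and UV: "x \<in> U \<Longrightarrow> x \<in> V"
  using NM by simp_all

lemma YU_inj:
  assumes "y \<in> Y" "\<And>u. u \<in> U \<Longrightarrow> h y u = 0"
  shows "y = 0"
  using lin_iso_eq_0[OF YU_iso, of y] pair_eq_0_iff[of y Y h U] assms subspace_ofD(3)[OF Y_subspace] by simp

lemma YU_surj:
  assumes f: "f \<in> lin_hom (sub_space M U) scalars"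
  shows "\<exists>y\<in>Y. \<forall>u\<in>U. h y u = f u"
  using lin_isoD(4)[OF YU_iso, of f] pair_eq_iff[OF f] f by auto

text \<open>On \<open>N\<close> this is the projection to \<open>U\<close> along the part of \<open>N\<close> orthogonal to \<open>Y\<close>; it is defined on all of \<open>M\<close>
by the same condition \<open>h_\<pi>\<close>, and so vanishes on \<open>L\<close>.\<close>

definition \<pi> :: "'v \<Rightarrow> 'v" where
  "\<pi> m = inv_iso (sub_space M U) (dual bar (sub_space M Y)) (pair h U Y) (pair h (carrier M) Y m)"

lemma \<pi>_hom: "\<pi> \<in> lin_hom M (sub_space M U)"
proof -
  have "pair h (carrier M) Y \<in> lin_hom (sub_space M (carrier M)) (dual bar (sub_space M Y))"
    by (rule pair_hom[OF h_sesq fg_space_carrier[OF fg] Y_subspace])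
  then have "pair h (carrier M) Y \<in> lin_hom M (dual bar (sub_space M Y))" by (simp add: sub_space_def)
  from lin_hom_comp[OF this lin_isoD(1)[OF inv_iso(1)[OF UY_iso fg_sub[OF U_subspace]]]]
  show ?thesis unfolding \<pi>_def[abs_def] .
qed

lemmas \<pi>_homD = lin_homD[OF \<pi>_hom, unfolded sub_space_simps]

lemma h_\<pi>:
  assumes m: "m \<in> carrier M" and y: "y \<in> Y"
  shows "h (\<pi> m) y = h m y"
proof -
  have "pair h (carrier M) Y \<in> lin_hom (sub_space M (carrier M)) (dual bar (sub_space M Y))"
    by (rule pair_hom[OF h_sesq fg_space_carrier[OF fg] Y_subspace])
  then have "pair h (carrier M) Y m \<in> carrier (dual bar (sub_space M Y))" using m lin_homD(1) by fastforce
  then have "pair h U Y (\<pi> m) = pair h (carrier M) Y m"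
    unfolding \<pi>_def by (rule inv_iso(3)[OF UY_iso fg_sub[OF U_subspace]])
  from fun_cong[OF this, of y] show ?thesis using m y \<pi>_homD(1)[OF m] by (simp add: pair_def)
qed

lemma \<pi>_U:
  assumes u: "u \<in> U"
  shows "\<pi> u = u"
proof -
  have "pair h (carrier M) Y u = pair h U Y u" using u UM by (auto simp: pair_def fun_eq_iff)
  then show ?thesis unfolding \<pi>_def using inv_iso(2)[OF UY_iso fg_sub[OF U_subspace], of u] u by simp
qed

text \<open>\<open>T\<close> with the form \<open>\<phi>T\<close> is the orthogonal sum of \<open>M\<close> and \<open>H(U)\<close>; \<open>LT\<close> and \<open>VT\<close> are its Lagrangian and its
half-rank summand after adding the trivial formation on \<open>U\<close>.\<close>

definition P :: "('a, 'v) space" where "P = sub_space M U"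

definition T :: "('a, 'v \<times> 'v \<times> ('v \<Rightarrow> 'a)) space" where "T = sum_space M (hyp_space bar P)"

definition \<phi>T :: "'v \<times> 'v \<times> ('v \<Rightarrow> 'a) \<Rightarrow> 'v \<times> 'v \<times> ('v \<Rightarrow> 'a) \<Rightarrow> 'a" where
  "\<phi>T x y = \<phi> (fst x) (fst y) + hyp (snd x) (snd y)"

abbreviation LT :: "('v \<times> 'v \<times> ('v \<Rightarrow> 'a)) set" where "LT \<equiv> L \<times> (U \<times> {0})"

abbreviation VT :: "('v \<times> 'v \<times> ('v \<Rightarrow> 'a)) set" where "VT \<equiv> V \<times> ({0} \<times> lin_hom P scalars)"

lemma P: "fg_space P" "carrier P = U"
  unfolding P_def using fg_sub[OF U_subspace] by simp_all

lemma fg_hyp_P: "fg_space (hyp_space bar P)"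
  by (rule fg_hyp_space(1)[OF P(1)])

lemma fg_T: "fg_space T"
  unfolding T_def by (rule fg_sum_space(1)[OF fg fg_hyp_P])

lemma sesq_\<phi>T: "sesq T \<phi>T"
  unfolding T_def \<phi>T_def[abs_def] by (rule sesq_sum[OF sesq sesq_hyp])

lemma carrier_T: "carrier T = carrier M \<times> U \<times> lin_hom P scalars"
  by (simp add: T_def P(2))

lemma symm_\<phi>T: "symm \<phi>T (m, a, f) (m', a', f') = h m m' + f a' + e * bar (f' a)"
  by (simp add: symm_def h_def \<phi>T_def hyp_def algebra_simps)

lemma qf_sum_eq_T: "qf_sum bar e (qf M \<phi> L V) (trivial_formation bar e P) =
    qf T \<phi>T (L \<times> (U \<times> {0})) (V \<times> ({0} \<times> lin_hom P scalars))"
  unfolding trivial_formation_qf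
    qf_sum_qf[OF fg_space_carrier[OF fg] fg_space_carrier[OF fg_hyp_P] sesq sesq_hyp]
  by (simp add: T_def \<phi>T_def[abs_def] P(2))

text \<open>\<open>K\<close> is parametrised by its component \<open>m = y + z\<close> in \<open>M\<close>, with \<open>y\<close> in \<open>Y\<close> and \<open>z\<close> in \<open>N\<close>, hence by the subspace
\<open>D0 = Y \<oplus> N\<close>. As \<open>N\<close> is isotropic, \<open>h y\<close> and \<open>h m\<close> agree on \<open>U\<close>, so that \<open>\<gamma>\<close> can be written in terms of \<open>m\<close>.\<close>

definition D0 :: "'v set" where "D0 = {m \<in> carrier M. p m \<in> Y}"

definition \<gamma> :: "'v \<Rightarrow> 'v \<Rightarrow> 'a" where "\<gamma> m u = (if u \<in> U then - h m u else 0)"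

definition k :: "'v \<Rightarrow> 'v \<times> 'v \<times> ('v \<Rightarrow> 'a)" where
  "k m = (if m \<in> carrier M then (m, \<pi> m, \<gamma> m) else 0)"

definition K :: "('v \<times> 'v \<times> ('v \<Rightarrow> 'a)) set" where "K = k ` D0"

lemma \<gamma>_functional:
  assumes m: "m \<in> carrier M"
  shows "\<gamma> m \<in> lin_hom P scalars"
  by (rule lin_homI)
    (use m UM sesqD(2,4)[OF h_sesq] subspace_ofD(4,5)[OF U_subspace] in \<open>auto simp: \<gamma>_def P_def\<close>)

lemma k_hom: "k \<in> lin_hom M T"
proof (rule lin_homI)
  fix x assume x: "x \<in> carrier M"
  show "k x \<in> carrier T" using x \<pi>_homD(1) \<gamma>_functional by (simp add: k_def carrier_T)
  show "k (x + y) = k x + k y" if y: "y \<in> carrier M" for y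
  proof -
    have "\<gamma> (x + y) = \<gamma> x + \<gamma> y"
      using sesqD(1)[OF h_sesq x y] UM by (auto simp: \<gamma>_def fun_eq_iff)
    then show ?thesis using x y subM(4) \<pi>_homD(2) by (simp add: k_def)
  qed
  show "k (smul M a x) = smul T a (k x)" for a
  proof -
    have "\<gamma> (smul M a x) = (\<lambda>u. \<gamma> x u * bar a)"
      using sesqD(3)[OF h_sesq x] UM by (auto simp: \<gamma>_def fun_eq_iff)
    then show ?thesis using x subM(5)[OF x, of a] \<pi>_homD(3)[OF x, of a] by (simp add: k_def T_def P_def)
  qed
qed (simp add: k_def)

lemma D0_subspace: "subspace_of M D0"
  unfolding subspace_of_def D0_def
  using subM p_hom(2,3) lin_hom_0[OF p_lin_hom] subspace_ofD(3,4,5)[OF Y_subspace] by auto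

lemma D0M: "m \<in> D0 \<Longrightarrow> m \<in> carrier M" "m \<in> D0 \<Longrightarrow> p m \<in> Y"
  by (simp_all add: D0_def)

lemma K_subspace: "subspace_of T K"
  unfolding K_def by (rule subspace_of_image[OF k_hom D0_subspace])

lemma K_elem:
  assumes "t \<in> K"
  shows "\<exists>m\<in>D0. t = (m, \<pi> m, \<gamma> m)"
  using assms D0M(1) unfolding K_def by (auto simp: k_def)

lemma K_mem:
  assumes "m \<in> D0"
  shows "(m, \<pi> m, \<gamma> m) \<in> K"
  using assms D0M(1)[OF assms] unfolding K_def by (force simp: k_def)

lemma LT_subspace: "subspace_of T LT"
  using subspace_ofD(3,4,5)[OF L_subspace] subspace_ofD(3,4,5)[OF U_subspace] LM zero_functional[of P]
  unfolding subspace_of_def carrier_T by (auto simp: zero_prod_def T_def P_def zero_fun_def)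

lemma VT_subspace: "subspace_of T VT"
proof -
  have "subspace_of (dual bar P) (lin_hom P scalars)"
    using fg_space_carrier[OF fg_space_dual(1)[OF P(1)]] by simp
  from subspace_ofD(3,4,5)[OF this] show ?thesis
    using subspace_ofD(3,4,5)[OF V_subspace] VM subspace_ofD(3)[OF U_subspace]
    unfolding subspace_of_def carrier_T by (auto simp: zero_prod_def T_def P_def)
qed

lemma h_eq_h_p:
  assumes m: "m \<in> carrier M" and u: "u \<in> N"
  shows "h m u = h (p m) u"
proof -
  have "h (p m + (m - p m)) u = h (p m) u + h (m - p m) u"
    using sesqD(1)[OF h_sesq LM[OF p_proj(1)[OF m]] NM[OF p_proj(2)[OF m]] NM[OF u]] .
  then show ?thesis using h_N[OF p_proj(2)[OF m] u] by simp
qed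

lemma Y_represents:
  assumes f: "f \<in> lin_hom P scalars"
  shows "\<exists>y\<in>Y. \<forall>u\<in>U. h y u = - f u"
proof -
  have "(\<lambda>u. - f u) \<in> lin_hom (sub_space M U) scalars"
    using functionalD[OF f] by (intro lin_homI) (auto simp: P_def)
  from YU_surj[OF this] show ?thesis .
qed

text \<open>For a point \<open>(m, a, f)\<close> of \<open>T\<close>, the summand in \<open>K\<close> must have last coordinate \<open>f\<close>, which determines its
component \<open>y\<close> by the duality of \<open>Y\<close> and \<open>U\<close>; its component in \<open>N\<close> is that of \<open>m\<close>.\<close>

lemma LT_K_complementary: "complementary T LT K"
proof (rule complementaryI[OF LT_subspace K_subspace])
  fix t assume t: "t \<in> LT" "t \<in> K"
  then obtain m where m: "m \<in> D0" "t = (m, \<pi> m, \<gamma> m)" using K_elem by blast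
  then have mL: "m \<in> L" and g0: "\<gamma> m = 0" using t(1) by auto
  have "h m u = 0" if u: "u \<in> U" for u using fun_cong[OF g0, of u] u by (simp add: \<gamma>_def)
  moreover have "m \<in> Y" using D0M(2)[OF m(1)] p_L[OF mL] by simp
  ultimately have "m = 0" using YU_inj by blast
  then show "t = 0" using m(2) lin_hom_0[OF \<pi>_hom] g0 by (simp add: zero_prod_def)
next
  fix t assume "t \<in> carrier T"
  then obtain m a f where t: "t = (m, a, f)" "m \<in> carrier M" "a \<in> U" "f \<in> lin_hom P scalars"
    unfolding carrier_T by auto
  obtain y where y: "y \<in> Y" "\<forall>u\<in>U. h y u = - f u" using Y_represents[OF t(4)] by blast
  define m' where "m' = m - p m + y"
  have m': "m' \<in> carrier M" unfolding m'_def using subM(4) NM[OF p_proj(2)[OF t(2)]] YM[OF y(1)] by blast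
  have pm': "p m' = y"
    using p_proj(3)[OF YL[OF y(1)] p_proj(2)[OF t(2)]] by (simp add: m'_def add.commute)
  have "m' \<in> D0" using m' pm' y(1) by (simp add: D0_def)
  moreover have "\<gamma> m' = f"
  proof
    fix u show "\<gamma> m' u = f u"
      using h_eq_h_p[OF m' UN, of u] y(2) pm' functionalD(3)[OF t(4), of u]
      by (cases "u \<in> U") (simp_all add: \<gamma>_def P(2))
  qed
  ultimately have "(m', \<pi> m', f) \<in> K" using K_mem by metis
  moreover have "m - m' \<in> L" using subspace_of_diff[OF vs L_subspace p_proj(1)[OF t(2)] YL[OF y(1)]] by (simp add: m'_def)
  moreover have "a - \<pi> m' \<in> U" using subspace_of_diff[OF vs U_subspace t(3) \<pi>_homD(1)[OF m']] .
  moreover have "t = (m - m', a - \<pi> m', 0) + (m', \<pi> m', f)" using t(1) by simp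
  ultimately show "\<exists>a\<in>LT. \<exists>c\<in>K. t = a + c" by blast
qed

text \<open>To decompose \<open>(m, a, f)\<close>, write \<open>p m = p v + y\<close> with \<open>v\<close> in \<open>V\<close> and \<open>y\<close> in \<open>Y\<close>; then \<open>m - v\<close> lies in \<open>D0\<close>.
Moving an element of \<open>U = V \<inter> N\<close> from one summand to the other adjusts the value of \<open>\<pi>\<close> to \<open>a\<close>.\<close>

lemma VT_K_complementary: "complementary T VT K"
proof (rule complementaryI[OF VT_subspace K_subspace])
  fix t assume t: "t \<in> VT" "t \<in> K"
  then obtain m where m: "m \<in> D0" "t = (m, \<pi> m, \<gamma> m)" using K_elem by blast
  then have mV: "m \<in> V" and \<pi>0: "\<pi> m = 0" using t(1) by auto
  have "p m = 0" using pV_disjoint_Y[OF mV D0M(2)[OF m(1)]] .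
  then have "m \<in> U" using p_proj(2)[OF D0M(1)[OF m(1)]] mV by simp
  then have m0: "m = 0" using \<pi>_U \<pi>0 by simp
  have "k 0 = 0" by (rule lin_hom_0[OF k_hom])
  then show "t = 0" using m(2) m0 subM(3) by (simp add: k_def)
next
  fix t assume "t \<in> carrier T"
  then obtain m a f where t: "t = (m, a, f)" "m \<in> carrier M" "a \<in> U" "f \<in> lin_hom P scalars"
    unfolding carrier_T by auto
  obtain v' y where vy: "v' \<in> V" "y \<in> Y" "p m = p v' + y"
    using pV_Y_span_L[OF p_proj(1)[OF t(2)]] by blast
  have d': "m - v' \<in> carrier M"
    using subspace_of_diff[OF vs fg_space_carrier[OF fg] t(2) VM[OF vy(1)]] .
  define u where "u = a - \<pi> (m - v')"
  have u: "u \<in> U" unfolding u_def using subspace_of_diff[OF vs U_subspace t(3) \<pi>_homD(1)[OF d']] .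
  \<comment> \<open>\<open>u\<close> lies in the kernel of \<open>p\<close> and is fixed by \<open>\<pi>\<close>.\<close>
  define d where "d = m - v' + u"
  have d: "d \<in> carrier M" unfolding d_def using subM(4)[OF d' UM[OF u]] .
  have "p d = y"
    unfolding d_def using p_hom(2)[OF d' UM[OF u]] lin_hom_diff[OF p_lin_hom t(2) VM[OF vy(1)] d'] p_N[OF UN[OF u]] vy(3)
    by simp
  then have dD: "d \<in> D0" using d vy(2) by (simp add: D0_def)
  have \<pi>d: "\<pi> d = a" unfolding d_def using \<pi>_homD(2)[OF d' UM[OF u]] \<pi>_U[OF u] by (simp add: u_def)
  have v: "v' - u \<in> V" using subspace_of_diff[OF vs V_subspace vy(1) UV[OF u]] .
  have f': "f - \<gamma> d \<in> lin_hom P scalars"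
    using subspace_of_diff[OF vector_space_dual fg_space_carrier[OF fg_space_dual(1)[OF P(1)]], of f "\<gamma> d"]
      t(4) \<gamma>_functional[OF d] by simp
  have "t = (v' - u, 0, f - \<gamma> d) + (d, \<pi> d, \<gamma> d)" using t(1) \<pi>d by (simp add: d_def)
  then show "\<exists>a\<in>VT. \<exists>c\<in>K. t = a + c" using v f' K_mem[OF dD] by blast
qed

lemma LT_null: "null_on (sub_space T LT) \<phi>T"
proof -
  have "linear_on (sub_space T LT) (sub_space M L) fst"
    unfolding linear_on_def by (auto simp: T_def P_def)
  from null_on_comp[OF null_L this] show ?thesis
    by (rule null_on_cong) (auto simp: \<phi>T_def hyp_def)
qed

text \<open>In components \<open>m = y + z\<close>, the form of \<open>M\<close> contributes two terms that are null, since \<open>Y\<close> lies in \<open>L\<close> and \<open>z\<close> in \<open>N\<close>,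
and cross terms. The hyperbolic part contributes \<open>- h y z'\<close>, which cancels the cross terms modulo null
forms.\<close>

lemma K_null: "null_on (sub_space T K) \<phi>T"
proof -
  let ?y = "\<lambda>t. p (fst t)" and ?z = "\<lambda>t. fst t - p (fst t)"
  have fstK: "fst t \<in> carrier M" if "t \<in> K" for t using K_elem[OF that] D0M(1) by auto
  have fs: "fst (smul T a t) = smul M a (fst t)" for a t by (cases t) (simp add: T_def)
  have ly: "linear_on (sub_space T K) (sub_space M L) ?y"
    unfolding linear_on_def using fstK p_proj(1) p_hom(2,3) by (auto simp: fs)
  have lz: "linear_on (sub_space T K) (sub_space M N) ?z"
    unfolding linear_on_def using fstK p_proj(2) p_hom(2,3) by (auto simp: fs scale_right_diff_distrib)
  have lyM: "linear_on (sub_space T K) M ?y" and lzM: "linear_on (sub_space T K) M ?z"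
    using ly lz LM NM unfolding linear_on_def by auto
  have n1: "null_on (sub_space T K) (\<lambda>s t. \<phi> (?y s) (?y t))"
    and n2: "null_on (sub_space T K) (\<lambda>s t. \<phi> (?z s) (?z t))"
    by (rule null_on_comp[OF null_L ly], rule null_on_comp[OF null_N lz])
  have n3: "null_on (sub_space T K) (\<lambda>s t. \<phi> (?z s) (?y t) - e * bar (\<phi> (?z t) (?y s)))"
    by (rule null_onI[OF sesq_comp[OF sesq lzM lyM]]) simp
  show ?thesis
  proof (rule null_on_cong[OF null_on_add[OF null_on_add[OF n1 n2] n3]])
    fix s t assume "s \<in> carrier (sub_space T K)" "t \<in> carrier (sub_space T K)"
    then have st: "s \<in> K" "t \<in> K" by simp_all
    obtain m where m: "m \<in> D0" "s = (m, \<pi> m, \<gamma> m)" using K_elem[OF st(1)] by blast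
    obtain n where n: "n \<in> D0" "t = (n, \<pi> n, \<gamma> n)" using K_elem[OF st(2)] by blast
    note mM = D0M(1)[OF m(1)] and nM = D0M(1)[OF n(1)]
    note y1 = LM[OF p_proj(1)[OF mM]] and y2 = LM[OF p_proj(1)[OF nM]]
    note z1 = NM[OF p_proj(2)[OF mM]] and z2 = NM[OF p_proj(2)[OF nM]]
    have sw: "h x x' = e * bar (h x' x)" for x x' unfolding h_def by (rule symm_swap)
    have "h m (\<pi> n) = h (p m) (\<pi> n)" using h_eq_h_p[OF mM UN[OF \<pi>_homD(1)[OF nM]]] .
    also have "\<dots> = h (p m) n"
      using h_\<pi>[OF nM D0M(2)[OF m(1)]] sw[of "p m" "\<pi> n"] sw[of "p m" n] by simp
    also have "\<dots> = h (p m) (n - p n)"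
      using sesq_minus(2)[OF h_sesq nM y2 y1 z2] h_L[OF p_proj(1)[OF mM] p_proj(1)[OF nM]] by simp
    also have "\<dots> = \<phi> (p m) (n - p n) + e * bar (\<phi> (n - p n) (p m))" by (simp add: h_def symm_def)
    finally have hyp_val: "hyp (snd s) (snd t) = - \<phi> (p m) (n - p n) - e * bar (\<phi> (n - p n) (p m))"
      using \<pi>_homD(1)[OF nM] m(2) n(2) by (simp add: hyp_def \<gamma>_def)
    have "\<phi> m n = \<phi> (p m + (m - p m)) (p n + (n - p n))" by simp
    also have "\<dots> = \<phi> (p m) (p n + (n - p n)) + \<phi> (m - p m) (p n + (n - p n))"
      by (rule sesqD(1)[OF sesq y1 z1]) (simp add: nM)
    also have "\<dots> = \<phi> (p m) (p n) + \<phi> (p m) (n - p n) + (\<phi> (m - p m) (p n) + \<phi> (m - p m) (n - p n))"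
      using sesqD(2)[OF sesq y2 z2 y1] sesqD(2)[OF sesq y2 z2 z1] by simp
    finally show "\<phi>T s t = \<phi> (?y s) (?y t) + \<phi> (?z s) (?z t) + (\<phi> (?z s) (?y t) - e * bar (\<phi> (?z t) (?y s)))"
      unfolding \<phi>T_def hyp_val using m(2) n(2) by simp
  qed
qed

lemma K_LT_injective:
  assumes t: "t \<in> K" "\<forall>s\<in>LT. symm \<phi>T t s = 0"
  shows "t = 0"
proof -
  obtain m where m: "m \<in> D0" "t = (m, \<pi> m, \<gamma> m)" using K_elem[OF t(1)] by blast
  note mM = D0M(1)[OF m(1)]
  have z: "h m l + \<gamma> m a = 0" if "l \<in> L" "a \<in> U" for l a
    using t(2) that unfolding m(2) by (auto simp: symm_\<phi>T dest!: bspec[of _ _ "(l, a, 0)"])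
  have \<gamma>0: "\<gamma> m a = 0" if "a \<in> U" for a
    using z[OF subspace_ofD(3)[OF L_subspace] that] sesq_0(2)[OF h_sesq subM(3) mM] by simp
  have "h (p m) a = 0" if a: "a \<in> U" for a
    using \<gamma>0[OF a] h_eq_h_p[OF mM UN[OF a]] a by (simp add: \<gamma>_def)
  then have "p m = 0" using YU_inj[OF D0M(2)[OF m(1)]] by blast
  then have mN: "m \<in> N" using p_proj(2)[OF mM] by simp
  have "h m l = 0" if "l \<in> L" for l
    using z[OF that subspace_ofD(3)[OF U_subspace]] \<gamma>0[OF subspace_ofD(3)[OF U_subspace]] by simp
  then have "m = 0" using N_dual_L(1)[OF mN] by blast
  then have "t = k 0" using m(2) subM(3) by (simp add: k_def)
  then show ?thesis using lin_hom_0[OF k_hom] by simp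
qed

lemma K_LT_surjective:
  assumes g: "g \<in> lin_hom (sub_space T LT) scalars"
  shows "\<exists>t\<in>K. \<forall>s\<in>LT. symm \<phi>T t s = g s"
proof -
  note gD = functionalD[OF g, unfolded sub_space_simps]
  note zU = subspace_ofD(3)[OF U_subspace] and zL = subspace_ofD(3)[OF L_subspace]
  have "(\<lambda>l. if l \<in> L then g (l, 0, 0) else 0) \<in> lin_hom (sub_space M L) scalars"
  proof (rule lin_homI)
    fix x y assume xy: "x \<in> carrier (sub_space M L)" "y \<in> carrier (sub_space M L)"
    then show "(if x + y \<in> L then g (x + y, 0, 0) else 0) =
        (if x \<in> L then g (x, 0, 0) else 0) + (if y \<in> L then g (y, 0, 0) else 0)"
      using gD(1)[of "(x, 0, 0)" "(y, 0, 0)"] zU subspace_ofD(4)[OF L_subspace] by simp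
  next
    fix a x assume x: "x \<in> carrier (sub_space M L)"
    have "(\<lambda>u. (0 :: 'v \<Rightarrow> 'a) u * bar a) = 0" by (simp add: fun_eq_iff)
    then have "smul T a (x, 0, 0) = (smul M a x, 0, 0)"
      by (simp only: T_def P_def sum_space_simps hyp_space_simps sub_space_simps scale_zero_right)
    then show "(if smul (sub_space M L) a x \<in> L then g (smul (sub_space M L) a x, 0, 0) else 0) =
        smul scalars a (if x \<in> L then g (x, 0, 0) else 0)"
      using gD(2)[of "(x, 0, 0)" a] zU subspace_ofD(5)[OF L_subspace] x by simp
  qed auto
  from N_dual_L(2)[OF this] obtain z where z: "z \<in> N" "\<forall>l\<in>L. h z l = g (l, 0, 0)" by auto
  have "(\<lambda>a. if a \<in> U then g (0, a, 0) else 0) \<in> lin_hom P scalars"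
  proof (rule lin_homI)
    fix x y assume xy: "x \<in> carrier P" "y \<in> carrier P"
    then show "(if x + y \<in> U then g (0, x + y, 0) else 0) =
        (if x \<in> U then g (0, x, 0) else 0) + (if y \<in> U then g (0, y, 0) else 0)"
      using gD(1)[of "(0, x, 0)" "(0, y, 0)"] zL subspace_ofD(4)[OF U_subspace] by (simp add: P(2))
  next
    fix a x assume x: "x \<in> carrier P"
    have "(\<lambda>u. (0 :: 'v \<Rightarrow> 'a) u * bar a) = 0" by (simp add: fun_eq_iff)
    then have "smul T a (0, x, 0) = (0, smul M a x, 0)"
      by (simp only: T_def P_def sum_space_simps hyp_space_simps sub_space_simps scale_zero_right)
    then show "(if smul P a x \<in> U then g (0, smul P a x, 0) else 0) =
        smul scalars a (if x \<in> U then g (0, x, 0) else 0)"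
      using gD(2)[of "(0, x, 0)" a] zL subspace_ofD(5)[OF U_subspace] x by (simp add: P_def)
  qed (auto simp: P(2))
  from Y_represents[OF this] obtain y where y: "y \<in> Y" "\<forall>u\<in>U. h y u = - g (0, u, 0)" by auto
  let ?m = "y + z"
  have mM: "?m \<in> carrier M" using subM(4)[OF YM[OF y(1)] NM[OF z(1)]] .
  have pm: "p ?m = y" using p_proj(3)[OF YL[OF y(1)] z(1)] .
  have mD: "?m \<in> D0" using mM pm y(1) by (simp add: D0_def)
  have "symm \<phi>T (?m, \<pi> ?m, \<gamma> ?m) s = g s" if s: "s \<in> LT" for s
  proof -
    obtain l a where la: "s = (l, a, 0)" "l \<in> L" "a \<in> U" using s by auto
    have "g s = g (l, 0, 0) + g (0, a, 0)"
      using gD(1)[of "(l, 0, 0)" "(0, a, 0)"] la zU zL by simp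
    moreover have "h ?m l = h z l"
      using sesqD(1)[OF h_sesq YM[OF y(1)] NM[OF z(1)] LM[OF la(2)]] h_L[OF YL[OF y(1)] la(2)] by simp
    moreover have "\<gamma> ?m a = - h y a"
      using h_eq_h_p[OF mM UN[OF la(3)]] pm la(3) by (simp add: \<gamma>_def)
    ultimately show ?thesis using z(2) y(2) la by (simp add: symm_\<phi>T)
  qed
  then show ?thesis using K_mem[OF mD] by blast
qed

lemma boundary_of_stabilisation:
  fixes L' :: "('a, 'w::ab_group_add) space"
  assumes "fg_space L'" "j \<in> lin_iso L' (sub_space T LT)"
  shows "\<exists>\<rho>\<in>form_hom bar L'.
    qf_isomorphic bar e (qf_sum bar e (qf M \<phi> L V) (trivial_formation bar e P)) (boundary bar e L' \<rho>)"
  unfolding qf_sum_eq_T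
  using boundary_splitting[OF fg_T sesq_\<phi>T LT_K_complementary VT_K_complementary LT_null K_null
      K_LT_injective K_LT_surjective assms] by blast

end

section \<open>Elementary representatives\<close>

context sign_involution
begin

lemma stable_boundary:
  fixes M :: "('a, 'a univ) space"
  assumes "fg_space M" "sesq M \<phi>" "is_quasi_formation bar e (qf M \<phi> L V)"
  shows "\<exists>(P :: ('a, 'a univ) space) (K :: ('a, 'a univ) space). \<exists>\<rho>\<in>form_hom bar K. fg_space P \<and> fg_space K \<and>
    qf_isomorphic bar e (qf_sum bar e (qf M \<phi> L V) (trivial_formation bar e P)) (boundary bar e K \<rho>)"
proof -
  have nd: "nondegenerate M (symm \<phi>)" and L: "subspace_of M L"
    and perp: "\<forall>x\<in>carrier M. x \<in> L \<longleftrightarrow> (\<forall>y\<in>L. symm \<phi> x y = 0)"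
    and null: "null_on (sub_space M L) \<phi>"
    and V: "subspace_of M V" "2 * rank (sub_space M V) = rank M"
    using assms(3) unfolding is_quasi_formation_qf_iff[OF assms(1,2)] by blast+
  obtain N where N: "complementary M L N" "null_on (sub_space M N) \<phi>"
    using lagrangian_complement_exists[OF assms(1,2) nd L perp null] by blast
  interpret S: split_lagrangian bar e M \<phi> L N
    by unfold_locales (use assms(1,2) nd N perp null in auto)
  obtain Y where Y: "subspace_of M Y" "Y \<subseteq> L" "\<forall>v\<in>V. S.p v \<in> Y \<longrightarrow> S.p v = 0"
    "\<forall>l\<in>L. \<exists>v\<in>V. \<exists>y\<in>Y. l = S.p v + y"
    "pair S.h Y (V \<inter> N) \<in> lin_iso (sub_space M Y) (dual bar (sub_space M (V \<inter> N)))"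
    "pair S.h (V \<inter> N) Y \<in> lin_iso (sub_space M (V \<inter> N)) (dual bar (sub_space M Y))"
    using S.dual_common_complement_exists[OF V] by blast
  interpret D: dual_complement bar e M \<phi> L N V Y
    by unfold_locales (use V(1) Y in blast)+
  obtain L' :: "('a, 'a univ) space" and j where L': "fg_space L'" "j \<in> lin_iso L' (sub_space D.T D.LT)"
    using univ_copy_exists[OF fg_sub_space[OF D.fg_T D.LT_subspace]] by blast
  show ?thesis using D.boundary_of_stabilisation[OF L'] D.P(1) L'(1) by blast
qed

text \<open>\<open>G\<close> is the copy, on the type of coordinate vectors, of the boundary that \<open>F\<close> becomes after
stabilisation.\<close>

lemma l_equiv_boundary:
  fixes F :: "('a, 'a univ) quasi_formation"
  assumes "is_quasi_formation bar e F"
  shows "\<exists>G (K :: ('a, 'a univ) space). \<exists>\<rho>\<in>form_hom bar K. fg_space K \<and> l_equiv bar e F G \<and>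
    qf_isomorphic bar e G (boundary bar e K \<rho>)"
proof -
  obtain M \<phi> L V where F: "F = qf M \<phi> L V" "fg_space M" "sesq M \<phi>"
    using is_quasi_formation_qfE[OF assms] by blast
  obtain P K :: "('a, 'a univ) space" and \<rho> where K: "\<rho> \<in> form_hom bar K" "fg_space P" "fg_space K"
    "qf_isomorphic bar e (qf_sum bar e F (trivial_formation bar e P)) (boundary bar e K \<rho>)"
    using stable_boundary[OF F(2,3) assms[unfolded F(1)]] unfolding F(1) by blast
  let ?H = "hyp_space bar K" and ?L = "carrier K \<times> {0}" and ?V = "(\<lambda>x. (x, \<rho> x)) ` carrier K"
  note fgH = fg_hyp_space(1)[OF K(3)] fg_hyp_space(1)[OF K(2)]
  obtain W :: "('a, 'a univ) space" and \<theta> L' V' where W: "fg_space W" "sesq W \<theta>"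
    "is_quasi_formation bar e (qf W \<theta> L' V')"
    "qf_isomorphic bar e (qf W \<theta> L' V') (boundary bar e K \<rho>)"
    "qf_isomorphic bar e (boundary bar e K \<rho>) (qf W \<theta> L' V')"
    using quasi_formation_univ_copy_exists[OF fgH(1) sesq_hyp, of ?L ?V, folded boundary_qf]
      is_quasi_formation_boundary[OF K(3,1)] by blast
  let ?T = "sum_space M (hyp_space bar P)" and ?\<phi> = "\<lambda>x y. \<phi> (fst x) (fst y) + hyp (snd x) (snd y)"
  have fgT: "fg_space ?T" using fg_sum_space(1)[OF F(2) fgH(2)] .
  have sT: "sesq ?T ?\<phi>" by (rule sesq_sum[OF F(3) sesq_hyp])
  have sum: "qf_sum bar e F (trivial_formation bar e P) =
      qf ?T ?\<phi> (L \<times> (carrier P \<times> {0})) (V \<times> ({0} \<times> carrier (dual bar P)))"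
    unfolding F(1) trivial_formation_qf
    by (rule qf_sum_qf[OF fg_space_carrier[OF F(2)] fg_space_carrier[OF fgH(2)] F(3) sesq_hyp])
  have "qf_isomorphic bar e (qf ?T ?\<phi> (L \<times> (carrier P \<times> {0})) (V \<times> ({0} \<times> carrier (dual bar P)))) (qf W \<theta> L' V')"
    using qf_isomorphic_trans[OF fgT sT fgH(1) sesq_hyp W(1,2)] K(4) W(5) unfolding sum boundary_qf by blast
  then have "stably_isomorphic bar e F (qf W \<theta> L' V')"
    using stably_isomorphicI[OF K(2) fgT sT W(1,2) sum] by blast
  then show ?thesis using l_equiv.stable[OF assms W(3)] W(4) K(1,3) by blast
qed

end

theorem corollary5:
  fixes bar :: "'a::field \<Rightarrow> 'a" and q :: nat
  assumes "is_involution bar"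
    and "q \<ge> 1"
    and "CHAR('a) \<noteq> 2 \<or> card (UNIV :: 'a set) = 2"
  shows "\<forall>X \<in> carrier (l_monoid bar q). elementary bar q X"
proof
  fix X assume "X \<in> carrier (l_monoid bar q)"
  then obtain F where F: "is_quasi_formation bar ((- 1) ^ q) F"
    "X = {(F, G). l_equiv bar ((- 1) ^ q) F G} `` {F}"
    by (auto simp: l_monoid_def Let_def elim!: quotientE)
  interpret involution bar by unfold_locales (fact assms(1))
  interpret sign_involution bar "(- 1) ^ q"
  proof unfold_locales
    show "(- 1 :: 'a) ^ q * (- 1) ^ q = 1" by (simp flip: power_mult_distrib)
    show "bar ((- 1) ^ q) = (- 1) ^ q" by (induction q) simp_all
  qed
  show "elementary bar q X"
    unfolding elementary_def F(2) using l_equiv_boundary[OF F(1)] by blast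
qed

end
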